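(* Let $G$ be a Fuchsian group of the first kind with a cusp at $\infty$, let $H$ be any finite index subgroup of $G$, with $[G:H]=m$, let $\rho:H\to\mathrm{GL}_d(\mathbb{C})$ be a rank $d$ admissible representation of $H$, and let $w$ be an even integer. Then there is a natural $R_G$-module isomorphism between $\mathcal{M}^!_w(\rho)$ and $\mathcal{M}^!_w(\widetilde\rho)$, where the induced representation $\widetilde\rho=\mathrm{Ind}_H^G(\rho)$ is an admissible representation of $G$ of rank $dm$.
   Context: $\mathrm{PSL}_2(\mathbb{R})$ acts by Möbius transformations on the upper half plane $\mathbb{H}$ and on $\mathbb{R}\cup\{\infty\}$; for $\gamma=\pm\begin{pmatrix}a&b\\c&d\end{pmatrix}$ write $j(\gamma,\tau)=c\tau+d$ (even powers are well defined). A Fuchsian group of the first kind is a discrete subgroup of $\mathrm{PSL}_2(\mathbb{R})$ having a fundamental domain in $\mathbb{H}$ of finite hyperbolic area. A cusp is a point of $\mathbb{R}\cup\{\infty\}$ fixed by a nontrivial parabolic element of the group. Let $\Gamma$ be a Fuchsian group of the first kind with a cusp at $\infty$ (below, $\Gamma=G$ or $\Gamma=H$). Put $t^{h}=\pm\begin{pmatrix}1&h\\0&1\end{pmatrix}$, $A_\infty=I$ and, for $\mathfrak{c}\in\mathbb{R}$, $A_{\mathfrak{c}}=\pm\begin{pmatrix}\mathfrak{c}&-1\\1&0\end{pmatrix}$. For a cusp $\mathfrak{c}$ of $\Gamma$, the stabilizer of $\mathfrak{c}$ in $\Gamma$ is infinite cyclic, generated by $t_{\mathfrak{c}}=A_{\mathfrak{c}}t^{h_{\mathfrak{c}}}A_{\mathfrak{c}}^{-1}$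 with $h_{\mathfrak{c}}>0$ the smallest positive real number for which this element lies in $\Gamma$. Put $\widetilde q_{\mathfrak{c}}=\exp(2\pi\mathrm{i}\,A_{\mathfrak{c}}^{-1}\tau/h_{\mathfrak{c}})$ and $\widetilde q=\widetilde q_\infty$. Admissible representation: $\rho:\Gamma\to\mathrm{GL}_d(\mathbb{C})$ is admissible if (1) $\rho(t_\infty)$ is a diagonal matrix, $\rho(t_\infty)=\exp(2\pi\mathrm{i}\Lambda)$ with $\Lambda$ diagonal, and (2) $\rho(t_{\mathfrak{c}})$ is diagonalizable for every cusp $\mathfrak{c}\neq\infty$ in a set of representatives of the $\Gamma$-inequivalent cusps, i.e. $\mathcal{P}_{\mathfrak{c}}^{-1}\rho(t_{\mathfrak{c}})\mathcal{P}_{\mathfrak{c}}=\exp(2\pi\mathrm{i}\Lambda_{\mathfrak{c}})$ with $\mathcal{P}_{\mathfrak{c}}\in\mathrm{GL}_d(\mathbb{C})$ and $\Lambda_{\mathfrak{c}}$ diagonal. The exponent matrices $\Lambda,\Lambda_{\mathfrak{c}}$ are defined up to changing diagonal entries by integers, and are normalized so that $0\le(\Lambda_{\mathfrak{c}})_{\xi\xi}<1$ for all $1\le\xi\le d$. Weakly holomorphic vector-valued modular forms: for even $w$ and admissible $\rho:\Gamma\to\mathrm{GL}_d(\mathbb{C})$, $\mathcal{M}^!_w(\rho)$ is the set of holomorphic functions $\mathbb{X}:\mathbb{H}\to\mathbb{C}^d$ such that $\mathbb{X}(\gamma\tau)=\rho(\gamma)j(\gamma,\tau)^w\mathbb{X}(\tau)$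 for all $\gamma\in\Gamma$, $\tau\in\mathbb{H}$, and which have expansions $\mathbb{X}(\tau)=\widetilde q^{\,\Lambda}\sum_{n\ge-M}\mathbb{X}_{[n]}\widetilde q^{\,n}$ at the cusp $\infty$ and $\mathbb{X}(\tau)=(\tau-\mathfrak{c})^{-w}\mathcal{P}_{\mathfrak{c}}\,\widetilde q_{\mathfrak{c}}^{\,\Lambda_{\mathfrak{c}}}\mathcal{P}_{\mathfrak{c}}^{-1}\sum_{n\ge-M_{\mathfrak{c}}}\mathbb{X}^{\mathfrak{c}}_{[n]}\widetilde q_{\mathfrak{c}}^{\,n}$ at each cusp $\mathfrak{c}\neq\infty$, with coefficients in $\mathbb{C}^d$. $R_G=\mathcal{M}^!_0(1)$ is the ring of scalar-valued weakly holomorphic modular (automorphic) functions of weight $0$ for $G$ with trivial multiplier; it acts on $\mathcal{M}^!_w(\rho)$ and $\mathcal{M}^!_w(\widetilde\rho)$ by multiplication. Induced representation: write $G=\gamma_1H\cup\cdots\cup\gamma_mH$ (disjoint), with $\gamma_1=1$, and extend $\rho$ to $G$ by $\rho(x)=0$ for $x\notin H$. Then $\widetilde\rho(x)$ is the $dm\times dm$ matrix whose $(i,j)$ block of size $d\times d$ is $\rho(\gamma_i^{-1}x\gamma_j)$.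
   Formalization: Since ρ̃(t_∞) need not be diagonal, ρ̃ is taken up to change of basis: P⁻¹ρ̃P is admissible for some P in GL_dm(C), and for every such P the isomorphism is onto M^!_w(P⁻¹ρ̃P). Exponents may be complex, normalized by 0 ≤ Re < 1. *)

theory Defs
  imports
    "HOL-Complex_Analysis.Complex_Analysis"
    "HOL-Algebra.Left_Coset"
    "HOL-Algebra.Module"
begin

section \<open>The group PSL(2,R) and its actions\<close>

definition SL2R :: "(real^2^2) monoid" where
  "SL2R = \<lparr>carrier = {A. det A = 1}, monoid.mult = (**), one = mat 1\<rparr>"

text \<open>An element of the quotient is a coset, i.e. a two-element set \<open>{A, -A}\<close> of matrices.\<close>

type_synonym psl = "(real^2^2) set"

definition PSL2R :: "psl monoid" where
  "PSL2R = SL2R Mod {mat 1, - mat 1}"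

definition pm_mat :: "real \<Rightarrow> real \<Rightarrow> real \<Rightarrow> real \<Rightarrow> psl" where
  "pm_mat a b c d = (let A = vector [vector [a, b], vector [c, d]] in {A, - A})"

text \<open>A matrix representing an element of PSL(2,R). The notions below do not depend on the
  sign of the choice; for the automorphy factor \<open>aut_j\<close> this holds for its even powers.\<close>

definition rep :: "psl \<Rightarrow> real^2^2" where
  "rep \<gamma> = (SOME A. A \<in> \<gamma>)"

definition uhp :: "complex set" where
  "uhp = {\<tau>. Im \<tau> > 0}"

definition aut_j :: "psl \<Rightarrow> complex \<Rightarrow> complex" where
  "aut_j \<gamma> \<tau> = of_real (rep \<gamma> $ 2 $ 1) * \<tau> + of_real (rep \<gamma> $ 2 $ 2)"

definition moebius :: "psl \<Rightarrow> complex \<Rightarrow> complex" where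
  "moebius \<gamma> \<tau> = (of_real (rep \<gamma> $ 1 $ 1) * \<tau> + of_real (rep \<gamma> $ 1 $ 2)) / aut_j \<gamma> \<tau>"

datatype bpoint = Finite real | Infty

fun bact :: "psl \<Rightarrow> bpoint \<Rightarrow> bpoint" where
  "bact \<gamma> Infty =
     (if rep \<gamma> $ 2 $ 1 = 0 then Infty else Finite (rep \<gamma> $ 1 $ 1 / rep \<gamma> $ 2 $ 1))"
| "bact \<gamma> (Finite x) =
     (if rep \<gamma> $ 2 $ 1 * x + rep \<gamma> $ 2 $ 2 = 0 then Infty
      else Finite ((rep \<gamma> $ 1 $ 1 * x + rep \<gamma> $ 1 $ 2) / (rep \<gamma> $ 2 $ 1 * x + rep \<gamma> $ 2 $ 2)))"

section \<open>Fuchsian groups of the first kind and their cusps\<close>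

definition fundamental_domain :: "psl set \<Rightarrow> complex set \<Rightarrow> bool" where
  "fundamental_domain \<Gamma> F \<longleftrightarrow>
     F \<in> sets lebesgue \<and> F \<subseteq> uhp \<and> (\<Union>\<gamma>\<in>\<Gamma>. moebius \<gamma> ` F) = uhp \<and>
     (\<forall>\<gamma>\<in>\<Gamma>. \<gamma> \<noteq> \<one>\<^bsub>PSL2R\<^esub> \<longrightarrow> negligible (F \<inter> moebius \<gamma> ` F))"

definition hyperbolic_area :: "complex set \<Rightarrow> ennreal" where
  "hyperbolic_area F = (\<integral>\<^sup>+ z\<in>F. ennreal (1 / (Im z)\<^sup>2) \<partial>lebesgue)"

text \<open>The union of \<open>\<Gamma>\<close>, a set of cosets, is its preimage in SL(2,R). As the projection
  is a two-sheeted covering, discreteness of that preimage in the space of matrices is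
  discreteness of \<open>\<Gamma>\<close> in PSL(2,R).\<close>

definition fuchsian_first_kind :: "psl set \<Rightarrow> bool" where
  "fuchsian_first_kind \<Gamma> \<longleftrightarrow>
     subgroup \<Gamma> PSL2R \<and> discrete (\<Union>\<Gamma>) \<and>
     (\<exists>F. fundamental_domain \<Gamma> F \<and> hyperbolic_area F < \<infinity>)"

definition parabolic :: "psl \<Rightarrow> bool" where
  "parabolic \<gamma> \<longleftrightarrow>
     \<gamma> \<in> carrier PSL2R \<and> \<gamma> \<noteq> \<one>\<^bsub>PSL2R\<^esub> \<and> \<bar>trace (rep \<gamma>)\<bar> = 2"

definition cusp :: "psl set \<Rightarrow> bpoint \<Rightarrow> bool" where
  "cusp \<Gamma> c \<longleftrightarrow> (\<exists>\<gamma>\<in>\<Gamma>. parabolic \<gamma> \<and> bact \<gamma> c = c)"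

definition cusp_representatives :: "psl set \<Rightarrow> bpoint set \<Rightarrow> bool" where
  "cusp_representatives \<Gamma> C \<longleftrightarrow>
     (\<forall>c\<in>C. cusp \<Gamma> c) \<and> Infty \<in> C \<and>
     (\<forall>c. cusp \<Gamma> c \<longrightarrow> (\<exists>!c'. c' \<in> C \<and> (\<exists>\<gamma>\<in>\<Gamma>. bact \<gamma> c' = c)))"

fun cusp_mat :: "bpoint \<Rightarrow> psl" where
  "cusp_mat Infty = \<one>\<^bsub>PSL2R\<^esub>"
| "cusp_mat (Finite x) = pm_mat x (-1) 1 0"

definition cusp_translation :: "bpoint \<Rightarrow> real \<Rightarrow> psl" where
  "cusp_translation c h =
     cusp_mat c \<otimes>\<^bsub>PSL2R\<^esub> pm_mat 1 h 0 1 \<otimes>\<^bsub>PSL2R\<^esub> inv\<^bsub>PSL2R\<^esub> (cusp_mat c)"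

definition cusp_width :: "psl set \<Rightarrow> bpoint \<Rightarrow> real" where
  "cusp_width \<Gamma> c = (LEAST h. 0 < h \<and> cusp_translation c h \<in> \<Gamma>)"

definition cusp_gen :: "psl set \<Rightarrow> bpoint \<Rightarrow> psl" where
  "cusp_gen \<Gamma> c = cusp_translation c (cusp_width \<Gamma> c)"

text \<open>The power \<open>q_c ^ \<alpha>\<close> of the local parameter \<open>q_c = cusp_q \<Gamma> c 1\<close> at the cusp \<open>c\<close>.\<close>

definition cusp_q :: "psl set \<Rightarrow> bpoint \<Rightarrow> complex \<Rightarrow> complex \<Rightarrow> complex" where
  "cusp_q \<Gamma> c \<alpha> \<tau> =
     exp (2 * of_real pi * \<i> * \<alpha> * moebius (inv\<^bsub>PSL2R\<^esub> (cusp_mat c)) \<tau>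
          / of_real (cusp_width \<Gamma> c))"

section \<open>Admissible representations\<close>

definition GL :: "(complex^'d^'d) monoid" where
  "GL = \<lparr>carrier = {A. invertible A}, monoid.mult = (**), one = mat 1\<rparr>"

definition diag :: "('d \<Rightarrow> complex) \<Rightarrow> complex^'d^'d" where
  "diag v = (\<chi> i j. if i = j then v i else 0)"

text \<open>\<open>\<Lambda>\<close> lists the diagonal of the exponent matrix. The eigenvalues of \<open>A\<close> need not
  have modulus 1, so \<open>\<Lambda>\<close> may be non-real; the normalisation then fixes the real parts.\<close>

definition diagonalized_by ::
    "complex^'d^'d \<Rightarrow> complex^'d^'d \<Rightarrow> ('d \<Rightarrow> complex) \<Rightarrow> bool" where
  "diagonalized_by A P \<Lambda> \<longleftrightarrow>
     invertible P \<and>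
     matrix_inv P ** A ** P = diag (\<lambda>\<xi>. exp (2 * of_real pi * \<i> * \<Lambda> \<xi>)) \<and>
     (\<forall>\<xi>. 0 \<le> Re (\<Lambda> \<xi>) \<and> Re (\<Lambda> \<xi>) < 1)"

definition admissible :: "psl set \<Rightarrow> (psl \<Rightarrow> complex^'d^'d) \<Rightarrow> bool" where
  "admissible \<Gamma> \<rho> \<longleftrightarrow>
     \<rho> \<in> hom (PSL2R\<lparr>carrier := \<Gamma>\<rparr>) GL \<and>
     (\<exists>\<Lambda>. diagonalized_by (\<rho> (cusp_gen \<Gamma> Infty)) (mat 1) \<Lambda>) \<and>
     (\<exists>C. cusp_representatives \<Gamma> C \<and>
        (\<forall>c\<in>C - {Infty}. \<exists>P \<Lambda>. diagonalized_by (\<rho> (cusp_gen \<Gamma> c)) P \<Lambda>))"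

section \<open>Weakly holomorphic vector-valued modular forms\<close>

fun cusp_factor :: "int \<Rightarrow> bpoint \<Rightarrow> complex \<Rightarrow> complex" where
  "cusp_factor w Infty \<tau> = 1"
| "cusp_factor w (Finite x) \<tau> = (\<tau> - of_real x) powi (- w)"

definition has_cusp_expansion ::
    "psl set \<Rightarrow> int \<Rightarrow> bpoint \<Rightarrow> complex^'d^'d \<Rightarrow> ('d \<Rightarrow> complex) \<Rightarrow> (complex \<Rightarrow> complex^'d) \<Rightarrow> bool"
  where
  "has_cusp_expansion \<Gamma> w c P \<Lambda> X \<longleftrightarrow>
     (\<exists>(M::int) (a :: int \<Rightarrow> complex^'d). \<forall>\<tau>\<in>uhp. \<exists>S.
        ((\<lambda>n. cusp_q \<Gamma> c (of_int n) \<tau> *s a n) has_sum S) {- M..} \<and>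
        X \<tau> = cusp_factor w c \<tau> *s
               ((P ** diag (\<lambda>\<xi>. cusp_q \<Gamma> c (\<Lambda> \<xi>) \<tau>) ** matrix_inv P) *v S))"

text \<open>Functions on the upper half plane are represented by functions on \<open>complex\<close> that vanish
  off it, so that equality of forms is equality of functions. The matrix
  \<open>P diag(q_c ^ \<Lambda>) P^(-1)\<close> does not depend on the choice of the normalised pair \<open>P\<close>, \<open>\<Lambda>\<close>.\<close>

definition wh_forms ::
    "psl set \<Rightarrow> int \<Rightarrow> (psl \<Rightarrow> complex^'d^'d) \<Rightarrow> (complex \<Rightarrow> complex^'d) set" where
  "wh_forms \<Gamma> w \<rho> =
     {X. (\<forall>\<tau>. \<tau> \<notin> uhp \<longrightarrow> X \<tau> = 0) \<and>
         (\<forall>\<xi>. (\<lambda>\<tau>. X \<tau> $ \<xi>) holomorphic_on uhp) \<and>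
         (\<forall>\<gamma>\<in>\<Gamma>. \<forall>\<tau>\<in>uhp. X (moebius \<gamma> \<tau>) = (aut_j \<gamma> \<tau> powi w) *s (\<rho> \<gamma> *v X \<tau>)) \<and>
         (\<exists>\<Lambda>. diagonalized_by (\<rho> (cusp_gen \<Gamma> Infty)) (mat 1) \<Lambda> \<and>
              has_cusp_expansion \<Gamma> w Infty (mat 1) \<Lambda> X) \<and>
         (\<forall>c. cusp \<Gamma> c \<and> c \<noteq> Infty \<longrightarrow>
              (\<exists>P \<Lambda>. diagonalized_by (\<rho> (cusp_gen \<Gamma> c)) P \<Lambda> \<and>
                     has_cusp_expansion \<Gamma> w c P \<Lambda> X))}"

text \<open>Scalar functions are identified with functions into the one-dimensional space
  \<open>complex^1\<close>. The unit is the constant 1 on the upper half plane.\<close>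

definition fun_ring :: "psl set \<Rightarrow> (complex \<Rightarrow> complex) ring" where
  "fun_ring \<Gamma> =
     \<lparr>carrier = {f. (\<lambda>\<tau>. (\<chi> i. f \<tau>) :: complex^1) \<in> wh_forms \<Gamma> 0 (\<lambda>_. mat 1)},
      monoid.mult = (\<lambda>f g \<tau>. f \<tau> * g \<tau>), one = (\<lambda>\<tau>. if \<tau> \<in> uhp then 1 else 0),
      zero = (\<lambda>_. 0), add = (\<lambda>f g \<tau>. f \<tau> + g \<tau>)\<rparr>"

text \<open>The fields \<open>mult\<close> and \<open>one\<close> of a module record carry no meaning.\<close>

definition wh_module ::
    "psl set \<Rightarrow> int \<Rightarrow> (psl \<Rightarrow> complex^'d^'d) \<Rightarrow>
     (complex \<Rightarrow> complex, complex \<Rightarrow> complex^'d) module" where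
  "wh_module \<Gamma> w \<rho> =
     \<lparr>carrier = wh_forms \<Gamma> w \<rho>, monoid.mult = undefined, one = undefined,
      zero = (\<lambda>_. 0), add = (\<lambda>X Y \<tau>. X \<tau> + Y \<tau>), smult = (\<lambda>f X \<tau>. f \<tau> *s X \<tau>)\<rparr>"

definition module_iso ::
    "('r, 'k) ring_scheme \<Rightarrow> ('r, 'a, 'l) module_scheme \<Rightarrow> ('r, 'b, 'n) module_scheme \<Rightarrow>
     ('a \<Rightarrow> 'b) \<Rightarrow> bool" where
  "module_iso R M N \<Phi> \<longleftrightarrow>
     module R M \<and> module R N \<and> bij_betw \<Phi> (carrier M) (carrier N) \<and>
     (\<forall>x\<in>carrier M. \<forall>y\<in>carrier M. \<Phi> (x \<oplus>\<^bsub>M\<^esub> y) = \<Phi> x \<oplus>\<^bsub>N\<^esub> \<Phi> y) \<and>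
     (\<forall>r\<in>carrier R. \<forall>x\<in>carrier M. \<Phi> (r \<odot>\<^bsub>M\<^esub> x) = r \<odot>\<^bsub>N\<^esub> \<Phi> x)"

section \<open>Induction\<close>

text \<open>Cosets are numbered by a finite type \<open>'m\<close>, with \<open>i1\<close> as the first index; matrices of
  size \<open>d m\<close> are indexed by the pairs of a block number and an index within the block.\<close>

definition coset_representatives ::
    "psl set \<Rightarrow> psl set \<Rightarrow> 'm \<Rightarrow> ('m \<Rightarrow> psl) \<Rightarrow> bool" where
  "coset_representatives G H i1 \<gamma> \<longleftrightarrow>
     (\<forall>i. \<gamma> i \<in> G) \<and> \<gamma> i1 = \<one>\<^bsub>PSL2R\<^esub> \<and>
     G = (\<Union>i. \<gamma> i <#\<^bsub>PSL2R\<^esub> H) \<and> disjoint_family (\<lambda>i. \<gamma> i <#\<^bsub>PSL2R\<^esub> H)"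

definition induced_rep ::
    "psl set \<Rightarrow> ('m::finite \<Rightarrow> psl) \<Rightarrow> (psl \<Rightarrow> complex^'d::finite^'d) \<Rightarrow>
     psl \<Rightarrow> complex^('m \<times> 'd)^('m \<times> 'd)" where
  "induced_rep H \<gamma> \<rho> x =
     (\<chi> r s. (let y = inv\<^bsub>PSL2R\<^esub> (\<gamma> (fst r)) \<otimes>\<^bsub>PSL2R\<^esub> x \<otimes>\<^bsub>PSL2R\<^esub> \<gamma> (fst s)
               in if y \<in> H then \<rho> y $ snd r $ snd s else 0))"

text \<open>The natural map sends \<open>X\<close> to the column of its slashes by the inverses of the coset
  representatives; its block at \<open>i1\<close> is \<open>X\<close> itself.\<close>

definition slash :: "int \<Rightarrow> (complex \<Rightarrow> complex^'d) \<Rightarrow> psl \<Rightarrow> complex \<Rightarrow> complex^'d" where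
  "slash w X g \<tau> = (if \<tau> \<in> uhp then (aut_j g \<tau> powi (- w)) *s X (moebius g \<tau>) else 0)"

definition lift_form ::
    "int \<Rightarrow> ('m::finite \<Rightarrow> psl) \<Rightarrow> (complex \<Rightarrow> complex^'d::finite) \<Rightarrow>
     complex \<Rightarrow> complex^('m \<times> 'd)" where
  "lift_form w \<gamma> X \<tau> = (\<chi> r. slash w X (inv\<^bsub>PSL2R\<^esub> (\<gamma> (fst r))) \<tau> $ snd r)"

definition conj_rep ::
    "complex^'n^'n \<Rightarrow> (psl \<Rightarrow> complex^'n^'n) \<Rightarrow> psl \<Rightarrow> complex^'n^'n" where
  "conj_rep P \<rho> x = matrix_inv P ** \<rho> x ** P"

end

theory Submission
  imports Defs
begin

text \<open>The isomorphism is Frobenius reciprocity for automorphic forms. A form \<open>X\<close> for \<open>H\<close> is sent to the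
column whose \<open>i\<close>-th block is the slash of \<open>X\<close> by \<open>\<gamma> i\<inverse>\<close>. For \<open>g \<in> G\<close> one has
\<open>\<gamma> i\<inverse> g = y \<gamma> j\<inverse>\<close> with a unique \<open>j\<close> and \<open>y = \<gamma> i\<inverse> g \<gamma> j \<in> H\<close>, so slashing the column by \<open>g\<close> permutes
its blocks and multiplies them by the matrices \<open>\<rho> y\<close>: this is the action of the induced
representation (\<open>slash_lift_form\<close>). The inverse map keeps the block at the index \<open>i1\<close> of the trivial
coset; the transformation law under \<open>\<gamma> i\<inverse>\<close> recovers block \<open>i\<close> from that block
(\<open>block_i1_in_wh_forms\<close>). Changing the basis by \<open>P\<close> is harmless throughout.

The delicate condition is the expansion at each cusp, since the local parameter, the exponents and
the diagonalizing matrix differ between \<open>G\<close> and \<open>H\<close> and from one cusp to another. It is replaced by a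
condition that mentions neither the group nor the representation. Slash \<open>X\<close> by the matrix of the
cusp \<open>c\<close>, so that the cusp moves to infinity. If \<open>X\<close> is holomorphic and obeys the transformation law
under the least translation at \<open>c\<close>, then it has an expansion at \<open>c\<close> exactly when the slashed
function grows at most exponentially in the imaginary part on vertical strips
(\<open>has_cusp_expansion_iff_growth\<close>). Indeed the eigencomponents, multiplied by the inverse fractional
powers of the local parameter, are periodic, and a periodic holomorphic function on the half
plane is a holomorphic function on the punctured disc, for which exponential growth says that the
singularity at the centre is at most a pole. Moderate growth is visibly stable under sums,
products, constant matrices and the slash operators, and \<open>G\<close> and \<open>H\<close> have the same cusps. So
\<open>wh_forms_iff_growth\<close> reduces every closure property, those making the spaces of forms modules
included, to a formal verification.

Admissibility of the induced representation is a statement about eigenvectors. Let \<open>t\<close> be the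
least translation in \<open>G\<close> at a cusp \<open>c\<close>. For each \<open>i\<close> some power \<open>t ^ n\<close> has \<open>\<gamma> i\<inverse> t ^ n \<gamma> i \<in> H\<close>, and this element is
a power of the least translation in \<open>H\<close> at the cusp \<open>\<gamma> i\<inverse> c\<close>, because discreteness makes the widths at a cusp
the multiples of the least one. Hence the eigenvectors of its matrix under \<open>\<rho>\<close>, placed in block \<open>i\<close>,
are eigenvectors of the \<open>n\<close>-th power of the induced matrix of \<open>t\<close> with nonzero eigenvalue, and over
the complex numbers such a vector is a sum of eigenvectors of the matrix itself
(\<open>eigenvector_power_in_span\<close>). Therefore the induced matrix of \<open>t\<close> has a spanning set of
eigenvectors, and conjugating by a diagonalizing matrix at infinity makes the induced
representation admissible.\<close>

no_notation fps_nth (infixl "$" 75)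

section \<open>Diagonalizable complex matrices\<close>

lemma matrix_inv_cancel:
  fixes P :: "complex^'n^'n"
  assumes "invertible P"
  shows "P ** matrix_inv P = mat 1" "matrix_inv P ** P = mat 1"
proof -
  have "\<exists>B. P ** B = mat 1 \<and> B ** P = mat 1"
    using assms by (simp add: invertible_def)
  from someI_ex[OF this] show "P ** matrix_inv P = mat 1" "matrix_inv P ** P = mat 1"
    by (simp_all add: matrix_inv_def)
qed

lemma invertible_matrix_inv:
  fixes P :: "complex^'n^'n"
  assumes "invertible P" shows "invertible (matrix_inv P)"
  unfolding invertible_def using matrix_inv_cancel[OF assms] by blast

lemma matrix_inv_vector_cancel:
  fixes P :: "complex^'n^'n"
  assumes "invertible P"
  shows "P *v (matrix_inv P *v v) = v" "matrix_inv P *v (P *v v) = v"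
  using matrix_inv_cancel[OF assms] by (simp_all add: matrix_vector_mul_assoc)

lemma matrix_inv_one: "matrix_inv (mat 1 :: complex^'n^'n) = mat 1"
  using matrix_inv_cancel(1)[of "mat 1 :: complex^'n^'n"]
  by (metis invertible_def matrix_mul_lid)

lemma invertible_mat_1: "invertible (mat 1 :: complex^'n^'n)"
  unfolding invertible_def by (rule exI[of _ "mat 1"]) simp

lemma matrix_inv_eqI:
  fixes A B :: "complex^'n^'n"
  assumes "B ** A = mat 1"
  shows "matrix_inv A = B"
proof -
  have A: "invertible A" using assms invertible_left_inverse by blast
  have "B = B ** (A ** matrix_inv A)" using matrix_inv_cancel(1)[OF A] by simp
  also have "\<dots> = matrix_inv A" by (simp add: matrix_mul_assoc assms)
  finally show ?thesis by simp
qed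

lemma matrix_vector_sum_right:
  fixes A :: "'a::comm_semiring_1^'n^'m"
  shows "A *v (\<Sum>i\<in>I. f i) = (\<Sum>i\<in>I. A *v f i)"
  by (induction I rule: infinite_finite_induct) (simp_all add: matrix_vector_right_distrib)

lemma diag_mult_vector: "diag v *v u = (\<chi> i. v i * u $ i)"
proof -
  have "(\<Sum>j\<in>UNIV. (if i = j then v i else 0) * u $ j) = v i * u $ i" for i
    by (subst sum.mono_neutral_right[of _ "{i}"]) auto
  then show ?thesis by (simp add: diag_def matrix_vector_mult_def vec_eq_iff)
qed

lemma matrix_mult_diag: "P ** diag v = (\<chi> i j. P $ i $ j * v j)"
proof -
  have "(\<Sum>k\<in>UNIV. P $ i $ k * (if k = j then v k else 0)) = P $ i $ j * v j" for i j
    by (subst sum.mono_neutral_right[of _ "{j}"]) auto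
  then show ?thesis by (simp add: diag_def matrix_matrix_mult_def vec_eq_iff)
qed

definition eigenvectors :: "complex^'n^'n \<Rightarrow> (complex^'n) set" where
  "eigenvectors A = {v. \<exists>\<mu>. A *v v = \<mu> *s v}"

text \<open>Spanning by eigenvectors is preferred to an eigenbasis: it is checked one vector at a time and
  passes through linear maps, which is how it is established for induced representations.\<close>

definition diagonalizable :: "complex^'n^'n \<Rightarrow> bool" where
  "diagonalizable A \<longleftrightarrow> vec.span (eigenvectors A) = UNIV"

text \<open>The tool for transporting spanning sets of eigenvectors along a change of basis or the
  inclusion of a block.\<close>

lemma span_matrix_image:
  fixes T :: "complex^'n^'m"
  assumes "u \<in> vec.span E" and "\<And>v. v \<in> E \<Longrightarrow> T *v v \<in> vec.span F"
  shows "T *v u \<in> vec.span F"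
  using assms(1)
proof (induction rule: vec.span_induct)
  case base
  then show ?case
    by (auto simp: vec.subspace_def matrix_vector_right_distrib vector_scalar_commute
        vec.span_zero vec.span_add vec.span_scale)
next
  case (step v)
  then show ?case using assms(2) by simp
qed

lemma diagonalized_by_imp_diagonalizable:
  fixes A :: "complex^'n^'n"
  assumes "diagonalized_by A P \<Lambda>"
  shows "diagonalizable A"
proof -
  define D where "D = (\<lambda>\<xi>. exp (2 * of_real pi * \<i> * \<Lambda> \<xi>))"
  have P: "invertible P" and PD: "matrix_inv P ** A ** P = diag D"
    using assms by (auto simp: diagonalized_by_def D_def)
  have AP: "A ** P = P ** diag D"
    using matrix_inv_cancel[OF P] by (metis PD matrix_mul_assoc matrix_mul_lid)
  have "column j P \<in> eigenvectors A" for j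
  proof -
    have "A *v column j P = D j *s column j P"
      using arg_cong[OF AP[unfolded matrix_mult_diag], of "column j"]
      by (simp add: vec_eq_iff column_def matrix_matrix_mult_def
          matrix_vector_mult_def mult.commute)
    then show ?thesis by (auto simp: eigenvectors_def)
  qed
  then have "columns P \<subseteq> eigenvectors A" by (auto simp: columns_def)
  moreover have "vec.span (columns P) = UNIV"
    using P matrix_right_invertible_span_columns[of P] by (auto simp: invertible_def)
  ultimately show ?thesis
    unfolding diagonalizable_def by (metis top.extremum_uniqueI vec.span_mono)
qed

text \<open>A logarithm of \<open>\<mu>\<close> is determined up to integers after division by \<open>2 \<pi> \<i>\<close>, so its real part can
  be moved into the unit interval.\<close>

lemma exists_normalized_log:
  assumes "\<mu> \<noteq> 0"
  shows "\<exists>l. exp (2 * of_real pi * \<i> * l) = \<mu> \<and> 0 \<le> Re l \<and> Re l < 1"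
proof -
  define z where "z = Ln \<mu> / (2 * of_real pi * \<i>)"
  define l where "l = z - of_int \<lfloor>Re z\<rfloor>"
  have "exp (2 * of_real pi * \<i> * l) = exp (Ln \<mu>) / exp (of_int (2 * \<lfloor>Re z\<rfloor>) * of_real pi * \<i>)"
    by (simp add: l_def z_def algebra_simps exp_diff)
  also have "exp (of_int (2 * \<lfloor>Re z\<rfloor>) * of_real pi * \<i>) = 1"
    by (subst exp_eq_1) auto
  finally have "exp (2 * of_real pi * \<i> * l) = \<mu>" using assms by simp
  moreover have "0 \<le> Re l" "Re l < 1" by (simp_all add: l_def) linarith+
  ultimately show ?thesis by blast
qed

text \<open>A basis is selected from the spanning set of eigenvectors; invertibility of \<open>A\<close> makes the
  eigenvalues nonzero, hence exponentials.\<close>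

lemma diagonalizable_imp_diagonalized_by:
  fixes A :: "complex^'n^'n"
  assumes "diagonalizable A" "invertible A"
  shows "\<exists>P \<Lambda>. diagonalized_by A P \<Lambda>"
proof -
  obtain B where B: "B \<subseteq> eigenvectors A" "vec.independent B"
      "eigenvectors A \<subseteq> vec.span B" "card B = vec.dim (eigenvectors A)"
    using vec.basis_exists by blast
  have spanB: "vec.span B = UNIV"
    using B(3) assms(1) unfolding diagonalizable_def
    by (metis top.extremum_uniqueI vec.span_mono vec.span_span)
  have "finite B" using B(2) by (rule vec.finiteI_independent)
  moreover have "card B = CARD('n)"
    using B(2) spanB by (metis vec_dim_card vec.dim_span_eq_card_independent)
  ultimately obtain f :: "'n \<Rightarrow> complex^'n" where f: "bij_betw f UNIV B"
    by (metis finite_class.finite_UNIV finite_same_card_bij)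
  have fE: "\<exists>\<mu>. A *v f j = \<mu> *s f j" for j
    using f B(1) by (auto simp: eigenvectors_def bij_betw_def)
  then obtain \<mu> where \<mu>: "\<And>j. A *v f j = \<mu> j *s f j" by metis
  have \<mu>0: "\<mu> j \<noteq> 0" for j
  proof
    assume "\<mu> j = 0"
    then have "A *v f j = 0" using \<mu>[of j] by simp
    then have "f j = 0"
      using matrix_inv_vector_cancel(2)[OF assms(2), of "f j"] by simp
    moreover have "f j \<in> B" using f by (auto simp: bij_betw_def)
    ultimately show False using B(2) vec.dependent_zero by metis
  qed
  obtain \<Lambda> where \<Lambda>: "\<And>j. exp (2 * of_real pi * \<i> * \<Lambda> j) = \<mu> j \<and> 0 \<le> Re (\<Lambda> j) \<and> Re (\<Lambda> j) < 1"
    using exists_normalized_log[OF \<mu>0] by metis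
  define P :: "complex^'n^'n" where "P = (\<chi> i j. f j $ i)"
  have colP: "column j P = f j" for j by (simp add: column_def P_def vec_eq_iff)
  have "columns P = B" using f by (auto simp: columns_def colP bij_betw_def)
  then have P: "invertible P"
    using spanB matrix_right_invertible_span_columns[of P] invertible_right_inverse by metis
  have "A ** P = P ** diag \<mu>"
    unfolding matrix_mult_diag
    using \<mu> by (simp add: vec_eq_iff P_def matrix_matrix_mult_def matrix_vector_mult_def
        mult.commute)
  then have "matrix_inv P ** A ** P = diag \<mu>"
    by (metis P matrix_inv_cancel(2) matrix_mul_assoc matrix_mul_lid)
  then have "diagonalized_by A P \<Lambda>" using P \<Lambda> by (simp add: diagonalized_by_def)
  then show ?thesis by blast
qed

lemma diagonalizable_conj:
  fixes A P :: "complex^'n^'n"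
  assumes "diagonalizable A" "invertible P"
  shows "diagonalizable (matrix_inv P ** A ** P)"
proof -
  have "u \<in> vec.span (eigenvectors (matrix_inv P ** A ** P))" for u
  proof -
    have "matrix_inv P *v (P *v u) \<in> vec.span (eigenvectors (matrix_inv P ** A ** P))"
    proof (rule span_matrix_image[where E = "eigenvectors A"])
      show "P *v u \<in> vec.span (eigenvectors A)" using assms(1) by (simp add: diagonalizable_def)
    next
      fix v assume "v \<in> eigenvectors A"
      then obtain \<mu> where "A *v v = \<mu> *s v" by (auto simp: eigenvectors_def)
      then have "(matrix_inv P ** A ** P) *v (matrix_inv P *v v) = \<mu> *s (matrix_inv P *v v)"
        using assms(2)
        by (simp add: matrix_inv_vector_cancel vector_scalar_commute flip: matrix_vector_mul_assoc)
      then show "matrix_inv P *v v \<in> vec.span (eigenvectors (matrix_inv P ** A ** P))"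
        by (intro vec.span_base) (auto simp: eigenvectors_def)
    qed
    then show ?thesis using assms(2) by (simp add: matrix_inv_vector_cancel)
  qed
  then show ?thesis by (auto simp: diagonalizable_def)
qed

text \<open>Let \<open>\<nu> ^ n = \<mu>\<close>, and let \<open>\<omega>\<close> be a primitive \<open>n\<close>-th root of unity. The averages
  \<open>e k = \<Sum>j<n. (\<nu> \<omega> ^ k) ^ (-j) A ^ j v\<close> are eigenvectors of \<open>A\<close> for the eigenvalues \<open>\<nu> \<omega> ^ k\<close>, and
  orthogonality of the powers of \<open>\<omega>\<close> gives \<open>\<Sum>k<n. e k = n v\<close>. The condition on \<open>\<mu>\<close> is essential: a
  nilpotent matrix has a diagonalizable power.\<close>

lemma eigenvector_power_in_span:
  fixes A :: "complex^'n^'n"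
  assumes n: "n > 0" and \<mu>: "\<mu> \<noteq> 0" and v: "(((*v) A) ^^ n) v = \<mu> *s v"
  shows "v \<in> vec.span (eigenvectors A)"
proof -
  obtain \<nu> where \<nu>: "\<nu> \<noteq> 0" "\<mu> = \<nu> ^ n"
    using exists_complex_root_nonzero[OF \<mu>, of n] n by auto
  define \<omega> where "\<omega> = exp (2 * of_real pi * \<i> / of_nat n)"
  have \<omega>_pow: "\<omega> ^ j = exp (2 * of_real pi * \<i> * of_nat j / of_nat n)" for j
    by (simp add: \<omega>_def mult.commute flip: exp_of_nat_mult)
  have \<omega>n: "\<omega> ^ n = 1" and \<omega>j: "\<And>j. 0 < j \<Longrightarrow> j < n \<Longrightarrow> \<omega> ^ j \<noteq> 1"
    using n by (auto simp: \<omega>_pow complex_root_unity_eq_1 dest: dvd_imp_le)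
  have \<omega>0: "\<omega> \<noteq> 0" by (simp add: \<omega>_def)
  define it where "it = (\<lambda>j. (((*v) A) ^^ j) v)"
  define c where "c = (\<lambda>k. inverse (\<nu> * \<omega> ^ k))"
  define e where "e = (\<lambda>k. \<Sum>j<n. c k ^ j *s it j)"
  have eig: "e k \<in> eigenvectors A" for k
  proof -
    have "(\<omega> ^ k) ^ n = 1" by (metis \<omega>n mult.commute power_mult power_one)
    then have cn: "c k ^ n * \<mu> = 1"
      using \<nu> by (simp add: c_def power_inverse power_mult_distrib)
    have "c k *s (A *v e k) = (\<Sum>j<n. c k ^ Suc j *s it (Suc j))"
      by (simp add: e_def it_def matrix_vector_sum_right vector_scalar_commute
          vec.scale_sum_right vector_smult_assoc)
    also have "it 0 + \<dots> = (\<Sum>j<Suc n. c k ^ j *s it j)"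
      by (subst sum.lessThan_Suc_shift) simp
    also have "\<dots> = e k + (c k ^ n * \<mu>) *s v"
      using v by (simp add: e_def it_def vector_smult_assoc)
    finally have "c k *s (A *v e k) = e k" by (simp add: cn it_def)
    then have "(\<nu> * \<omega> ^ k) *s (c k *s (A *v e k)) = (\<nu> * \<omega> ^ k) *s e k" by simp
    moreover have "(\<nu> * \<omega> ^ k) * c k = 1" using \<nu> \<omega>0 by (simp add: c_def field_simps)
    ultimately have "A *v e k = (\<nu> * \<omega> ^ k) *s e k" by (simp add: vector_smult_assoc)
    then show ?thesis by (auto simp: eigenvectors_def)
  qed
  have geo: "(\<Sum>k<n. c k ^ j) = (if j = 0 then of_nat n else 0)" if "j < n" for j
  proof (cases "j = 0")
    case False
    define x where "x = inverse (\<omega> ^ j)"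
    have "x \<noteq> 1" using \<omega>j[of j] False that by (auto simp: x_def)
    moreover have "(\<omega> ^ j) ^ n = 1" by (metis \<omega>n mult.commute power_mult power_one)
    then have "x ^ n = 1" by (simp add: x_def power_inverse)
    ultimately have "(\<Sum>k<n. x ^ k) = 0" by (simp add: geometric_sum)
    moreover have "c k ^ j = inverse \<nu> ^ j * x ^ k" for k
      by (simp add: c_def x_def power_mult_distrib power_inverse mult.commute
          flip: power_mult)
    ultimately show ?thesis using False by (simp flip: sum_distrib_left)
  qed simp
  have "(\<Sum>k<n. e k) = (\<Sum>j<n. (\<Sum>k<n. c k ^ j) *s it j)"
    unfolding e_def by (subst sum.swap) (simp add: vec.scale_sum_left)
  also have "\<dots> = (\<Sum>j<n. (if j = 0 then of_nat n else 0) *s it j)"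
    by (intro sum.cong refl) (simp add: geo)
  also have "\<dots> = of_nat n *s v"
    using n by (subst sum.mono_neutral_right[of _ "{0}"]) (auto simp: it_def)
  finally have "v = inverse (of_nat n) *s (\<Sum>k<n. e k)"
    using n by (simp add: vector_smult_assoc)
  also have "\<dots> \<in> vec.span (eigenvectors A)"
    by (intro vec.span_scale vec.span_sum vec.span_base eig)
  finally show ?thesis .
qed

section \<open>PSL(2,R) as a group of signed two-by-two matrices\<close>

lemma matrix_mult_minus:
  fixes A B :: "real^'n^'n"
  shows "(- A) ** B = - (A ** B)" "A ** (- B) = - (A ** B)"
  by (simp_all add: matrix_matrix_mult_def vec_eq_iff sum_negf)

lemma group_SL2R: "group SL2R"
proof (rule groupI)
  fix A assume "A \<in> carrier SL2R"
  then have A: "det A = 1" by (simp add: SL2R_def)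
  then obtain B where B: "A ** B = mat 1" "B ** A = mat 1"
    using invertible_det_nz[of A] by (auto simp: invertible_def)
  have "det B = 1" using arg_cong[OF B(1), of det] A by (simp add: det_mul)
  then show "\<exists>B\<in>carrier SL2R. B \<otimes>\<^bsub>SL2R\<^esub> A = \<one>\<^bsub>SL2R\<^esub>"
    using B by (auto simp: SL2R_def)
qed (auto simp: SL2R_def det_mul matrix_mul_assoc)

lemma normal_pm_one: "{mat 1, - mat 1} \<lhd> SL2R"
proof (rule group.normalI[OF group_SL2R])
  have N: "{mat 1, - mat 1} \<subseteq> carrier SL2R"
    by (simp add: SL2R_def det_2 mat_def)
  have mult: "x \<otimes>\<^bsub>SL2R\<^esub> y \<in> {mat 1, - mat 1}"
    if "x \<in> {mat 1, - mat 1}" "y \<in> {mat 1, - mat 1}" for x y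
    using that by (auto simp: SL2R_def matrix_mult_minus)
  have inv: "inv\<^bsub>SL2R\<^esub> x = x" if "x \<in> {mat 1, - mat 1}" for x
  proof (rule group.inv_equality[OF group_SL2R])
    show "x \<otimes>\<^bsub>SL2R\<^esub> x = \<one>\<^bsub>SL2R\<^esub>"
      using that by (auto simp: SL2R_def matrix_mult_minus)
  qed (use that N in blast)+
  show "subgroup {mat 1, - mat 1} SL2R"
  proof (rule group.subgroupI[OF group_SL2R N])
    fix a assume a: "a \<in> {mat 1, - mat 1 :: real^2^2}"
    then show "inv\<^bsub>SL2R\<^esub> a \<in> {mat 1, - mat 1}" by (simp only: inv[OF a])
  qed (use mult in blast)+
  show "\<forall>x\<in>carrier SL2R. {mat 1, - mat 1} #>\<^bsub>SL2R\<^esub> x = x <#\<^bsub>SL2R\<^esub> {mat 1, - mat 1}"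
    by (simp add: r_coset_def l_coset_def SL2R_def matrix_mult_minus)
qed

lemma group_PSL2R: "group PSL2R"
  unfolding PSL2R_def by (rule normal.factorgroup_is_group[OF normal_pm_one])

interpretation PSL: group PSL2R by (rule group_PSL2R)

abbreviation mat22 :: "real \<Rightarrow> real \<Rightarrow> real \<Rightarrow> real \<Rightarrow> real^2^2" where
  "mat22 a b c d \<equiv> vector [vector [a, b], vector [c, d]]"

lemma mat22_mult:
  "mat22 a b c d ** mat22 a' b' c' d' =
     mat22 (a * a' + b * c') (a * b' + b * d') (c * a' + d * c') (c * b' + d * d')"
  by (simp add: vec_eq_iff forall_2 matrix_matrix_mult_def sum_2)

lemma uminus_mat22: "- mat22 a b c d = mat22 (- a) (- b) (- c) (- d)"
  by (simp add: vec_eq_iff forall_2)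

lemma mat_1_mat22: "mat 1 = mat22 1 0 0 1"
  by (simp add: vec_eq_iff forall_2 mat_def)

lemma det_mat22: "det (mat22 a b c d) = a * d - b * c"
  by (simp add: det_2)

lemma mat22_eq_iff: "mat22 a b c d = mat22 a' b' c' d' \<longleftrightarrow> a = a' \<and> b = b' \<and> c = c' \<and> d = d'"
  by (auto simp: vec_eq_iff forall_2)

lemma pm_mat_eq: "pm_mat a b c d = {mat22 a b c d, mat22 (- a) (- b) (- c) (- d)}"
  by (simp add: pm_mat_def Let_def uminus_mat22)

lemma pm_mat_uminus: "pm_mat (- a) (- b) (- c) (- d) = pm_mat a b c d"
  by (auto simp: pm_mat_eq)

lemma carrier_PSL2R: "carrier PSL2R = {pm_mat a b c d | a b c d. a * d - b * c = 1}"
proof -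
  have coset: "{mat 1, - mat 1} #>\<^bsub>SL2R\<^esub> mat22 a b c d = pm_mat a b c d" for a b c d
    by (auto simp: r_coset_def SL2R_def pm_mat_def Let_def matrix_mult_minus)
  have entries: "A = mat22 (A $ 1 $ 1) (A $ 1 $ 2) (A $ 2 $ 1) (A $ 2 $ 2)" for A :: "real^2^2"
    by (simp add: vec_eq_iff forall_2)
  have "g \<in> carrier PSL2R \<longleftrightarrow> (\<exists>A. det A = 1 \<and> g = {mat 1, - mat 1} #>\<^bsub>SL2R\<^esub> A)" for g
    by (auto simp: PSL2R_def FactGroup_def RCOSETS_def SL2R_def)
  also have "\<dots> g \<longleftrightarrow> (\<exists>a b c d. a * d - b * c = 1 \<and> g = pm_mat a b c d)" for g
    by (metis coset entries det_mat22)
  finally have mem: "g \<in> carrier PSL2R \<longleftrightarrow>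
      g \<in> {pm_mat a b c d | a b c d. a * d - b * c = 1}" for g
    unfolding mem_Collect_eq by (simp only: conj_commute)
  show ?thesis by (rule Set.set_eqI) (rule mem)
qed

lemma pm_mat_in_PSL2R: "a * d - b * c = 1 \<Longrightarrow> pm_mat a b c d \<in> carrier PSL2R"
  by (auto simp: carrier_PSL2R)

text \<open>Every computation in the group is done on the four entries of a representing matrix.\<close>

lemma PSL2R_cases:
  assumes "g \<in> carrier PSL2R"
  obtains a b c d where "g = pm_mat a b c d" "a * d - b * c = 1"
  using assms by (auto simp: carrier_PSL2R)

lemma PSL2R_one: "\<one>\<^bsub>PSL2R\<^esub> = pm_mat 1 0 0 1"
  by (simp add: PSL2R_def FactGroup_def pm_mat_def Let_def mat_1_mat22)

lemma pm_mat_mult: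
  "pm_mat a b c d \<otimes>\<^bsub>PSL2R\<^esub> pm_mat a' b' c' d' =
     pm_mat (a * a' + b * c') (a * b' + b * d') (c * a' + d * c') (c * b' + d * d')"
proof -
  have "X \<otimes>\<^bsub>PSL2R\<^esub> Y = (\<Union>A\<in>X. \<Union>B\<in>Y. {A ** B})" for X Y
    by (simp add: PSL2R_def FactGroup_def set_mult_def SL2R_def)
  then show ?thesis
    by (simp add: pm_mat_def Let_def matrix_mult_minus mat22_mult insert_commute)
qed

lemma pm_mat_inv:
  assumes "a * d - b * c = 1"
  shows "inv\<^bsub>PSL2R\<^esub> (pm_mat a b c d) = pm_mat d (- b) (- c) a"
  using assms
  by (intro PSL.inv_equality)
     (auto simp: pm_mat_mult PSL2R_one algebra_simps intro!: pm_mat_in_PSL2R)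

lemma rep_pm_mat: "rep (pm_mat a b c d) = mat22 a b c d \<or> rep (pm_mat a b c d) = mat22 (-a) (-b) (-c) (-d)"
proof -
  have "rep (pm_mat a b c d) \<in> pm_mat a b c d"
    unfolding rep_def by (rule someI[of _ "mat22 a b c d"]) (simp add: pm_mat_eq)
  then show ?thesis by (simp add: pm_mat_eq)
qed

lemma aut_j_pm_mat:
  "aut_j (pm_mat a b c d) \<tau> = of_real c * \<tau> + of_real d \<or>
   aut_j (pm_mat a b c d) \<tau> = - (of_real c * \<tau> + of_real d)"
  using rep_pm_mat[of a b c d] by (auto simp: aut_j_def algebra_simps)

text \<open>The sign ambiguity of the representative disappears in even powers.\<close>

lemma aut_j_powi:
  "even w \<Longrightarrow> aut_j (pm_mat a b c d) \<tau> powi w = (of_real c * \<tau> + of_real d) powi w"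
  using aut_j_pm_mat[of a b c d \<tau>] by (metis power_int_minus_left_even)

lemma moebius_pm_mat:
  "moebius (pm_mat a b c d) \<tau> = (of_real a * \<tau> + of_real b) / (of_real c * \<tau> + of_real d)"
proof -
  have "(- (of_real a * \<tau>) - of_real b) / (- (of_real c * \<tau>) - of_real d) =
      (of_real a * \<tau> + of_real b) / (of_real c * \<tau> + of_real d)"
    using minus_divide_divide[of "of_real a * \<tau> + of_real b" "of_real c * \<tau> + of_real d"] by simp
  then show ?thesis
    using rep_pm_mat[of a b c d] by (auto simp: moebius_def aut_j_def)
qed

section \<open>The action on the boundary\<close>

lemma bact_pm_mat:
  "bact (pm_mat a b c d) Infty = (if c = 0 then Infty else Finite (a / c))"
  "bact (pm_mat a b c d) (Finite x) =
     (if c * x + d = 0 then Infty else Finite ((a * x + b) / (c * x + d)))"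
proof -
  have "(- (a * x) - b) / (- (c * x) - d) = (a * x + b) / (c * x + d)"
    using minus_divide_divide[of "a * x + b" "c * x + d"] by simp
  moreover have "- (c * x) - d = 0 \<longleftrightarrow> c * x + d = 0" by linarith
  ultimately show "bact (pm_mat a b c d) Infty = (if c = 0 then Infty else Finite (a / c))"
  "bact (pm_mat a b c d) (Finite x) =
     (if c * x + d = 0 then Infty else Finite ((a * x + b) / (c * x + d)))"
  using rep_pm_mat[of a b c d] by auto
qed

text \<open>The defining equations speak of an arbitrarily chosen representative.\<close>

declare bact.simps [simp del]

text \<open>The point \<open>[x : y]\<close> of the projective line. In homogeneous coordinates the boundary action is
  matrix multiplication, so that its functoriality needs no discussion of poles.\<close>

definition proj_point :: "real \<Rightarrow> real \<Rightarrow> bpoint" where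
  "proj_point x y = (if y = 0 then Infty else Finite (x / y))"

lemma proj_point_cases: obtains x y where "c = proj_point x y" "x \<noteq> 0 \<or> y \<noteq> 0"
proof (cases c)
  case (Finite x)
  then show ?thesis using that[of x 1] by (simp add: proj_point_def)
next
  case Infty
  then show ?thesis using that[of 1 0] by (simp add: proj_point_def)
qed

lemma bact_proj_point:
  assumes "a * d - b * c = 1" "x \<noteq> 0 \<or> y \<noteq> 0"
  shows "bact (pm_mat a b c d) (proj_point x y) = proj_point (a * x + b * y) (c * x + d * y)"
proof (cases "y = 0")
  case True
  then show ?thesis using assms by (auto simp: proj_point_def bact_pm_mat)
next
  case False
  have "c * (x / y) + d = (c * x + d * y) / y" "a * (x / y) + b = (a * x + b * y) / y"
    using False by (simp_all add: field_simps)
  then show ?thesis using False by (simp add: proj_point_def bact_pm_mat)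
qed

lemma bact_mult:
  assumes "g \<in> carrier PSL2R" "h \<in> carrier PSL2R"
  shows "bact (g \<otimes>\<^bsub>PSL2R\<^esub> h) p = bact g (bact h p)"
proof -
  obtain a b c d where g: "g = pm_mat a b c d" "a * d - b * c = 1" using assms(1) PSL2R_cases by blast
  obtain a' b' c' d' where h: "h = pm_mat a' b' c' d'" "a' * d' - b' * c' = 1"
    using assms(2) PSL2R_cases by blast
  obtain x y where p: "p = proj_point x y" "x \<noteq> 0 \<or> y \<noteq> 0" by (rule proj_point_cases)
  have nz: "a' * x + b' * y \<noteq> 0 \<or> c' * x + d' * y \<noteq> 0"
  proof (rule ccontr)
    assume "\<not> ?thesis"
    then have *: "a' * x + b' * y = 0" "c' * x + d' * y = 0" by auto
    have "d' * (a' * x + b' * y) - b' * (c' * x + d' * y) = (a' * d' - b' * c') * x"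
      by (simp add: algebra_simps)
    moreover have "a' * (c' * x + d' * y) - c' * (a' * x + b' * y) = (a' * d' - b' * c') * y"
      by (simp add: algebra_simps)
    ultimately show False using p(2) * h(2) by simp
  qed
  have "(a * a' + b * c') * (c * b' + d * d') - (a * b' + b * d') * (c * a' + d * c') =
      (a * d - b * c) * (a' * d' - b' * c')"
    by (simp add: algebra_simps)
  then have det: "(a * a' + b * c') * (c * b' + d * d') - (a * b' + b * d') * (c * a' + d * c') = 1"
    using g(2) h(2) by simp
  show ?thesis
    unfolding p(1) g(1) h(1) pm_mat_mult bact_proj_point[OF h(2) p(2)]
      bact_proj_point[OF g(2) nz] bact_proj_point[OF det p(2)]
    by (simp add: algebra_simps)
qed

lemma bact_one: "bact \<one>\<^bsub>PSL2R\<^esub> p = p"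
  by (cases p) (simp_all add: PSL2R_one bact_pm_mat)

section \<open>The action on the upper half plane and the slash operator\<close>

lemma denominator_nonzero:
  assumes "a * d - b * c = (1::real)" "\<tau> \<in> uhp"
  shows "of_real c * \<tau> + of_real d \<noteq> 0"
proof
  assume 0: "of_real c * \<tau> + of_real d = 0"
  have "c * Im \<tau> = 0" using arg_cong[OF 0, of Im] by simp
  then have "c = 0" using assms(2) by (simp add: uhp_def)
  then show False using 0 assms(1) by simp
qed

lemma Im_moebius_pm_mat:
  assumes "a * d - b * c = (1::real)" "\<tau> \<in> uhp"
  shows "Im (moebius (pm_mat a b c d) \<tau>) = Im \<tau> / (cmod (of_real c * \<tau> + of_real d))\<^sup>2"
proof -
  have "Im (moebius (pm_mat a b c d) \<tau>) =
      ((a * d - b * c) * Im \<tau>) / (cmod (of_real c * \<tau> + of_real d))\<^sup>2"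
    by (simp add: moebius_pm_mat Im_divide cmod_power2 algebra_simps)
  then show ?thesis using assms(1) by simp
qed

lemma moebius_in_uhp:
  assumes "g \<in> carrier PSL2R" "\<tau> \<in> uhp"
  shows "moebius g \<tau> \<in> uhp"
proof -
  obtain a b c d where g: "g = pm_mat a b c d" "a * d - b * c = 1"
    by (rule PSL2R_cases[OF assms(1)])
  show ?thesis
    using assms(2) denominator_nonzero[OF g(2) assms(2)] Im_moebius_pm_mat[OF g(2) assms(2)]
    by (simp add: uhp_def g(1))
qed

lemma aut_j_nonzero:
  assumes "g \<in> carrier PSL2R" "\<tau> \<in> uhp"
  shows "aut_j g \<tau> \<noteq> 0"
proof -
  obtain a b c d where g: "g = pm_mat a b c d" "a * d - b * c = 1"
    by (rule PSL2R_cases[OF assms(1)])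
  show ?thesis
    using denominator_nonzero[OF g(2) assms(2)] aut_j_pm_mat[of a b c d \<tau>]
    unfolding g(1) by (metis neg_equal_0_iff_equal)
qed

lemma moebius_one: "moebius \<one>\<^bsub>PSL2R\<^esub> \<tau> = \<tau>"
  by (simp add: PSL2R_one moebius_pm_mat)

lemma aut_j_one: "even w \<Longrightarrow> aut_j \<one>\<^bsub>PSL2R\<^esub> \<tau> powi w = 1"
  by (simp add: PSL2R_one aut_j_powi)

lemma moebius_mult:
  assumes "g \<in> carrier PSL2R" "h \<in> carrier PSL2R" "\<tau> \<in> uhp"
  shows "moebius (g \<otimes>\<^bsub>PSL2R\<^esub> h) \<tau> = moebius g (moebius h \<tau>)"
proof -
  obtain a b c d where g: "g = pm_mat a b c d" "a * d - b * c = 1" by (rule PSL2R_cases[OF assms(1)])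
  obtain a' b' c' d' where h: "h = pm_mat a' b' c' d'" "a' * d' - b' * c' = 1"
    by (rule PSL2R_cases[OF assms(2)])
  define n where "n = of_real a' * \<tau> + of_real b'"
  define e where "e = of_real c' * \<tau> + of_real d'"
  have e: "e \<noteq> 0" using denominator_nonzero[OF h(2) assms(3)] by (simp add: e_def)
  have frac: "x * (n / e) + y = (x * n + y * e) / e" for x y :: complex
    using e by (simp add: field_simps)
  have "moebius g (moebius h \<tau>) =
      (of_real a * n + of_real b * e) / (of_real c * n + of_real d * e)"
    unfolding g(1) h(1) moebius_pm_mat n_def[symmetric] e_def[symmetric] frac using e by simp
  then show ?thesis
    by (simp add: g(1) h(1) pm_mat_mult moebius_pm_mat n_def e_def algebra_simps)
qed

lemma aut_j_mult:
  assumes "g \<in> carrier PSL2R" "h \<in> carrier PSL2R" "\<tau> \<in> uhp" "even w"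
  shows "aut_j (g \<otimes>\<^bsub>PSL2R\<^esub> h) \<tau> powi w = aut_j g (moebius h \<tau>) powi w * aut_j h \<tau> powi w"
proof -
  obtain a b c d where g: "g = pm_mat a b c d" "a * d - b * c = 1" by (rule PSL2R_cases[OF assms(1)])
  obtain a' b' c' d' where h: "h = pm_mat a' b' c' d'" "a' * d' - b' * c' = 1"
    by (rule PSL2R_cases[OF assms(2)])
  define n where "n = of_real a' * \<tau> + of_real b'"
  define e where "e = of_real c' * \<tau> + of_real d'"
  have e: "e \<noteq> 0" using denominator_nonzero[OF h(2) assms(3)] by (simp add: e_def)
  have "aut_j g (moebius h \<tau>) powi w * aut_j h \<tau> powi w =
      ((of_real c * (n / e) + of_real d) * e) powi w"
    by (simp add: g(1) h(1) aut_j_powi[OF assms(4)] moebius_pm_mat n_def e_def power_int_mult_distrib)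
  also have "(of_real c * (n / e) + of_real d) * e = of_real c * n + of_real d * e"
    using e by (simp add: field_simps)
  finally show ?thesis
    by (simp add: g(1) h(1) pm_mat_mult aut_j_powi[OF assms(4)] n_def e_def algebra_simps)
qed

lemma slash_mult:
  assumes "g \<in> carrier PSL2R" "h \<in> carrier PSL2R" "even w"
  shows "slash w X (g \<otimes>\<^bsub>PSL2R\<^esub> h) = slash w (slash w X g) h"
proof
  fix \<tau>
  show "slash w X (g \<otimes>\<^bsub>PSL2R\<^esub> h) \<tau> = slash w (slash w X g) h \<tau>"
    using assms moebius_in_uhp[OF assms(2)]
    by (simp add: slash_def moebius_mult aut_j_mult vector_smult_assoc mult.commute)
qed

lemma slash_one:
  assumes "even w" "\<And>\<tau>. \<tau> \<notin> uhp \<Longrightarrow> X \<tau> = 0"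
  shows "slash w X \<one>\<^bsub>PSL2R\<^esub> = X"
  using assms by (simp add: fun_eq_iff slash_def moebius_one aut_j_one)

text \<open>The transformation law of a form, read as an equation for the slash operator.\<close>

lemma slash_eq_iff:
  assumes "g \<in> carrier PSL2R" "\<tau> \<in> uhp"
  shows "X (moebius g \<tau>) = (aut_j g \<tau> powi w) *s v \<longleftrightarrow> slash w X g \<tau> = v"
proof -
  have "aut_j g \<tau> powi w * aut_j g \<tau> powi (- w) = 1"
    using aut_j_nonzero[OF assms] by (simp add: power_int_minus)
  then show ?thesis
    using assms(2) by (auto simp: slash_def vector_smult_assoc mult.commute)
qed

lemma holomorphic_on_slash:
  assumes "g \<in> carrier PSL2R" "even w"
    and "\<And>\<xi>. (\<lambda>\<tau>. X \<tau> $ \<xi>) holomorphic_on uhp"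
  shows "(\<lambda>\<tau>. slash w X g \<tau> $ \<xi>) holomorphic_on uhp"
proof -
  obtain a b c d where g: "g = pm_mat a b c d" "a * d - b * c = 1"
    by (rule PSL2R_cases[OF assms(1)])
  have nz: "of_real c * \<tau> + of_real d \<noteq> 0" if "\<tau> \<in> uhp" for \<tau>
    using denominator_nonzero[OF g(2) that] .
  have "(\<lambda>\<tau>. moebius g \<tau>) holomorphic_on uhp"
    unfolding g(1) moebius_pm_mat using nz by (intro holomorphic_intros) auto
  then have "(\<lambda>\<tau>. X (moebius g \<tau>) $ \<xi>) holomorphic_on uhp"
    using holomorphic_on_compose_gen[OF _ assms(3), of "moebius g" uhp \<xi>] moebius_in_uhp[OF assms(1)]
    by (auto simp: o_def)
  then have "(\<lambda>\<tau>. (of_real c * \<tau> + of_real d) powi (- w) * X (moebius g \<tau>) $ \<xi>) holomorphic_on uhp"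
    using nz by (intro holomorphic_intros) auto
  then show ?thesis
    by (rule holomorphic_transform) (simp add: slash_def g(1) aut_j_powi assms(2))
qed

section \<open>Cusps and their translations\<close>

lemma cusp_mat_in_PSL2R: "cusp_mat c \<in> carrier PSL2R"
  by (cases c) (auto intro: pm_mat_in_PSL2R)

lemma cusp_translation_Infty: "cusp_translation Infty h = pm_mat 1 h 0 1"
  by (simp add: cusp_translation_def PSL2R_one pm_mat_mult pm_mat_inv)

lemma cusp_translation_Finite:
  "cusp_translation (Finite x) h = pm_mat (1 - x * h) (x\<^sup>2 * h) (- h) (1 + x * h)"
  by (simp add: cusp_translation_def pm_mat_mult pm_mat_inv algebra_simps power2_eq_square)

lemma cusp_translation_in_PSL2R: "cusp_translation c h \<in> carrier PSL2R"
  unfolding cusp_translation_def by (intro PSL.m_closed PSL.inv_closed cusp_mat_in_PSL2R pm_mat_in_PSL2R) simp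

lemma cusp_translation_add:
  "cusp_translation c (h + k) = cusp_translation c h \<otimes>\<^bsub>PSL2R\<^esub> cusp_translation c k"
  by (cases c) (auto simp: cusp_translation_Infty cusp_translation_Finite pm_mat_mult algebra_simps
      power2_eq_square)

lemma cusp_translation_zero: "cusp_translation c 0 = \<one>\<^bsub>PSL2R\<^esub>"
  by (cases c) (auto simp: cusp_translation_Infty cusp_translation_Finite PSL2R_one)

lemma cusp_translation_uminus: "cusp_translation c (- h) = inv\<^bsub>PSL2R\<^esub> (cusp_translation c h)"
  using cusp_translation_add[of c "- h" h]
  by (intro PSL.inv_equality[symmetric]) (auto simp: cusp_translation_zero cusp_translation_in_PSL2R)

lemma cusp_translation_pow:
  "cusp_translation c h [^]\<^bsub>PSL2R\<^esub> n = cusp_translation c (of_nat n * h)"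
proof (induction n)
  case (Suc n)
  have "of_nat (Suc n) * h = of_nat n * h + h" by (simp add: algebra_simps)
  then show ?case by (simp only: PSL.nat_pow_Suc Suc cusp_translation_add)
qed (simp add: cusp_translation_zero)

lemma cusp_translation_eq_one_iff: "cusp_translation c h = \<one>\<^bsub>PSL2R\<^esub> \<longleftrightarrow> h = 0"
  by (cases c) (auto simp: cusp_translation_Infty cusp_translation_Finite PSL2R_one pm_mat_eq
      mat22_eq_iff doubleton_eq_iff)

text \<open>Both \<open>g A\<^sub>c\<close> and the matrix of the cusp \<open>g c\<close> send infinity to \<open>g c\<close>, so they differ by an element
  fixing infinity, that is, by an upper triangular matrix. Everything that compares two cusps in
  the same orbit rests on this factorization.\<close>

lemma mult_cusp_mat:
  assumes "g \<in> carrier PSL2R"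
  obtains a b where "a \<noteq> 0"
    "g \<otimes>\<^bsub>PSL2R\<^esub> cusp_mat c = cusp_mat (bact g c) \<otimes>\<^bsub>PSL2R\<^esub> pm_mat a b 0 (1 / a)"
proof -
  obtain p q r s where g: "g = pm_mat p q r s" and det: "p * s - q * r = 1"
        by (rule PSL2R_cases[OF assms])
  show ?thesis
  proof (cases c)
    case Infty
    show ?thesis
    proof (cases "r = 0")
      case True
      then have "p \<noteq> 0" using det by auto
      then have "s = 1 / p" using det True by (simp add: field_simps)
      then show ?thesis using that[of p q] True \<open>p \<noteq> 0\<close>
        by (simp add: g Infty bact_pm_mat PSL2R_one pm_mat_mult)
    next
      case False
      then have "q = s * (p / r) - 1 / r" using det by (simp add: field_simps)
      then show ?thesis using that[of r s] False
        by (simp add: g Infty bact_pm_mat PSL2R_one pm_mat_mult mult.commute)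
    qed
  next
    case (Finite x)
    show ?thesis
    proof (cases "r * x + s = 0")
      case True
      then have s: "s = - (r * x)" by linarith
      have inverse: "(- r) * (p * x + q) = 1" using det by (simp add: s algebra_simps)
      then have nz: "p * x + q \<noteq> 0" by (metis mult_zero_right zero_neq_one)
      have "1 / (p * x + q) = - r" by (rule eq_divide_imp[OF nz inverse, symmetric])
      then show ?thesis using that[of "p * x + q" "- p"] True nz
        by (simp add: g Finite bact_pm_mat PSL2R_one pm_mat_mult)
    next
      case False
      have "p * (r * x + s) = r * (p * x + q) + 1" using det by (simp add: algebra_simps)
      then have "p = (r * (p * x + q) + 1) / (r * x + s)" using False by (metis nonzero_mult_div_cancel_right)
      moreover have "N / e * (- r) - 1 / e = - ((r * N + 1) / e)" for N e :: real
        by (simp add: add_divide_distrib mult.commute)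
      ultimately have "- p = (p * x + q) / (r * x + s) * (- r) - 1 / (r * x + s)" by metis
      then show ?thesis using that[of "r * x + s" "- r"] False
        by (simp add: g Finite bact_pm_mat PSL2R_one pm_mat_mult)
    qed
  qed
qed

text \<open>The upper triangular factor conjugates the translation by \<open>h\<close> into that by \<open>a\<^sup>2 * h\<close>: widths
  scale by a positive factor independent of \<open>h\<close>.\<close>

lemma cusp_translation_conj:
  assumes g: "g \<in> carrier PSL2R"
  obtains a where "a \<noteq> 0"
    "\<And>h. g \<otimes>\<^bsub>PSL2R\<^esub> cusp_translation c h \<otimes>\<^bsub>PSL2R\<^esub> inv\<^bsub>PSL2R\<^esub> g = cusp_translation (bact g c) (a\<^sup>2 * h)"
proof -
  obtain a b where a: "a \<noteq> 0" and
    gA: "g \<otimes>\<^bsub>PSL2R\<^esub> cusp_mat c = cusp_mat (bact g c) \<otimes>\<^bsub>PSL2R\<^esub> pm_mat a b 0 (1 / a)"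
    using mult_cusp_mat[OF g] by blast
  define A where "A = cusp_mat c"
  define A' where "A' = cusp_mat (bact g c)"
  define U where "U = pm_mat a b 0 (1 / a)"
  have carr: "A \<in> carrier PSL2R" "A' \<in> carrier PSL2R" "U \<in> carrier PSL2R"
    using a by (auto simp: A_def A'_def U_def cusp_mat_in_PSL2R pm_mat_in_PSL2R)
  have "g \<otimes>\<^bsub>PSL2R\<^esub> cusp_translation c h \<otimes>\<^bsub>PSL2R\<^esub> inv\<^bsub>PSL2R\<^esub> g = cusp_translation (bact g c) (a\<^sup>2 * h)" for h
  proof -
    define t where "t = pm_mat 1 h 0 1"
    have t: "t \<in> carrier PSL2R" by (auto simp: t_def pm_mat_in_PSL2R)
    have "g \<otimes>\<^bsub>PSL2R\<^esub> (A \<otimes>\<^bsub>PSL2R\<^esub> t \<otimes>\<^bsub>PSL2R\<^esub> inv\<^bsub>PSL2R\<^esub> A) \<otimes>\<^bsub>PSL2R\<^esub> inv\<^bsub>PSL2R\<^esub> g =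
        (g \<otimes>\<^bsub>PSL2R\<^esub> A) \<otimes>\<^bsub>PSL2R\<^esub> t \<otimes>\<^bsub>PSL2R\<^esub> inv\<^bsub>PSL2R\<^esub> (g \<otimes>\<^bsub>PSL2R\<^esub> A)"
      using g carr t by (simp add: PSL.m_assoc PSL.inv_mult_group)
    also have "\<dots> = A' \<otimes>\<^bsub>PSL2R\<^esub> (U \<otimes>\<^bsub>PSL2R\<^esub> t \<otimes>\<^bsub>PSL2R\<^esub> inv\<^bsub>PSL2R\<^esub> U) \<otimes>\<^bsub>PSL2R\<^esub> inv\<^bsub>PSL2R\<^esub> A'"
      using g carr t gA[folded A_def A'_def U_def] by (simp add: PSL.m_assoc PSL.inv_mult_group)
    also have "U \<otimes>\<^bsub>PSL2R\<^esub> t \<otimes>\<^bsub>PSL2R\<^esub> inv\<^bsub>PSL2R\<^esub> U = pm_mat 1 (a\<^sup>2 * h) 0 1"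
      using a by (simp add: U_def t_def pm_mat_mult pm_mat_inv algebra_simps power2_eq_square)
    finally show ?thesis by (simp add: cusp_translation_def A_def A'_def t_def)
  qed
  with a show ?thesis using that by blast
qed

text \<open>A parabolic element has a double eigenvalue \<open>\<plusminus>1\<close>; knowing one fixed boundary point determines it
  up to one real parameter, and the resulting family is that of the translations at the cusp.\<close>

lemma cusp_iff_translation:
  assumes "subgroup \<Gamma> PSL2R"
  shows "cusp \<Gamma> c \<longleftrightarrow> (\<exists>h>0. cusp_translation c h \<in> \<Gamma>)"
proof
  assume "cusp \<Gamma> c"
  then obtain \<gamma> where \<gamma>: "\<gamma> \<in> \<Gamma>" "parabolic \<gamma>" "bact \<gamma> c = c" by (auto simp: cusp_def)
  then obtain p q r s where pqrs: "\<gamma> = pm_mat p q r s" "p * s - q * r = 1"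
    using PSL2R_cases by (metis parabolic_def)
  have "\<bar>p + s\<bar> = 2"
    using \<gamma>(2) rep_pm_mat[of p q r s] by (auto simp: parabolic_def pqrs(1) trace_def sum_2)
  then obtain a b c' d where abcd: "\<gamma> = pm_mat a b c' d" "a * d - b * c' = 1" "a + d = 2"
  proof (cases "p + s = 2")
    case False
    with \<open>\<bar>p + s\<bar> = 2\<close> have "- p + - s = 2" by linarith
    then show ?thesis
      using that[of "- p" "- q" "- r" "- s"] pqrs by (simp add: pm_mat_uminus)
  qed (use that pqrs in blast)
  have "\<exists>h. \<gamma> = cusp_translation c h"
  proof (cases c)
    case Infty
    have c': "c' = 0" using \<gamma>(3) Infty by (auto simp: abcd(1) bact_pm_mat split: if_splits)
    have d: "d = 2 - a" using abcd(3) by linarith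
    have "(a - 1)\<^sup>2 = 0" using abcd(2) by (simp add: c' d power2_eq_square algebra_simps)
    then show ?thesis by (auto simp: Infty cusp_translation_Infty abcd(1) c' d)
  next
    case (Finite x)
    have nz: "c' * x + d \<noteq> 0" and fix_x: "(a * x + b) / (c' * x + d) = x"
      using \<gamma>(3) Finite by (auto simp: abcd(1) bact_pm_mat split: if_splits)
    have a: "a = 2 - d" using abcd(3) by linarith
    have b: "b = x * (c' * x + d) - a * x" using fix_x nz by (simp add: field_simps)
    have "(c' * x + d - 1)\<^sup>2 = 0"
      using abcd(2) by (simp add: a b power2_eq_square algebra_simps)
    then have d: "d = 1 - c' * x" by simp
    have "\<gamma> = cusp_translation c (- c')"
      by (simp add: Finite cusp_translation_Finite abcd(1) a b d power2_eq_square algebra_simps)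
    then show ?thesis by blast
  qed
  then obtain h where h: "\<gamma> = cusp_translation c h" by blast
  have "h \<noteq> 0" using \<gamma>(2) h by (auto simp: parabolic_def cusp_translation_zero)
  moreover have "cusp_translation c (- h) \<in> \<Gamma>"
    unfolding cusp_translation_uminus using assms \<gamma>(1) h by (simp add: subgroup.m_inv_closed)
  ultimately show "\<exists>h>0. cusp_translation c h \<in> \<Gamma>"
    using h \<gamma>(1) by (cases "h > 0") (auto intro: exI[of _ "- h"])
next
  assume "\<exists>h>0. cusp_translation c h \<in> \<Gamma>"
  then obtain h where h: "h > 0" "cusp_translation c h \<in> \<Gamma>" by blast
  have "\<bar>trace (rep (cusp_translation c h))\<bar> = 2"
  proof -
    have "\<bar>trace (rep (pm_mat p q r s))\<bar> = \<bar>p + s\<bar>" for p q r s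
      using rep_pm_mat[of p q r s] by (auto simp: trace_def sum_2)
    then show ?thesis
      by (cases c) (simp_all add: cusp_translation_Infty cusp_translation_Finite)
  qed
  then have "parabolic (cusp_translation c h)"
    using h by (simp add: parabolic_def cusp_translation_in_PSL2R cusp_translation_eq_one_iff)
  moreover have "bact (cusp_translation c h) c = c"
    by (cases c) (simp_all add: cusp_translation_Infty cusp_translation_Finite bact_pm_mat
        algebra_simps power2_eq_square)
  ultimately show "cusp \<Gamma> c" using h by (auto simp: cusp_def)
qed

lemma discrete_subset:
  assumes "discrete S" "T \<subseteq> S"
  shows "discrete T"
proof (rule discreteI)
  fix x assume x: "x \<in> T"
  then have "x isolated_in S" using assms by (auto intro: discreteD)
  then obtain U where U: "open U" "U \<inter> S = {x}" by (auto simp: isolated_in_def)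
  then have "U \<inter> T = {x}" using x assms(2) by blast
  then show "x isolated_in T" using U(1) x by (auto simp: isolated_in_def)
qed

text \<open>The translations at \<open>c\<close> are a continuous injective image of the real line through the identity,
  which is isolated in a discrete group.\<close>

lemma cusp_translation_discrete:
  assumes "subgroup \<Gamma> PSL2R" "discrete (\<Union>\<Gamma>)"
  shows "\<exists>\<epsilon>>0. \<forall>h. cusp_translation c h \<in> \<Gamma> \<longrightarrow> \<bar>h\<bar> < \<epsilon> \<longrightarrow> h = 0"
proof -
  \<comment> \<open>A continuous choice of one of the two matrices representing the translation.\<close>
  define M where "M = (\<lambda>h. case c of Infty \<Rightarrow> mat22 1 h 0 1
      | Finite x \<Rightarrow> mat22 (1 - x * h) (x\<^sup>2 * h) (- h) (1 + x * h))"
  have M: "M h \<in> cusp_translation c h" for h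
    by (cases c) (simp_all add: M_def cusp_translation_Infty cusp_translation_Finite pm_mat_eq)
  have M0: "M h = M 0 \<Longrightarrow> h = 0" for h
    by (cases c) (simp_all add: M_def mat22_eq_iff)
  have "M 0 \<in> \<Union>\<Gamma>"
    using M[of 0] subgroup.one_closed[OF assms(1)] by (auto simp: cusp_translation_zero)
  then obtain T where T: "open T" "T \<inter> \<Union>\<Gamma> = {M 0}"
    using discreteD[OF assms(2)] unfolding isolated_in_def by blast
  have "continuous_on UNIV (\<lambda>h. M h $ i $ j)" for i j
    using exhaust_2[of i] exhaust_2[of j]
    by (cases c) (auto simp: M_def, auto intro!: continuous_intros)
  then have "continuous_on UNIV (\<lambda>h. \<chi> i j. M h $ i $ j)"
    by (intro continuous_on_vec_lambda) auto
  then have "open (M -` T)" using T(1) by (simp add: open_vimage)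
  moreover have "0 \<in> M -` T" using T(2) by blast
  ultimately obtain \<epsilon> where \<epsilon>: "\<epsilon> > 0" "ball 0 \<epsilon> \<subseteq> M -` T"
    by (meson open_contains_ball)
  have "h = 0" if "cusp_translation c h \<in> \<Gamma>" "\<bar>h\<bar> < \<epsilon>" for h
  proof -
    have "M h \<in> T" using \<epsilon>(2) that(2) by (auto simp: subset_iff dist_real_def)
    moreover have "M h \<in> \<Union>\<Gamma>" using M[of h] that(1) by blast
    ultimately show ?thesis using T(2) M0 by blast
  qed
  then show ?thesis using \<epsilon>(1) by blast
qed

text \<open>The widths occurring at a cusp form a discrete subgroup of the reals, hence the multiples of a
  least positive element. In particular the minimum defining \<open>cusp_width\<close> is attained.\<close>

lemma cusp_width_generates:
  assumes \<Gamma>: "subgroup \<Gamma> PSL2R" "discrete (\<Union>\<Gamma>)" and c: "cusp \<Gamma> c"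
  shows "cusp_width \<Gamma> c > 0" "cusp_gen \<Gamma> c \<in> \<Gamma>"
    "\<And>h. h > 0 \<Longrightarrow> cusp_translation c h \<in> \<Gamma> \<Longrightarrow> cusp_width \<Gamma> c \<le> h"
    "\<And>h. h > 0 \<Longrightarrow> cusp_translation c h \<in> \<Gamma> \<Longrightarrow> \<exists>k::nat. h = of_nat k * cusp_width \<Gamma> c"
proof -
  define S where "S = {h. cusp_translation c h \<in> \<Gamma>}"
  have diff: "x - y \<in> S" if "x \<in> S" "y \<in> S" for x y
  proof -
    have "cusp_translation c (x - y) =
        cusp_translation c x \<otimes>\<^bsub>PSL2R\<^esub> inv\<^bsub>PSL2R\<^esub> (cusp_translation c y)"
      by (metis cusp_translation_add cusp_translation_uminus diff_conv_add_uminus)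
    then show ?thesis
      using that \<Gamma>(1) by (simp add: S_def subgroup.m_closed subgroup.m_inv_closed)
  qed
  obtain \<epsilon> where \<epsilon>: "\<epsilon> > 0" "\<And>h. h \<in> S \<Longrightarrow> \<bar>h\<bar> < \<epsilon> \<Longrightarrow> h = 0"
    using cusp_translation_discrete[OF \<Gamma>] unfolding S_def by blast
  \<comment> \<open>If the infimum were not attained, two elements close to it would differ by less than \<open>\<epsilon>\<close>.\<close>
  define s where "s = Inf {h \<in> S. h > 0}"
  obtain h0 where h0: "h0 \<in> S" "h0 > 0"
    using c cusp_iff_translation[OF \<Gamma>(1)] by (auto simp: S_def)
  have bdd: "bdd_below {h \<in> S. h > 0}" by (rule bdd_belowI[of _ 0]) auto
  have s_le: "s \<le> h" if "h \<in> S" "h > 0" for h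
    unfolding s_def using that bdd by (intro cInf_lower) auto
  obtain h where h: "h \<in> S" "h > 0" "h < s + \<epsilon>"
    using cInf_lessD[of "{h \<in> S. h > 0}" "s + \<epsilon>"] h0 \<epsilon>(1) by (auto simp: s_def)
  have "h = s"
  proof (rule ccontr)
    assume "h \<noteq> s"
    then have "s < h" using s_le[OF h(1,2)] by simp
    then obtain h' where h': "h' \<in> S" "h' > 0" "h' < h"
      using cInf_lessD[of "{h \<in> S. h > 0}" h] h0 by (auto simp: s_def)
    then have "h - h' = 0" using s_le[OF h'(1,2)] h by (intro \<epsilon>(2) diff) auto
    then show False using h'(3) by simp
  qed
  then have s: "s \<in> S" "s > 0" using h by auto
  have width: "cusp_width \<Gamma> c = s"
    unfolding cusp_width_def using s s_le by (intro Least_equality) (auto simp: S_def)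
  show "cusp_width \<Gamma> c > 0" "cusp_gen \<Gamma> c \<in> \<Gamma>"
    using s by (simp_all add: cusp_gen_def width S_def)
  show "cusp_width \<Gamma> c \<le> h" if "h > 0" "cusp_translation c h \<in> \<Gamma>" for h
    using that s_le by (simp add: width S_def)
  show "\<exists>k::nat. h = of_nat k * cusp_width \<Gamma> c" if h: "h > 0" "cusp_translation c h \<in> \<Gamma>" for h
  proof -
    have multiple: "h - of_nat k * s \<in> S" for k
    proof (induction k)
      case (Suc k)
      have "h - of_nat (Suc k) * s = (h - of_nat k * s) - s" by (simp add: algebra_simps)
      then show ?case using diff[OF Suc s(1)] by (simp only:)
    qed (use h in \<open>simp add: S_def\<close>)
    \<comment> \<open>Division with remainder; the remainder is a width below the least positive one, hence 0.\<close>
    define k where "k = nat \<lfloor>h / s\<rfloor>"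
    have "of_nat k \<le> h / s" "h / s < of_nat k + 1"
      using h(1) s(2) by (auto simp: k_def)
    then have "0 \<le> h - of_nat k * s" "h - of_nat k * s < s"
      using s(2) by (auto simp: field_simps)
    then have "h - of_nat k * s = 0"
      using s_le[OF multiple[of k]] by force
    then show ?thesis by (auto simp: width)
  qed
qed

text \<open>As conjugation scales all widths by the same factor, it carries least widths to least widths;
  the generators at equivalent cusps are therefore conjugate on the nose, not merely up to powers.\<close>

lemma cusp_bact:
  assumes \<Gamma>: "subgroup \<Gamma> PSL2R" "discrete (\<Union>\<Gamma>)" and c: "cusp \<Gamma> c" and g: "g \<in> \<Gamma>"
  shows "cusp \<Gamma> (bact g c)"
    "cusp_gen \<Gamma> (bact g c) = g \<otimes>\<^bsub>PSL2R\<^esub> cusp_gen \<Gamma> c \<otimes>\<^bsub>PSL2R\<^esub> inv\<^bsub>PSL2R\<^esub> g"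
proof -
  have gP: "g \<in> carrier PSL2R" using \<Gamma>(1) g by (rule subgroup.mem_carrier)
  obtain a where a: "a \<noteq> 0" and conj: "\<And>h. g \<otimes>\<^bsub>PSL2R\<^esub> cusp_translation c h \<otimes>\<^bsub>PSL2R\<^esub> inv\<^bsub>PSL2R\<^esub> g =
      cusp_translation (bact g c) (a\<^sup>2 * h)"
    using cusp_translation_conj[OF gP] by blast
  have closed: "x \<otimes>\<^bsub>PSL2R\<^esub> y \<otimes>\<^bsub>PSL2R\<^esub> inv\<^bsub>PSL2R\<^esub> x \<in> \<Gamma>" if "x \<in> \<Gamma>" "y \<in> \<Gamma>" for x y
    using that \<Gamma>(1) by (simp add: subgroup.m_closed subgroup.m_inv_closed)
  have mem: "cusp_translation (bact g c) (a\<^sup>2 * h) \<in> \<Gamma> \<longleftrightarrow> cusp_translation c h \<in> \<Gamma>" for h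
  proof
    assume *: "cusp_translation (bact g c) (a\<^sup>2 * h) \<in> \<Gamma>"
    have "inv\<^bsub>PSL2R\<^esub> g \<otimes>\<^bsub>PSL2R\<^esub> cusp_translation (bact g c) (a\<^sup>2 * h) \<otimes>\<^bsub>PSL2R\<^esub> inv\<^bsub>PSL2R\<^esub> (inv\<^bsub>PSL2R\<^esub> g) = cusp_translation c h"
      unfolding conj[symmetric] using gP cusp_translation_in_PSL2R[of c h]
      by (simp add: PSL.m_assoc) (simp flip: PSL.m_assoc)
    then show "cusp_translation c h \<in> \<Gamma>"
      using closed[OF subgroup.m_inv_closed[OF \<Gamma>(1) g] *] by simp
  next
    assume "cusp_translation c h \<in> \<Gamma>"
    then show "cusp_translation (bact g c) (a\<^sup>2 * h) \<in> \<Gamma>"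
      using closed[OF g] conj by metis
  qed
  have a2: "a\<^sup>2 > 0" using a by simp
  note width = cusp_width_generates[OF \<Gamma> c]
  have "0 < a\<^sup>2 * cusp_width \<Gamma> c" "cusp_translation (bact g c) (a\<^sup>2 * cusp_width \<Gamma> c) \<in> \<Gamma>"
    using width(1,2) a2 mem by (auto simp: cusp_gen_def)
  moreover have "a\<^sup>2 * cusp_width \<Gamma> c \<le> h" if "0 < h" "cusp_translation (bact g c) h \<in> \<Gamma>" for h
  proof -
    have "cusp_translation c (h / a\<^sup>2) \<in> \<Gamma>" using that(2) mem[of "h / a\<^sup>2"] a by simp
    then have "cusp_width \<Gamma> c \<le> h / a\<^sup>2" using that(1) a2 by (intro width(3)) auto
    then show ?thesis using a2 by (simp add: field_simps)
  qed
  ultimately have "cusp \<Gamma> (bact g c) \<and> cusp_width \<Gamma> (bact g c) = a\<^sup>2 * cusp_width \<Gamma> c"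
    unfolding cusp_iff_translation[OF \<Gamma>(1)] cusp_width_def[of \<Gamma> "bact g c"]
    by (auto intro!: Least_equality)
  then show "cusp \<Gamma> (bact g c)"
    "cusp_gen \<Gamma> (bact g c) = g \<otimes>\<^bsub>PSL2R\<^esub> cusp_gen \<Gamma> c \<otimes>\<^bsub>PSL2R\<^esub> inv\<^bsub>PSL2R\<^esub> g"
    by (auto simp: cusp_gen_def conj)
qed

section \<open>Moderate growth and Fourier expansions\<close>

lemma has_sum_vec_iff:
  fixes f :: "'b \<Rightarrow> complex^'n"
  shows "(f has_sum S) A \<longleftrightarrow> (\<forall>i. ((\<lambda>x. f x $ i) has_sum S $ i) A)"
proof -
  have "((sum f \<longlongrightarrow> S) F) \<longleftrightarrow> (\<forall>i. ((\<lambda>X. sum f X $ i) \<longlongrightarrow> S $ i) F)" for F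
    using tendsto_vec_nth vec_tendstoI by metis
  then show ?thesis by (simp add: has_sum_def comp_def sum_component)
qed

lemma has_sum_matrix_vector:
  fixes f :: "'b \<Rightarrow> complex^'n"
  assumes "(f has_sum S) A"
  shows "((\<lambda>x. Q *v f x) has_sum Q *v S) A"
proof -
  have "linear ((*v) Q)"
    by (rule linearI)
       (simp add: matrix_vector_right_distrib,
        simp add: matrix_vector_mult_def vec_eq_iff scaleR_sum_right)
  then have "bounded_linear ((*v) Q)" by (simp add: linear_conv_bounded_linear)
  from has_sum_bounded_linear[OF this assms] show ?thesis by (simp add: o_def)
qed

lemma holomorphic_on_matrix_vector:
  assumes "\<And>j. (\<lambda>z. F z $ j) holomorphic_on S"
  shows "(\<lambda>z. (A *v F z) $ i) holomorphic_on S"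
  unfolding matrix_vector_mult_def vec_lambda_beta
  by (intro holomorphic_on_sum holomorphic_on_mult holomorphic_on_const assms)

text \<open>One constant serves as exponent and as threshold; this loses nothing by \<open>moderateI\<close>, since
  constant factors are absorbed by a larger exponent. The bound is required on strips of bounded
  real part only, because the exponents at a cusp may be non-real and the fractional power
  \<open>q ^ \<Lambda>\<close> is then unbounded along horizontal lines.\<close>

definition moderate :: "(complex \<Rightarrow> complex) \<Rightarrow> bool" where
  "moderate f \<longleftrightarrow> (\<forall>B. \<exists>K. \<forall>z. \<bar>Re z\<bar> \<le> B \<and> K \<le> Im z \<longrightarrow> cmod (f z) \<le> exp (K * Im z))"

lemma moderateD:
  assumes "moderate f"
  obtains K where "K \<ge> K0" "K > 0"
    "\<And>z. \<bar>Re z\<bar> \<le> B \<Longrightarrow> K \<le> Im z \<Longrightarrow> cmod (f z) \<le> exp (K * Im z)"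
proof -
  obtain K where K: "\<And>z. \<bar>Re z\<bar> \<le> B \<Longrightarrow> K \<le> Im z \<Longrightarrow> cmod (f z) \<le> exp (K * Im z)"
    using assms unfolding moderate_def by metis
  define K' where "K' = Max {K, K0, 1}"
  have K': "K \<le> K'" "K0 \<le> K'" "1 \<le> K'" by (auto simp: K'_def)
  have "cmod (f z) \<le> exp (K' * Im z)" if "\<bar>Re z\<bar> \<le> B" "K' \<le> Im z" for z
  proof -
    have "cmod (f z) \<le> exp (K * Im z)" using that K' by (intro K) auto
    also have "\<dots> \<le> exp (K' * Im z)" using that K' by (simp add: mult_right_mono)
    finally show ?thesis .
  qed
  then show ?thesis using that[of K'] K' by auto
qed

lemma moderateI:
  assumes "\<And>B. \<exists>C K Y. \<forall>z. \<bar>Re z\<bar> \<le> B \<and> Y \<le> Im z \<longrightarrow> cmod (f z) \<le> C * exp (K * Im z)"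
  shows "moderate f"
  unfolding moderate_def
proof
  fix B
  obtain C K Y where bound: "\<And>z. \<bar>Re z\<bar> \<le> B \<Longrightarrow> Y \<le> Im z \<Longrightarrow> cmod (f z) \<le> C * exp (K * Im z)"
    using assms[of B] by blast
  \<comment> \<open>Above height 1 the factor \<open>C\<close> is at most \<open>exp (\<bar>C\<bar> * Im z)\<close>.\<close>
  define K' where "K' = \<bar>K\<bar> + \<bar>C\<bar> + \<bar>Y\<bar> + 1"
  have "cmod (f z) \<le> exp (K' * Im z)" if z: "\<bar>Re z\<bar> \<le> B" "K' \<le> Im z" for z
  proof -
    have Im: "1 \<le> Im z" "Y \<le> Im z" using z(2) by (auto simp: K'_def)
    have "C \<le> \<bar>C\<bar> * Im z" using mult_left_mono[OF Im(1), of "\<bar>C\<bar>"] by auto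
    also have "\<dots> \<le> exp (\<bar>C\<bar> * Im z)" using exp_ge_add_one_self[of "\<bar>C\<bar> * Im z"] by linarith
    finally have "C * exp (K * Im z) \<le> exp (\<bar>C\<bar> * Im z) * exp (K * Im z)"
      by (simp add: mult_right_mono)
    also have "\<dots> = exp ((\<bar>C\<bar> + K) * Im z)" by (simp add: exp_add algebra_simps)
    also have "\<dots> \<le> exp (K' * Im z)"
      using Im by (auto simp: K'_def intro!: mult_right_mono)
    finally show ?thesis using bound[OF z(1) Im(2)] by linarith
  qed
  then show "\<exists>K. \<forall>z. \<bar>Re z\<bar> \<le> B \<and> K \<le> Im z \<longrightarrow> cmod (f z) \<le> exp (K * Im z)" by blast
qed

lemma moderate_cong:
  assumes "\<And>z. z \<in> uhp \<Longrightarrow> f z = g z"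
  shows "moderate f \<longleftrightarrow> moderate g"
proof -
  have "moderate g" if f: "moderate f" and eq: "\<And>z. z \<in> uhp \<Longrightarrow> f z = g z" for f g
  proof (rule moderateI)
    fix B
    obtain K where K: "K > 0" "\<And>z. \<bar>Re z\<bar> \<le> B \<Longrightarrow> K \<le> Im z \<Longrightarrow> cmod (f z) \<le> exp (K * Im z)"
      using moderateD[OF f] by metis
    have "cmod (g z) \<le> 1 * exp (K * Im z)" if "\<bar>Re z\<bar> \<le> B" "K \<le> Im z" for z
      using K(2)[OF that] eq[of z] K(1) that by (simp add: uhp_def)
    then show "\<exists>C K Y. \<forall>z. \<bar>Re z\<bar> \<le> B \<and> Y \<le> Im z \<longrightarrow> cmod (g z) \<le> C * exp (K * Im z)" by blast
  qed
  then show ?thesis using assms by metis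
qed

lemma moderate_const: "moderate (\<lambda>_. c)"
  by (rule moderateI, rule exI[of _ "cmod c"], rule exI[of _ 0]) auto

lemma moderate_add:
  assumes "moderate f" "moderate g"
  shows "moderate (\<lambda>z. f z + g z)"
proof (rule moderateI)
  fix B
  obtain K where K: "\<And>z. \<bar>Re z\<bar> \<le> B \<Longrightarrow> K \<le> Im z \<Longrightarrow> cmod (f z) \<le> exp (K * Im z)"
    using moderateD[OF assms(1)] by metis
  obtain L where L: "L > 0" "L \<ge> K" "\<And>z. \<bar>Re z\<bar> \<le> B \<Longrightarrow> L \<le> Im z \<Longrightarrow> cmod (g z) \<le> exp (L * Im z)"
    using moderateD[OF assms(2)] by metis
  have "cmod (f z + g z) \<le> 2 * exp (L * Im z)" if z: "\<bar>Re z\<bar> \<le> B" "L \<le> Im z" for z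
  proof -
    have "cmod (f z) \<le> exp (K * Im z)" using K z L by auto
    also have "\<dots> \<le> exp (L * Im z)" using z L by (simp add: mult_right_mono)
    finally show ?thesis using L(3)[OF z] norm_triangle_ineq[of "f z" "g z"] by linarith
  qed
  then show "\<exists>C K Y. \<forall>z. \<bar>Re z\<bar> \<le> B \<and> Y \<le> Im z \<longrightarrow> cmod (f z + g z) \<le> C * exp (K * Im z)"
    by blast
qed

lemma moderate_mult:
  assumes "moderate f" "moderate g"
  shows "moderate (\<lambda>z. f z * g z)"
proof (rule moderateI)
  fix B
  obtain K where K: "\<And>z. \<bar>Re z\<bar> \<le> B \<Longrightarrow> K \<le> Im z \<Longrightarrow> cmod (f z) \<le> exp (K * Im z)"
    using moderateD[OF assms(1)] by metis
  obtain L where L: "L \<ge> K" "\<And>z. \<bar>Re z\<bar> \<le> B \<Longrightarrow> L \<le> Im z \<Longrightarrow> cmod (g z) \<le> exp (L * Im z)"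
    using moderateD[OF assms(2)] by metis
  have "cmod (f z * g z) \<le> 1 * exp ((K + L) * Im z)" if z: "\<bar>Re z\<bar> \<le> B" "L \<le> Im z" for z
    using mult_mono[OF K[OF z(1)] L(2)[OF z]] z L(1)
    by (simp add: norm_mult exp_add distrib_right)
  then show "\<exists>C K Y. \<forall>z. \<bar>Re z\<bar> \<le> B \<and> Y \<le> Im z \<longrightarrow> cmod (f z * g z) \<le> C * exp (K * Im z)"
    by blast
qed

lemma moderate_sum:
  "(\<And>i. i \<in> I \<Longrightarrow> moderate (f i)) \<Longrightarrow> moderate (\<lambda>z. \<Sum>i\<in>I. f i z)"
  by (induction I rule: infinite_finite_induct) (auto intro: moderate_add moderate_const)

lemma moderate_matrix_mult:
  assumes "\<And>j. moderate (\<lambda>z. F z $ j)"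
  shows "moderate (\<lambda>z. (A *v F z) $ i)"
  unfolding matrix_vector_mult_def using assms
  by (auto intro!: moderate_sum moderate_mult moderate_const)

lemma moderate_exp: "moderate (\<lambda>z. exp (\<alpha> * z))"
proof (rule moderateI)
  fix B
  have "cmod (exp (\<alpha> * z)) \<le> exp (\<bar>Re \<alpha>\<bar> * B) * exp (- Im \<alpha> * Im z)" if "\<bar>Re z\<bar> \<le> B" for z
  proof -
    have "Re \<alpha> * Re z \<le> \<bar>Re \<alpha>\<bar> * B"
      using mult_left_mono[OF that, of "\<bar>Re \<alpha>\<bar>"] abs_ge_self[of "Re \<alpha> * Re z"]
      by (simp add: abs_mult)
    then show ?thesis by (simp flip: exp_add)
  qed
  then show "\<exists>C K Y. \<forall>z. \<bar>Re z\<bar> \<le> B \<and> Y \<le> Im z \<longrightarrow> cmod (exp (\<alpha> * z)) \<le> C * exp (K * Im z)"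
    by blast
qed

lemma moderate_affine:
  assumes f: "moderate f" and p: "p > 0"
  shows "moderate (\<lambda>z. f (of_real p * z + of_real q))"
proof (rule moderateI)
  fix B
  obtain K where K: "\<And>z. \<bar>Re z\<bar> \<le> p * B + \<bar>q\<bar> \<Longrightarrow> K \<le> Im z \<Longrightarrow> cmod (f z) \<le> exp (K * Im z)"
    using moderateD[OF f] by metis
  have "cmod (f (of_real p * z + of_real q)) \<le> 1 * exp ((K * p) * Im z)"
    if z: "\<bar>Re z\<bar> \<le> B" "K / p \<le> Im z" for z
  proof -
    have "\<bar>Re (of_real p * z + of_real q)\<bar> \<le> p * B + \<bar>q\<bar>"
    proof -
      have "p * \<bar>Re z\<bar> \<le> p * B" using z(1) p by (intro mult_left_mono) auto
      moreover have "\<bar>p * Re z + q\<bar> \<le> p * \<bar>Re z\<bar> + \<bar>q\<bar>"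
        using abs_triangle_ineq[of "p * Re z" q] p by (simp add: abs_mult)
      ultimately show ?thesis by simp
    qed
    moreover have "K \<le> Im (of_real p * z + of_real q)" using z(2) p by (simp add: field_simps)
    ultimately have "cmod (f (of_real p * z + of_real q)) \<le> exp (K * Im (of_real p * z + of_real q))"
      by (rule K)
    then show ?thesis by (simp add: mult.assoc)
  qed
  then show "\<exists>C K Y. \<forall>z. \<bar>Re z\<bar> \<le> B \<and> Y \<le> Im z \<longrightarrow>
      cmod (f (of_real p * z + of_real q)) \<le> C * exp (K * Im z)" by blast
qed

lemma periodic_int:
  assumes "\<And>z. z \<in> uhp \<Longrightarrow> f (z + of_real h) = f z" "z \<in> uhp"
  shows "f (z + of_int k * of_real h) = f z"
proof -
  have nat: "f (u + of_nat n * of_real h) = f u" if "u \<in> uhp" for n u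
  proof (induction n)
    case (Suc n)
    have "u + of_nat n * of_real h \<in> uhp" using that by (simp add: uhp_def)
    from assms(1)[OF this] show ?case using Suc by (simp add: algebra_simps)
  qed simp
  show ?thesis
  proof (cases "k \<ge> 0")
    case True
    then show ?thesis using nat[OF assms(2), of "nat k"] by simp
  next
    case False
    have "z + of_int k * of_real h \<in> uhp" using assms(2) by (simp add: uhp_def)
    from nat[OF this, of "nat (- k)"] show ?thesis using False by simp
  qed
qed

text \<open>Inside the disc the Taylor series converges absolutely, so the order of summation is
  irrelevant.\<close>

lemma power_series_has_sum:
  fixes c :: "nat \<Rightarrow> complex"
  assumes "\<And>w. w \<in> ball 0 1 \<Longrightarrow> (\<lambda>n. c n * w ^ n) sums G w" "w \<in> ball 0 1"
  shows "((\<lambda>n. c n * w ^ n) has_sum G w) UNIV"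
proof -
  obtain r where r: "cmod w < r" "r < 1" using assms(2) dense[of "cmod w" 1] by auto
  have "r > 0" using r(1) norm_ge_zero[of w] by linarith
  then have "summable (\<lambda>n. c n * of_real r ^ n)"
    using assms(1)[of "of_real r"] r by (auto simp: sums_iff)
  moreover have "cmod w < cmod (of_real r)" using r \<open>r > 0\<close> by simp
  ultimately have "summable (\<lambda>n. norm (c n * w ^ n))" by (rule powser_insidea)
  then show ?thesis using assms by (intro norm_summable_imp_has_sum)
qed

text \<open>With \<open>q = exp (2 \<pi> \<i> z / h)\<close> one has \<open>f z = g q\<close> for a function \<open>g\<close> on the punctured unit disc, and
  \<open>g\<close> is holomorphic because it can be written with any local branch of the logarithm. The growth
  condition bounds \<open>g\<close> by a power of \<open>1 / |q|\<close>, so \<open>q ^ M g\<close> extends holomorphically with value 0 at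
  the origin for large \<open>M\<close>, and its Taylor series is the expansion. The coefficients below
  \<open>- M\<close> are set to zero so that finitely many expansions can be given a common lower bound.\<close>

lemma periodic_moderate_imp_expansion:
  fixes f :: "complex \<Rightarrow> complex"
  assumes h: "h > 0" and holo: "f holomorphic_on uhp"
    and periodic: "\<And>z. z \<in> uhp \<Longrightarrow> f (z + of_real h) = f z"
    and growth: "moderate f"
  obtains M :: nat and a :: "int \<Rightarrow> complex"
  where "\<And>n. n < - int M \<Longrightarrow> a n = 0"
    "\<And>z. z \<in> uhp \<Longrightarrow>
      ((\<lambda>n. exp (2 * of_real pi * \<i> * of_int n * z / of_real h) * a n) has_sum f z) {- int M..}"
proof -
  define q where "q = (\<lambda>z. exp (2 * of_real pi * \<i> * z / of_real h))"
  define coord where "coord = (\<lambda>w. of_real h * w / (2 * of_real pi * \<i>))"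
  define g where "g = (\<lambda>w. f (coord (Ln w)))"
  have q_coord: "q (coord u) = exp u" for u using h by (simp add: q_def coord_def)
  have Im_coord: "Im (coord u) = - h * Re u / (2 * pi)" and Re_coord: "Re (coord u) = h * Im u / (2 * pi)" for u
    by (simp_all add: coord_def Re_divide Im_divide power2_eq_square field_simps)
  have g_q: "g (q z) = f z" if z: "z \<in> uhp" for z
  proof -
    have "exp (Ln (q z)) = exp (2 * of_real pi * \<i> * z / of_real h)" by (simp add: q_def)
    then obtain k :: int where
      "Ln (q z) = 2 * of_real pi * \<i> * z / of_real h + of_int (2 * k) * of_real pi * \<i>"
      unfolding exp_eq by auto
    then have "coord (Ln (q z)) = z + of_int k * of_real h"
      using h by (simp add: coord_def field_simps)
    then show ?thesis using periodic_int[where f = f and h = h, OF periodic z] by (simp add: g_def)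
  qed
  have g_exp: "g (exp u) = f (coord u)" if "Re u < 0" for u
    using g_q[of "coord u"] that h by (simp add: q_coord uhp_def Im_coord divide_neg_pos mult_pos_neg)
  have g_holo: "g holomorphic_on ball 0 1 - {0}"
    unfolding holomorphic_on_def
  proof
    fix w0 :: complex assume w0: "w0 \<in> ball 0 1 - {0}"
    define S where "S = ball w0 (cmod w0) \<inter> ball 0 1"
    have S: "w \<noteq> 0 \<and> cmod w < 1 \<and> w / w0 \<notin> \<real>\<^sub>\<le>\<^sub>0" if "w \<in> S" for w
    proof (intro conjI)
      have lt: "cmod (1 - w / w0) < 1"
        using that w0 by (simp add: S_def dist_norm diff_divide_eq_iff norm_divide)
      then have "Re (1 - w / w0) < 1" using complex_Re_le_cmod[of "1 - w / w0"] by linarith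
      then show "w / w0 \<notin> \<real>\<^sub>\<le>\<^sub>0" by (auto simp: complex_nonpos_Reals_iff)
      then show "w \<noteq> 0" by auto
    qed (use that in \<open>simp add: S_def\<close>)
    \<comment> \<open>A branch of the logarithm near \<open>w0\<close>; the principal branch may be discontinuous there.\<close>
    define L where "L = (\<lambda>w. Ln (w / w0) + Ln w0)"
    have expL: "exp (L w) = w" if "w \<in> S" for w
      using S[OF that] w0 by (simp add: L_def exp_add)
    have ReL: "Re (L w) < 0" if "w \<in> S" for w
    proof -
      have "exp (Re (L w)) = cmod w" using expL[OF that] by (metis norm_exp_eq_Re)
      then show ?thesis using S[OF that] by (metis exp_less_one_iff)
    qed
    have "(\<lambda>w. coord (L w)) holomorphic_on S"
      unfolding coord_def L_def using S w0 by (intro holomorphic_intros) auto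
    moreover have "coord (L w) \<in> uhp" if "w \<in> S" for w
      using ReL[OF that] h by (simp add: uhp_def Im_coord divide_neg_pos mult_pos_neg)
    ultimately have "(f \<circ> (\<lambda>w. coord (L w))) holomorphic_on S"
      using holo by (intro holomorphic_on_compose_gen) auto
    then have "g holomorphic_on S"
      by (rule holomorphic_transform) (use g_exp ReL expL in \<open>simp add: o_def, metis\<close>)
    moreover have "open S" "w0 \<in> S" using w0 by (auto simp: S_def)
    ultimately have "g field_differentiable (at w0)"
      using holomorphic_on_imp_differentiable_at by blast
    then show "g field_differentiable (at w0 within ball 0 1 - {0})"
      by (rule field_differentiable_at_within)
  qed
  obtain K where K: "K > 0"
    "\<And>z. \<bar>Re z\<bar> \<le> h \<Longrightarrow> K \<le> Im z \<Longrightarrow> cmod (f z) \<le> exp (K * Im z)"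
    using moderateD[OF growth] by metis
  \<comment> \<open>The growth condition reads \<open>|g w| \<le> |w| ^ (- K h / 2 \<pi>)\<close>; one power more forces the limit 0.\<close>
  define M where "M = nat \<lceil>K * h / (2 * pi)\<rceil> + 1"
  have M: "real M \<ge> K * h / (2 * pi) + 1"
    by (simp add: M_def) linarith
  have bound: "cmod (w ^ M * g w) \<le> cmod w" if w: "w \<noteq> 0" "cmod w < exp (- 2 * pi * K / h)" for w
  proof -
    have ln: "ln (cmod w) < - 2 * pi * K / h"
      using w by (metis exp_less_cancel_iff exp_ln zero_less_norm_iff)
    then have "ln (cmod w) * h < - 2 * pi * K" using h by (simp add: field_simps)
    then have "K \<le> Im (coord (Ln w))" using w(1) by (simp add: Im_coord field_simps)
    moreover have "\<bar>Re (coord (Ln w))\<bar> \<le> h"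
    proof -
      have "\<bar>Im (Ln w)\<bar> \<le> pi" using mpi_less_Im_Ln[OF w(1)] Im_Ln_le_pi[OF w(1)] by linarith
      then have "\<bar>Im (Ln w)\<bar> * h \<le> (2 * pi) * h" using h pi_gt_zero by (intro mult_right_mono) linarith+
      then show ?thesis using h by (simp add: Re_coord abs_mult field_simps)
    qed
    ultimately have "cmod (g w) \<le> exp (K * Im (coord (Ln w)))" unfolding g_def using K by blast
    also have "\<dots> = exp (- (K * h / (2 * pi)) * ln (cmod w))" using w(1) by (simp add: Im_coord)
    finally have "cmod (w ^ M * g w) \<le>
        exp (real M * ln (cmod w)) * exp (- (K * h / (2 * pi)) * ln (cmod w))"
      using w(1) by (simp add: norm_mult norm_power exp_of_nat_mult mult_left_mono)
    also have "\<dots> = exp ((real M - K * h / (2 * pi)) * ln (cmod w))"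
      by (simp add: left_diff_distrib flip: exp_add)
    also have "\<dots> \<le> exp (1 * ln (cmod w))"
    proof -
      have "ln (cmod w) \<le> 0"
      proof -
        have "- 2 * pi * K / h \<le> 0" using K(1) h by (simp add: field_simps)
        then show ?thesis using ln by linarith
      qed
      then show ?thesis using M by (subst exp_le_cancel_iff, intro mult_right_mono_neg) auto
    qed
    finally show ?thesis using w(1) by simp
  qed
  have "((\<lambda>w. w ^ M * g w) \<longlongrightarrow> 0) (at 0)"
  proof (rule Lim_null_comparison)
    show "((\<lambda>w::complex. cmod w) \<longlongrightarrow> 0) (at 0)" by (intro tendsto_eq_intros) auto
    show "\<forall>\<^sub>F w in at 0. cmod (w ^ M * g w) \<le> cmod w"
      unfolding eventually_at using bound
      by (intro exI[of _ "exp (- 2 * pi * K / h)"]) (auto simp: dist_norm)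
  qed
  moreover have "(\<lambda>w. w ^ M * g w) holomorphic_on ball 0 1 - {0}"
    using g_holo by (intro holomorphic_intros)
  ultimately have G_holo: "(\<lambda>w. if w = 0 then 0 else w ^ M * g w) holomorphic_on ball 0 1"
    by (intro removable_singularity) auto
  define G where "G = (\<lambda>w. if w = 0 then 0 else w ^ M * g w)"
  define c where "c = (\<lambda>n. (deriv ^^ n) G 0 / fact n)"
  have "(\<lambda>n. c n * w ^ n) sums G w" if "w \<in> ball 0 1" for w
    using holomorphic_power_series[OF G_holo that] by (simp add: G_def c_def)
  note series = power_series_has_sum[OF this]
  define a where "a = (\<lambda>n. if n < - int M then 0 else c (nat (n + int M)))"
  show ?thesis
  proof (rule that[of M a])
    fix z assume z: "z \<in> uhp"
    have q: "q z \<in> ball 0 1" "q z \<noteq> 0"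
      using z h by (auto simp: q_def uhp_def norm_exp_eq_Re Re_divide power2_eq_square field_simps)
    have "((\<lambda>n. inverse (q z ^ M) * (c n * q z ^ n)) has_sum (inverse (q z ^ M) * G (q z))) UNIV"
      using series[OF _ q(1)] by (intro has_sum_cmult_right) auto
    also have "inverse (q z ^ M) * G (q z) = f z"
      using q(2) g_q[OF z] by (simp add: G_def)
    also have "(\<lambda>n. inverse (q z ^ M) * (c n * q z ^ n)) =
        (\<lambda>n. exp (2 * of_real pi * \<i> * of_int (int n - int M) * z / of_real h) * a (int n - int M))"
    proof
      fix n
      have pw: "q z ^ k = exp (2 * of_real pi * \<i> * of_nat k * z / of_real h)" for k
        unfolding q_def by (simp add: mult_ac flip: exp_of_nat_mult)
      have "exp (2 * of_real pi * \<i> * of_int (int n - int M) * z / of_real h) =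
          q z ^ n / q z ^ M"
        unfolding pw by (simp add: algebra_simps diff_divide_distrib flip: exp_diff)
      then show "inverse (q z ^ M) * (c n * q z ^ n) =
          exp (2 * of_real pi * \<i> * of_int (int n - int M) * z / of_real h) * a (int n - int M)"
        by (simp add: a_def field_simps)
    qed
    finally show "((\<lambda>n. exp (2 * of_real pi * \<i> * of_int n * z / of_real h) * a n) has_sum f z) {- int M..}"
      by (rule iffD1[OF has_sum_reindex_bij_witness[where i = "\<lambda>n. nat (n + int M)"
              and j = "\<lambda>n. int n - int M"], rotated -1]) auto
  qed (simp add: a_def)
qed

text \<open>Absolute convergence at the point \<open>\<i>\<close> dominates the series at every point with larger imaginary
  part, after the most negative power of \<open>q\<close> has been taken out.\<close>

lemma expansion_imp_moderate:
  assumes h: "h > 0"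
    and series: "\<And>z. z \<in> uhp \<Longrightarrow>
      ((\<lambda>n. exp (2 * of_real pi * \<i> * of_int n * z / of_real h) * a n) has_sum f z) {- M..}"
  shows "moderate f"
proof (rule moderateI)
  fix B :: real
  have norm_exp: "cmod (exp (2 * of_real pi * \<i> * of_int n * z / of_real h)) =
      exp (- 2 * pi * of_int n * Im z / h)" for n :: int and z
    using h by (simp add: norm_exp_eq_Re Re_divide power2_eq_square field_simps)
  define t where "t = (\<lambda>n::int. exp (- 2 * pi * of_int n / h) * cmod (a n))"
  have "(\<lambda>n. exp (2 * of_real pi * \<i> * of_int n * \<i> / of_real h) * a n) summable_on {- M..}"
    using series[of \<i>] by (auto simp: uhp_def summable_on_def)
  then have "(\<lambda>n. cmod (exp (2 * of_real pi * \<i> * of_int n * \<i> / of_real h) * a n)) summable_on {- M..}"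
    by (simp only: summable_on_iff_abs_summable_on_complex)
  then have "t summable_on {- M..}"
    by (simp only: norm_mult norm_exp t_def) simp
  then obtain T where T: "(t has_sum T) {- M..}" by (auto simp: summable_on_def)
  have "cmod (f z) \<le> (T * exp (- (2 * pi * of_int M / h))) * exp ((2 * pi * of_int M / h) * Im z)"
    if z: "1 \<le> Im z" for z
  proof -
    define E where "E = exp (2 * pi * of_int M * (Im z - 1) / h)"
    have "cmod (f z) \<le> E * T"
    proof (rule norm_infsum_le)
      show "((\<lambda>n. exp (2 * of_real pi * \<i> * of_int n * z / of_real h) * a n) has_sum f z) {- M..}"
        using z by (intro series) (simp add: uhp_def)
      show "((\<lambda>n. E * t n) has_sum E * T) {- M..}" by (rule has_sum_cmult_right[OF T])
      fix n assume n: "n \<in> {- M..}"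
      have "- of_int n * (2 * pi * (Im z - 1)) \<le> of_int M * (2 * pi * (Im z - 1))"
        using n z by (intro mult_right_mono) auto
      then have "- 2 * pi * of_int n * Im z \<le> 2 * pi * of_int M * (Im z - 1) + - 2 * pi * of_int n"
        by (simp add: algebra_simps)
      then have "- 2 * pi * of_int n * Im z / h \<le> (2 * pi * of_int M * (Im z - 1) + - 2 * pi * of_int n) / h"
        using h by (intro divide_right_mono) auto
      then have "exp (- 2 * pi * of_int n * Im z / h) \<le> E * exp (- 2 * pi * of_int n / h)"
        unfolding E_def exp_add[symmetric] by (simp only: exp_le_cancel_iff add_divide_distrib)
      then show "cmod (exp (2 * of_real pi * \<i> * of_int n * z / of_real h) * a n) \<le> E * t n"
        unfolding norm_mult norm_exp t_def mult.assoc[symmetric] by (rule mult_right_mono) simp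
    qed
    also have "E = exp (- (2 * pi * of_int M / h)) * exp ((2 * pi * of_int M / h) * Im z)"
      unfolding E_def exp_add[symmetric] using h by (simp add: field_simps)
    finally show ?thesis by (simp add: mult_ac)
  qed
  then show "\<exists>C K Y. \<forall>z. \<bar>Re z\<bar> \<le> B \<and> Y \<le> Im z \<longrightarrow> cmod (f z) \<le> C * exp (K * Im z)" by blast
qed

section \<open>Weakly holomorphic forms and growth at the cusps\<close>

text \<open>Neither a group nor a representation enters, so this condition can be compared between \<open>G\<close> and
  \<open>H\<close>.\<close>

definition cusp_growth :: "int \<Rightarrow> bpoint \<Rightarrow> (complex \<Rightarrow> complex^'n) \<Rightarrow> bool" where
  "cusp_growth w c X \<longleftrightarrow> (\<forall>\<xi>. moderate (\<lambda>z. slash w X (cusp_mat c) z $ \<xi>))"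

lemma slash_matrix: "slash w (\<lambda>\<tau>. A *v X \<tau>) g = (\<lambda>\<tau>. A *v slash w X g \<tau>)"
  by (rule ext) (simp add: slash_def vector_scalar_commute)

lemma slash_cong:
  assumes "g \<in> carrier PSL2R" "\<And>\<tau>. \<tau> \<in> uhp \<Longrightarrow> X \<tau> = Y \<tau>"
  shows "slash w X g = slash w Y g"
proof
  show "slash w X g \<tau> = slash w Y g \<tau>" for \<tau>
    using assms(2)[OF moebius_in_uhp[OF assms(1), of \<tau>]] by (simp add: slash_def)
qed

text \<open>By \<open>mult_cusp_mat\<close>, slashing by \<open>g\<close> replaces the function at the cusp \<open>g c\<close> by its composite with
  the affine map \<open>z \<mapsto> a\<^sup>2 z + a b\<close>, up to a constant.\<close>

lemma cusp_growth_slash: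
  assumes g: "g \<in> carrier PSL2R" and w: "even w" and growth: "cusp_growth w (bact g c) X"
  shows "cusp_growth w c (slash w X g)"
proof -
  obtain a b where a: "a \<noteq> 0" and
    gA: "g \<otimes>\<^bsub>PSL2R\<^esub> cusp_mat c = cusp_mat (bact g c) \<otimes>\<^bsub>PSL2R\<^esub> pm_mat a b 0 (1 / a)"
    using mult_cusp_mat[OF g] by blast
  define U where "U = pm_mat a b 0 (1 / a)"
  have U: "U \<in> carrier PSL2R" using a by (simp add: U_def pm_mat_in_PSL2R)
  define F where "F = slash w X (cusp_mat (bact g c))"
  have "slash w (slash w X g) (cusp_mat c) = slash w F U"
    using g U w gA by (simp add: F_def U_def cusp_mat_in_PSL2R flip: slash_mult)
  moreover have "slash w F U z $ \<xi> =
      of_real (1 / a) powi (- w) * F (of_real (a\<^sup>2) * z + of_real (a * b)) $ \<xi>" if "z \<in> uhp" for z \<xi>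
  proof -
    have "moebius U z = of_real (a\<^sup>2) * z + of_real (a * b)"
      using a by (simp add: U_def moebius_pm_mat field_simps power2_eq_square)
    then show ?thesis using that w by (simp add: slash_def U_def aut_j_powi)
  qed
  moreover have "moderate (\<lambda>z. of_real (1 / a) powi (- w) * F (of_real (a\<^sup>2) * z + of_real (a * b)) $ \<xi>)" for \<xi>
    using growth a unfolding cusp_growth_def F_def
    by (intro moderate_mult moderate_const moderate_affine[where f = "\<lambda>z. _ z $ \<xi>"]) auto
  ultimately show ?thesis
    unfolding cusp_growth_def using moderate_cong by (metis (no_types, lifting))
qed

lemma cusp_growth_matrix:
  assumes "cusp_growth w c X"
  shows "cusp_growth w c (\<lambda>\<tau>. A *v X \<tau>)"
  unfolding cusp_growth_def slash_matrix
  by (intro allI moderate_matrix_mult) (use assms in \<open>simp add: cusp_growth_def\<close>)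

lemma cusp_growth_add:
  assumes "cusp_growth w c X" "cusp_growth w c Y"
  shows "cusp_growth w c (\<lambda>\<tau>. X \<tau> + Y \<tau>)"
proof -
  have "slash w (\<lambda>\<tau>. X \<tau> + Y \<tau>) g z $ \<xi> = slash w X g z $ \<xi> + slash w Y g z $ \<xi>" for g z \<xi>
    by (simp add: slash_def distrib_left)
  then show ?thesis using assms by (auto simp: cusp_growth_def intro: moderate_add)
qed

lemma cusp_growth_smult:
  fixes f :: "complex \<Rightarrow> complex^1"
  assumes "cusp_growth 0 c f" "cusp_growth w c X"
  shows "cusp_growth w c (\<lambda>\<tau>. f \<tau> $ 1 *s X \<tau>)"
proof -
  have "slash w (\<lambda>\<tau>. f \<tau> $ 1 *s X \<tau>) g z $ \<xi> = slash 0 f g z $ 1 * slash w X g z $ \<xi>" for g z \<xi>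
    by (simp add: slash_def)
  then show ?thesis using assms by (auto simp: cusp_growth_def intro!: moderate_mult)
qed

lemma cusp_growth_bounded:
  assumes "\<And>\<tau>. \<tau> \<in> uhp \<Longrightarrow> X \<tau> = v"
  shows "cusp_growth 0 c X"
proof -
  have "moderate (\<lambda>z. slash 0 X (cusp_mat c) z $ \<xi>) \<longleftrightarrow> moderate (\<lambda>z. v $ \<xi>)" for \<xi>
    using assms moebius_in_uhp[OF cusp_mat_in_PSL2R] by (intro moderate_cong) (simp add: slash_def)
  then show ?thesis by (simp add: cusp_growth_def moderate_const)
qed

lemma ball_uhp_moebius:
  assumes "g \<in> carrier PSL2R"
  shows "(\<forall>\<tau>\<in>uhp. Q \<tau>) \<longleftrightarrow> (\<forall>z\<in>uhp. Q (moebius g z))"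
proof
  assume *: "\<forall>z\<in>uhp. Q (moebius g z)"
  show "\<forall>\<tau>\<in>uhp. Q \<tau>"
  proof
    fix \<tau> assume \<tau>: "\<tau> \<in> uhp"
    have "moebius g (moebius (inv\<^bsub>PSL2R\<^esub> g) \<tau>) = \<tau>"
      using assms \<tau> by (simp add: moebius_one flip: moebius_mult)
    then show "Q \<tau>" using * moebius_in_uhp[OF PSL.inv_closed[OF assms] \<tau>] by metis
  qed
qed (use moebius_in_uhp[OF assms] in blast)

text \<open>The factor \<open>(\<tau> - c) ^ (-w)\<close> in the expansion is the automorphy factor of the cusp matrix: for
  \<open>\<tau> = c - 1 / z\<close> it equals \<open>(- 1 / z) ^ (-w) = z ^ w\<close>.\<close>

lemma cusp_factor_moebius:
  assumes "even w" "z \<in> uhp"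
  shows "cusp_factor w c (moebius (cusp_mat c) z) = aut_j (cusp_mat c) z powi w"
proof (cases c)
  case (Finite x)
  have "z \<noteq> 0" using assms(2) by (auto simp: uhp_def)
  then have "moebius (cusp_mat c) z - of_real x = - inverse z"
    by (simp add: Finite moebius_pm_mat field_simps)
  then show ?thesis using assms
    by (simp add: Finite aut_j_powi power_int_minus_left_even power_int_minus flip: power_int_inverse)
qed (use assms in \<open>simp add: aut_j_one\<close>)

text \<open>In the coordinate \<open>z\<close> with \<open>\<tau> = A\<^sub>c z\<close> the expansions at all cusps take the same form.\<close>

lemma has_cusp_expansion_iff_slash:
  assumes w: "even w"
  shows "has_cusp_expansion \<Gamma> w c P \<Lambda> X \<longleftrightarrow>
    (\<exists>(M::int) a. \<forall>z\<in>uhp. \<exists>S.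
       ((\<lambda>n. exp (2 * of_real pi * \<i> * of_int n * z / of_real (cusp_width \<Gamma> c)) *s a n) has_sum S) {- M..} \<and>
       slash w X (cusp_mat c) z =
         (P ** diag (\<lambda>\<xi>. exp (2 * of_real pi * \<i> * \<Lambda> \<xi> * z / of_real (cusp_width \<Gamma> c))) ** matrix_inv P) *v S)"
proof -
  have q: "cusp_q \<Gamma> c \<alpha> (moebius (cusp_mat c) z) =
      exp (2 * of_real pi * \<i> * \<alpha> * z / of_real (cusp_width \<Gamma> c))" if "z \<in> uhp" for \<alpha> z
    using that by (simp add: cusp_q_def cusp_mat_in_PSL2R moebius_one flip: moebius_mult)
  have pointwise:
    "(\<exists>S. ((\<lambda>n. cusp_q \<Gamma> c (of_int n) (moebius (cusp_mat c) z) *s a n) has_sum S) {- M..} \<and>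
        X (moebius (cusp_mat c) z) = cusp_factor w c (moebius (cusp_mat c) z) *s
          ((P ** diag (\<lambda>\<xi>. cusp_q \<Gamma> c (\<Lambda> \<xi>) (moebius (cusp_mat c) z)) ** matrix_inv P) *v S)) \<longleftrightarrow>
     (\<exists>S. ((\<lambda>n. exp (2 * of_real pi * \<i> * of_int n * z / of_real (cusp_width \<Gamma> c)) *s a n) has_sum S) {- M..} \<and>
       slash w X (cusp_mat c) z =
         (P ** diag (\<lambda>\<xi>. exp (2 * of_real pi * \<i> * \<Lambda> \<xi> * z / of_real (cusp_width \<Gamma> c))) ** matrix_inv P) *v S)"
    if z: "z \<in> uhp" for z and M :: int and a
    unfolding q[OF z] cusp_factor_moebius[OF w z] slash_eq_iff[OF cusp_mat_in_PSL2R z] ..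
  show ?thesis
    unfolding has_cusp_expansion_def
    by (rule ex_cong1, rule ex_cong1, rule trans[OF ball_uhp_moebius[OF cusp_mat_in_PSL2R[of c]]],
        rule ball_cong[OF refl], rule pointwise)
qed

text \<open>From \<open>t\<^sub>c A\<^sub>c = A\<^sub>c t\<^sup>h\<close>: in the coordinate at the cusp the generator acts by \<open>z \<mapsto> z + h\<close>.\<close>

lemma slash_cusp_gen_shift:
  assumes w: "even w" and z: "z \<in> uhp"
    and trans: "\<And>\<tau>. \<tau> \<in> uhp \<Longrightarrow> slash w X (cusp_gen \<Gamma> c) \<tau> = R *v X \<tau>"
  shows "slash w X (cusp_mat c) (z + of_real (cusp_width \<Gamma> c)) = R *v slash w X (cusp_mat c) z"
proof -
  define h where "h = cusp_width \<Gamma> c"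
  define t where "t = pm_mat 1 h 0 1"
  have t: "t \<in> carrier PSL2R" by (simp add: t_def pm_mat_in_PSL2R)
  note A = cusp_mat_in_PSL2R[of c]
  have gen: "cusp_gen \<Gamma> c \<in> carrier PSL2R" by (simp add: cusp_gen_def cusp_translation_in_PSL2R)
  have "cusp_gen \<Gamma> c \<otimes>\<^bsub>PSL2R\<^esub> cusp_mat c = cusp_mat c \<otimes>\<^bsub>PSL2R\<^esub> t"
    using A t by (simp add: cusp_gen_def cusp_translation_def t_def h_def PSL.m_assoc)
  then have "slash w (slash w X (cusp_mat c)) t = slash w (slash w X (cusp_gen \<Gamma> c)) (cusp_mat c)"
    using slash_mult[OF A t w] slash_mult[OF gen A w] by metis
  also have "\<dots> = slash w (\<lambda>\<tau>. R *v X \<tau>) (cusp_mat c)"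
    using trans by (intro slash_cong A) auto
  finally have "slash w (slash w X (cusp_mat c)) t z = R *v slash w X (cusp_mat c) z"
    by (simp add: slash_matrix)
  moreover have "slash w F t z = F (z + of_real h)" for F :: "complex \<Rightarrow> complex^'a"
    using z w by (simp add: slash_def t_def aut_j_powi moebius_pm_mat)
  ultimately show ?thesis by (simp add: h_def)
qed

text \<open>Write \<open>F\<close> for the form in the coordinate at the cusp. The components of \<open>P\<inverse> F\<close> are multiplied by
  \<open>exp (2 \<pi> \<i> \<Lambda> \<xi>)\<close> under \<open>z \<mapsto> z + h\<close>, so the functions \<open>f \<xi> = q ^ (- \<Lambda> \<xi>) (P\<inverse> F) \<xi>\<close> are periodic. An
  expansion of the form amounts to Fourier expansions of the \<open>f \<xi>\<close>, and moderate growth passes between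
  \<open>F\<close> and the \<open>f \<xi>\<close> because the factors \<open>q ^ (\<plusminus> \<Lambda> \<xi>)\<close> are moderate.\<close>

lemma has_cusp_expansion_iff_growth:
  fixes X :: "complex \<Rightarrow> complex^'n"
  assumes w: "even w" and h: "cusp_width \<Gamma> c > 0" and R: "diagonalized_by R P \<Lambda>"
    and holo: "\<And>\<xi>. (\<lambda>\<tau>. X \<tau> $ \<xi>) holomorphic_on uhp"
    and trans: "\<And>\<tau>. \<tau> \<in> uhp \<Longrightarrow> slash w X (cusp_gen \<Gamma> c) \<tau> = R *v X \<tau>"
  shows "has_cusp_expansion \<Gamma> w c P \<Lambda> X \<longleftrightarrow> cusp_growth w c X"
proof -
  define h where "h = cusp_width \<Gamma> c"
  have h0: "h > 0" using h by (simp add: h_def)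
  define F where "F = slash w X (cusp_mat c)"
  define e where "e = (\<lambda>\<xi> z. exp (2 * of_real pi * \<i> * \<Lambda> \<xi> * z / of_real h))"
  have P: "invertible P" using R by (simp add: diagonalized_by_def)
  define f where "f = (\<lambda>\<xi> z. inverse (e \<xi> z) * (matrix_inv P *v F z) $ \<xi>)"
  have e0: "e \<xi> z \<noteq> 0" for \<xi> z by (simp add: e_def)
  have e_alt: "e \<xi> z = exp ((2 * of_real pi * \<i> * \<Lambda> \<xi> / of_real h) * z)"
    "inverse (e \<xi> z) = exp ((- (2 * of_real pi * \<i> * \<Lambda> \<xi> / of_real h)) * z)" for \<xi> z
    by (simp_all add: e_def exp_minus)
  have F_f: "F z = (P ** diag (\<lambda>\<xi>. e \<xi> z) ** matrix_inv P) *v S \<longleftrightarrow> (\<chi> \<xi>. f \<xi> z) = matrix_inv P *v S" for z S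
  proof -
    have "(P ** diag (\<lambda>\<xi>. e \<xi> z) ** matrix_inv P) *v S =
        P *v (diag (\<lambda>\<xi>. e \<xi> z) *v (matrix_inv P *v S))"
      by (simp add: matrix_vector_mul_assoc matrix_mul_assoc)
    moreover have "F z = P *v u \<longleftrightarrow> matrix_inv P *v F z = u" for u
      using matrix_inv_vector_cancel[OF P] by auto
    ultimately have "F z = (P ** diag (\<lambda>\<xi>. e \<xi> z) ** matrix_inv P) *v S \<longleftrightarrow>
        matrix_inv P *v F z = diag (\<lambda>\<xi>. e \<xi> z) *v (matrix_inv P *v S)"
      by simp
    also have "\<dots> \<longleftrightarrow> (\<chi> \<xi>. f \<xi> z) = matrix_inv P *v S"
      using e0 by (auto simp: vec_eq_iff diag_mult_vector f_def field_simps)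
    finally show ?thesis .
  qed
  have expansion_iff: "has_cusp_expansion \<Gamma> w c P \<Lambda> X \<longleftrightarrow>
    (\<exists>(M::int) a. \<forall>z\<in>uhp. \<exists>S.
       ((\<lambda>n. exp (2 * of_real pi * \<i> * of_int n * z / of_real h) *s a n) has_sum S) {- M..} \<and>
       (\<chi> \<xi>. f \<xi> z) = matrix_inv P *v S)"
    unfolding has_cusp_expansion_iff_slash[OF w] F_def[symmetric] h_def[symmetric] F_f[symmetric]
      e_def ..
  show ?thesis
  proof
    assume "has_cusp_expansion \<Gamma> w c P \<Lambda> X"
    then obtain M a where Ma: "\<forall>z\<in>uhp. \<exists>S.
       ((\<lambda>n. exp (2 * of_real pi * \<i> * of_int n * z / of_real h) *s a n) has_sum S) {- M..} \<and>
       (\<chi> \<xi>. f \<xi> z) = matrix_inv P *v S"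
      unfolding expansion_iff by blast
    have f_mod: "moderate (f \<xi>)" for \<xi>
    proof (rule expansion_imp_moderate[OF h0])
      fix z assume "z \<in> uhp"
      then obtain S where
        S: "((\<lambda>n. exp (2 * of_real pi * \<i> * of_int n * z / of_real h) *s a n) has_sum S) {- M..}"
        and fS: "(\<chi> \<xi>. f \<xi> z) = matrix_inv P *v S"
        using Ma by blast
      have "f \<xi> z = (matrix_inv P *v S) $ \<xi>" by (simp flip: fS)
      then show "((\<lambda>n. exp (2 * of_real pi * \<i> * of_int n * z / of_real h) * (matrix_inv P *v a n) $ \<xi>)
          has_sum f \<xi> z) {- M..}"
        using has_sum_matrix_vector[OF S, of "matrix_inv P"]
        by (simp add: has_sum_vec_iff vector_scalar_commute)
    qed
    have PF: "(matrix_inv P *v F z) $ \<xi> = e \<xi> z * f \<xi> z" for z \<xi>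
      using e0 by (simp add: f_def)
    have "moderate (\<lambda>z. (matrix_inv P *v F z) $ \<xi>)" for \<xi>
      unfolding PF e_alt(1) by (intro moderate_mult moderate_exp f_mod)
    then have "moderate (\<lambda>z. (P *v (matrix_inv P *v F z)) $ \<xi>)" for \<xi>
      by (rule moderate_matrix_mult)
    then show "cusp_growth w c X"
      by (simp add: cusp_growth_def F_def matrix_inv_vector_cancel[OF P])
  next
    assume growth: "cusp_growth w c X"
    have F_mod: "moderate (\<lambda>z. F z $ \<xi>)" for \<xi> using growth by (simp add: cusp_growth_def F_def)
    have f_mod: "moderate (f \<xi>)" for \<xi>
      unfolding f_def e_alt(2) by (intro moderate_mult moderate_exp moderate_matrix_mult F_mod)
    have F_holo: "(\<lambda>z. F z $ \<xi>) holomorphic_on uhp" for \<xi>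
      unfolding F_def by (intro holomorphic_on_slash cusp_mat_in_PSL2R w holo)
    have f_holo: "f \<xi> holomorphic_on uhp" for \<xi>
      unfolding f_def e_alt(2)
      by (rule holomorphic_on_mult)
         (intro holomorphic_intros, rule holomorphic_on_matrix_vector[OF F_holo])
    have f_periodic: "f \<xi> (z + of_real h) = f \<xi> z" if "z \<in> uhp" for \<xi> z
    proof -
      define D where "D = diag (\<lambda>\<xi>. exp (2 * of_real pi * \<i> * \<Lambda> \<xi>))"
      have "F (z + of_real h) = R *v F z"
        unfolding F_def h_def by (rule slash_cusp_gen_shift[OF w that trans])
      moreover have "matrix_inv P ** R = D ** matrix_inv P"
        using R matrix_inv_cancel[OF P] unfolding diagonalized_by_def D_def
        by (metis matrix_mul_assoc matrix_mul_rid)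
      ultimately have "matrix_inv P *v F (z + of_real h) = D *v (matrix_inv P *v F z)"
        by (simp add: matrix_vector_mul_assoc)
      then have "(matrix_inv P *v F (z + of_real h)) $ \<xi> =
          exp (2 * of_real pi * \<i> * \<Lambda> \<xi>) * (matrix_inv P *v F z) $ \<xi>"
        by (simp add: D_def diag_mult_vector)
      moreover have "e \<xi> (z + of_real h) = exp (2 * of_real pi * \<i> * \<Lambda> \<xi>) * e \<xi> z"
        using h0 by (simp add: e_def field_simps flip: exp_add)
      ultimately show ?thesis by (simp add: f_def)
    qed
    define series where "series = (\<lambda>\<xi> M a. (\<forall>n. n < - int M \<longrightarrow> a n = 0) \<and> (\<forall>z\<in>uhp.
        ((\<lambda>n. exp (2 * of_real pi * \<i> * of_int n * z / of_real h) * a n) has_sum f \<xi> z) {- int M..}))"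
    have "\<exists>M a. series \<xi> M a" for \<xi>
      unfolding series_def
      by (rule periodic_moderate_imp_expansion[where f = "f \<xi>", OF h0 f_holo f_periodic f_mod]) blast+
    then obtain M a where Ma: "\<And>\<xi>. series \<xi> (M \<xi>) (a \<xi>)" by metis
    have a0: "a \<xi> n = 0" if "n < - int (M \<xi>)" for \<xi> n
      using Ma[of \<xi>] that by (simp add: series_def)
    have a: "((\<lambda>n. exp (2 * of_real pi * \<i> * of_int n * z / of_real h) * a \<xi> n)
          has_sum f \<xi> z) {- int (M \<xi>)..}" if "z \<in> uhp" for \<xi> z
      using Ma[of \<xi>] that by (simp add: series_def)
    define N where "N = int (Max (range M))"
    have MN: "int (M \<xi>) \<le> N" for \<xi> by (simp add: N_def)
    have sum: "((\<lambda>n. exp (2 * of_real pi * \<i> * of_int n * z / of_real h) *s (P *v (\<chi> \<xi>. a \<xi> n)))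
          has_sum (P *v (\<chi> \<xi>. f \<xi> z))) {- N..}" if z: "z \<in> uhp" for z
    proof -
      have "((\<lambda>n. exp (2 * of_real pi * \<i> * of_int n * z / of_real h) * a \<xi> n) has_sum f \<xi> z) {- N..}" for \<xi>
      proof (rule iffD1[OF has_sum_cong_neutral a[OF z, of \<xi>]])
        fix n assume "n \<in> {- int (M \<xi>)..} - {- N..}"
        then show "exp (2 * of_real pi * \<i> * of_int n * z / of_real h) * a \<xi> n = 0"
          using MN[of \<xi>] by auto
      qed (auto simp: a0)
      then have "((\<lambda>n. exp (2 * of_real pi * \<i> * of_int n * z / of_real h) *s (\<chi> \<xi>. a \<xi> n))
          has_sum (\<chi> \<xi>. f \<xi> z)) {- N..}"
        by (simp add: has_sum_vec_iff)
      from has_sum_matrix_vector[OF this, of P] show ?thesis by (simp add: vector_scalar_commute)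
    qed
    show "has_cusp_expansion \<Gamma> w c P \<Lambda> X"
      unfolding expansion_iff
    proof (intro exI[of _ N] exI[of _ "\<lambda>n. P *v (\<chi> \<xi>. a \<xi> n)"] ballI exI conjI)
      fix z assume "z \<in> uhp"
      then show "((\<lambda>n. exp (2 * of_real pi * \<i> * of_int n * z / of_real h) *s (P *v (\<chi> \<xi>. a \<xi> n)))
          has_sum (P *v (\<chi> \<xi>. f \<xi> z))) {- N..}" by (rule sum)
    qed (simp add: matrix_inv_vector_cancel[OF P])
  qed
qed

text \<open>What the expansions of forms require of a representation: diagonalizability at every cusp, not
  only at a set of representatives.\<close>

definition cuspidally_diagonalizable :: "psl set \<Rightarrow> (psl \<Rightarrow> complex^'n^'n) \<Rightarrow> bool" where
  "cuspidally_diagonalizable \<Gamma> \<rho> \<longleftrightarrow>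
     (\<exists>\<Lambda>. diagonalized_by (\<rho> (cusp_gen \<Gamma> Infty)) (mat 1) \<Lambda>) \<and>
     (\<forall>c. cusp \<Gamma> c \<longrightarrow> (\<exists>P \<Lambda>. diagonalized_by (\<rho> (cusp_gen \<Gamma> c)) P \<Lambda>))"

text \<open>The expansion may be taken with respect to any diagonalizing pair, since growth does not depend
  on the pair.\<close>

lemma wh_forms_iff_growth:
  fixes X :: "complex \<Rightarrow> complex^'n"
  assumes \<Gamma>: "subgroup \<Gamma> PSL2R" "discrete (\<Union>\<Gamma>)" and Infty: "cusp \<Gamma> Infty"
    and \<rho>: "cuspidally_diagonalizable \<Gamma> \<rho>" and w: "even w"
  shows "X \<in> wh_forms \<Gamma> w \<rho> \<longleftrightarrow>
    (\<forall>\<tau>. \<tau> \<notin> uhp \<longrightarrow> X \<tau> = 0) \<and>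
    (\<forall>\<xi>. (\<lambda>\<tau>. X \<tau> $ \<xi>) holomorphic_on uhp) \<and>
    (\<forall>g\<in>\<Gamma>. \<forall>\<tau>\<in>uhp. slash w X g \<tau> = \<rho> g *v X \<tau>) \<and>
    (\<forall>c. cusp \<Gamma> c \<longrightarrow> cusp_growth w c X)"
proof -
  have trans: "(\<forall>g\<in>\<Gamma>. \<forall>\<tau>\<in>uhp. X (moebius g \<tau>) = (aut_j g \<tau> powi w) *s (\<rho> g *v X \<tau>)) \<longleftrightarrow>
      (\<forall>g\<in>\<Gamma>. \<forall>\<tau>\<in>uhp. slash w X g \<tau> = \<rho> g *v X \<tau>)"
    using \<Gamma>(1) by (simp add: slash_eq_iff subgroup.mem_carrier)
  show ?thesis
  proof (cases "(\<forall>\<xi>. (\<lambda>\<tau>. X \<tau> $ \<xi>) holomorphic_on uhp) \<and>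
      (\<forall>g\<in>\<Gamma>. \<forall>\<tau>\<in>uhp. slash w X g \<tau> = \<rho> g *v X \<tau>)")
    case True
    have iff: "has_cusp_expansion \<Gamma> w c P \<Lambda> X \<longleftrightarrow> cusp_growth w c X"
      if "cusp \<Gamma> c" "diagonalized_by (\<rho> (cusp_gen \<Gamma> c)) P \<Lambda>" for c P \<Lambda>
      using True cusp_width_generates(1,2)[OF \<Gamma> that(1)]
      by (intro has_cusp_expansion_iff_growth[OF w _ that(2)]) auto
    have at_Infty: "(\<exists>\<Lambda>. diagonalized_by (\<rho> (cusp_gen \<Gamma> Infty)) (mat 1) \<Lambda> \<and>
        has_cusp_expansion \<Gamma> w Infty (mat 1) \<Lambda> X) \<longleftrightarrow> cusp_growth w Infty X"
      using iff[OF Infty] \<rho> unfolding cuspidally_diagonalizable_def by blast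
    have at_c: "(\<exists>P \<Lambda>. diagonalized_by (\<rho> (cusp_gen \<Gamma> c)) P \<Lambda> \<and>
        has_cusp_expansion \<Gamma> w c P \<Lambda> X) \<longleftrightarrow> cusp_growth w c X" if "cusp \<Gamma> c" for c
      using iff[OF that] that \<rho> unfolding cuspidally_diagonalizable_def by blast
    have "(\<forall>c. cusp \<Gamma> c \<and> c \<noteq> Infty \<longrightarrow> (\<exists>P \<Lambda>. diagonalized_by (\<rho> (cusp_gen \<Gamma> c)) P \<Lambda> \<and>
        has_cusp_expansion \<Gamma> w c P \<Lambda> X)) \<longleftrightarrow>
        (\<forall>c. cusp \<Gamma> c \<and> c \<noteq> Infty \<longrightarrow> cusp_growth w c X)"
      by (simp add: at_c cong: imp_cong)
    then show ?thesis
      unfolding wh_forms_def mem_Collect_eq trans at_Infty using True Infty by (simp only:) blast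
  next
    case False
    then show ?thesis unfolding wh_forms_def mem_Collect_eq trans by blast
  qed
qed

section \<open>Admissible representations\<close>

lemma hom_GL_iff:
  "\<rho> \<in> hom (PSL2R\<lparr>carrier := \<Gamma>\<rparr>) GL \<longleftrightarrow>
    (\<forall>g\<in>\<Gamma>. invertible (\<rho> g)) \<and> (\<forall>g\<in>\<Gamma>. \<forall>h\<in>\<Gamma>. \<rho> (g \<otimes>\<^bsub>PSL2R\<^esub> h) = \<rho> g ** \<rho> h)"
  by (auto simp: hom_def GL_def)

lemma hom_GL_one:
  fixes \<rho> :: "psl \<Rightarrow> complex^'n^'n"
  assumes "subgroup \<Gamma> PSL2R" "\<rho> \<in> hom (PSL2R\<lparr>carrier := \<Gamma>\<rparr>) GL"
  shows "\<rho> \<one>\<^bsub>PSL2R\<^esub> = mat 1"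
proof -
  have 1: "\<one>\<^bsub>PSL2R\<^esub> \<in> \<Gamma>" using assms(1) by (rule subgroup.one_closed)
  then have "\<rho> \<one>\<^bsub>PSL2R\<^esub> ** \<rho> \<one>\<^bsub>PSL2R\<^esub> = \<rho> \<one>\<^bsub>PSL2R\<^esub>" and inv: "invertible (\<rho> \<one>\<^bsub>PSL2R\<^esub>)"
    using assms(2) by (auto simp: hom_GL_iff simp del: PSL.l_one PSL.r_one) (metis PSL.l_one PSL.one_closed)
  then have "matrix_inv (\<rho> \<one>\<^bsub>PSL2R\<^esub>) ** (\<rho> \<one>\<^bsub>PSL2R\<^esub> ** \<rho> \<one>\<^bsub>PSL2R\<^esub>) = matrix_inv (\<rho> \<one>\<^bsub>PSL2R\<^esub>) ** \<rho> \<one>\<^bsub>PSL2R\<^esub>"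
    by simp
  then show ?thesis using matrix_inv_cancel(2)[OF inv] by (simp add: matrix_mul_assoc)
qed

lemma hom_conj_rep:
  fixes \<rho> :: "psl \<Rightarrow> complex^'n^'n"
  assumes "\<rho> \<in> hom (PSL2R\<lparr>carrier := \<Gamma>\<rparr>) GL" "invertible P"
  shows "conj_rep P \<rho> \<in> hom (PSL2R\<lparr>carrier := \<Gamma>\<rparr>) GL"
proof -
  have "invertible (conj_rep P \<rho> g)" if "g \<in> \<Gamma>" for g
    using assms that unfolding conj_rep_def hom_GL_iff
    by (intro invertible_mult invertible_matrix_inv) auto
  moreover have "conj_rep P \<rho> (g \<otimes>\<^bsub>PSL2R\<^esub> h) = conj_rep P \<rho> g ** conj_rep P \<rho> h"
    if "g \<in> \<Gamma>" "h \<in> \<Gamma>" for g h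
  proof -
    have "conj_rep P \<rho> g ** conj_rep P \<rho> h =
        matrix_inv P ** \<rho> g ** (P ** matrix_inv P) ** \<rho> h ** P"
      by (simp add: conj_rep_def matrix_mul_assoc)
    then show ?thesis
      using that assms(1) matrix_inv_cancel(1)[OF assms(2)]
      by (simp add: conj_rep_def hom_GL_iff matrix_mul_assoc)
  qed
  ultimately show ?thesis by (simp add: hom_GL_iff)
qed

lemma hom_power_vector:
  fixes R :: "psl \<Rightarrow> complex^'n^'n"
  assumes \<Gamma>: "subgroup \<Gamma> PSL2R" and R: "R \<in> hom (PSL2R\<lparr>carrier := \<Gamma>\<rparr>) GL" and x: "x \<in> \<Gamma>"
  shows "(((*v) (R x)) ^^ n) v = R (x [^]\<^bsub>PSL2R\<^esub> n) *v v" "x [^]\<^bsub>PSL2R\<^esub> n \<in> \<Gamma>"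
proof -
  have pow: "x [^]\<^bsub>PSL2R\<^esub> n \<in> \<Gamma>" for n :: nat
    by (induction n) (use x \<Gamma> in \<open>auto simp: subgroup.one_closed subgroup.m_closed\<close>)
  then show "x [^]\<^bsub>PSL2R\<^esub> n \<in> \<Gamma>" .
  have xP: "x \<in> carrier PSL2R" using \<Gamma> x by (rule subgroup.mem_carrier)
  show "(((*v) (R x)) ^^ n) v = R (x [^]\<^bsub>PSL2R\<^esub> n) *v v"
  proof (induction n)
    case (Suc n)
    have "R (x \<otimes>\<^bsub>PSL2R\<^esub> x [^]\<^bsub>PSL2R\<^esub> n) = R x ** R (x [^]\<^bsub>PSL2R\<^esub> n)"
      using R x pow by (simp add: hom_GL_iff)
    moreover have "x [^]\<^bsub>PSL2R\<^esub> Suc n = x \<otimes>\<^bsub>PSL2R\<^esub> x [^]\<^bsub>PSL2R\<^esub> n"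
      using xP by (rule PSL.nat_pow_Suc2)
    ultimately show ?case by (simp only: funpow.simps o_def Suc matrix_vector_mul_assoc)
  qed (simp add: hom_GL_one[OF \<Gamma> R])
qed

lemma diagonalizable_hom_conj:
  fixes \<rho> :: "psl \<Rightarrow> complex^'n^'n"
  assumes \<Gamma>: "subgroup \<Gamma> PSL2R" and \<rho>: "\<rho> \<in> hom (PSL2R\<lparr>carrier := \<Gamma>\<rparr>) GL"
    and gx: "g \<in> \<Gamma>" "x \<in> \<Gamma>" and diag: "diagonalizable (\<rho> x)"
  shows "diagonalizable (\<rho> (g \<otimes>\<^bsub>PSL2R\<^esub> x \<otimes>\<^bsub>PSL2R\<^esub> inv\<^bsub>PSL2R\<^esub> g))"
proof -
  have g': "inv\<^bsub>PSL2R\<^esub> g \<in> \<Gamma>" using \<Gamma> gx(1) by (rule subgroup.m_inv_closed)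
  have gP: "g \<in> carrier PSL2R" using \<Gamma> gx(1) by (rule subgroup.mem_carrier)
  have mult: "\<And>a b. a \<in> \<Gamma> \<Longrightarrow> b \<in> \<Gamma> \<Longrightarrow> \<rho> (a \<otimes>\<^bsub>PSL2R\<^esub> b) = \<rho> a ** \<rho> b"
    using \<rho> by (simp add: hom_GL_iff)
  have "\<rho> g ** \<rho> (inv\<^bsub>PSL2R\<^esub> g) = mat 1"
    using mult[OF gx(1) g'] hom_GL_one[OF \<Gamma> \<rho>] gP by simp
  then have "matrix_inv (\<rho> (inv\<^bsub>PSL2R\<^esub> g)) = \<rho> g" by (rule matrix_inv_eqI)
  moreover have "\<rho> (g \<otimes>\<^bsub>PSL2R\<^esub> x \<otimes>\<^bsub>PSL2R\<^esub> inv\<^bsub>PSL2R\<^esub> g) = \<rho> g ** \<rho> x ** \<rho> (inv\<^bsub>PSL2R\<^esub> g)"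
    using gx g' \<Gamma> by (simp add: mult subgroup.m_closed)
  moreover have "invertible (\<rho> (inv\<^bsub>PSL2R\<^esub> g))" using g' \<rho> by (simp add: hom_GL_iff)
  ultimately show ?thesis using diagonalizable_conj[OF diag] by metis
qed

text \<open>Generators at equivalent cusps are conjugate in the group, so diagonalizability spreads from
  the representatives to all cusps.\<close>

lemma admissible_imp:
  fixes \<rho> :: "psl \<Rightarrow> complex^'n^'n"
  assumes \<Gamma>: "subgroup \<Gamma> PSL2R" "discrete (\<Union>\<Gamma>)" and adm: "admissible \<Gamma> \<rho>"
  shows "\<rho> \<in> hom (PSL2R\<lparr>carrier := \<Gamma>\<rparr>) GL" "cusp \<Gamma> Infty" "cuspidally_diagonalizable \<Gamma> \<rho>"
proof -
  show \<rho>: "\<rho> \<in> hom (PSL2R\<lparr>carrier := \<Gamma>\<rparr>) GL" using adm by (simp add: admissible_def)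
  obtain C where C: "cusp_representatives \<Gamma> C"
    and diagC: "\<forall>c\<in>C - {Infty}. \<exists>P \<Lambda>. diagonalized_by (\<rho> (cusp_gen \<Gamma> c)) P \<Lambda>"
    using adm by (auto simp: admissible_def)
  obtain \<Lambda> where Infty: "diagonalized_by (\<rho> (cusp_gen \<Gamma> Infty)) (mat 1) \<Lambda>"
    using adm by (auto simp: admissible_def)
  show "cusp \<Gamma> Infty" using C by (auto simp: cusp_representatives_def)
  have "\<exists>P \<Lambda>. diagonalized_by (\<rho> (cusp_gen \<Gamma> c)) P \<Lambda>" if c: "cusp \<Gamma> c" for c
  proof -
    obtain c' g where c': "c' \<in> C" "g \<in> \<Gamma>" "bact g c' = c"
      using C c unfolding cusp_representatives_def by blast
    have cusp': "cusp \<Gamma> c'" using C c'(1) by (auto simp: cusp_representatives_def)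
    have "diagonalizable (\<rho> (cusp_gen \<Gamma> c'))"
    proof (cases "c' = Infty")
      case True
      then show ?thesis using Infty by (auto intro: diagonalized_by_imp_diagonalizable)
    next
      case False
      then have "\<exists>P \<Lambda>. diagonalized_by (\<rho> (cusp_gen \<Gamma> c')) P \<Lambda>" using diagC c'(1) by blast
      then show ?thesis by (auto intro: diagonalized_by_imp_diagonalizable)
    qed
    then have "diagonalizable (\<rho> (cusp_gen \<Gamma> c))"
      using diagonalizable_hom_conj[OF \<Gamma>(1) \<rho> c'(2) cusp_width_generates(2)[OF \<Gamma> cusp']]
        cusp_bact(2)[OF \<Gamma> cusp' c'(2)] c'(3) by simp
    moreover have "invertible (\<rho> (cusp_gen \<Gamma> c))"
      using \<rho> cusp_width_generates(2)[OF \<Gamma> c] by (simp add: hom_GL_iff)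
    ultimately show ?thesis by (rule diagonalizable_imp_diagonalized_by)
  qed
  then show "cuspidally_diagonalizable \<Gamma> \<rho>"
    using Infty by (auto simp: cuspidally_diagonalizable_def)
qed

text \<open>One point is chosen in every orbit of cusps, and infinity is chosen in its own orbit.\<close>

lemma exists_cusp_representatives:
  assumes \<Gamma>: "subgroup \<Gamma> PSL2R" "discrete (\<Union>\<Gamma>)" and Infty: "cusp \<Gamma> Infty"
  shows "\<exists>C. cusp_representatives \<Gamma> C"
proof -
  define orb where "orb c = (\<lambda>g. bact g c) ` \<Gamma>" for c
  have carr: "g \<in> carrier PSL2R" if "g \<in> \<Gamma>" for g using \<Gamma>(1) that by (rule subgroup.mem_carrier)
  have orb_refl: "c \<in> orb c" for c
    unfolding orb_def using subgroup.one_closed[OF \<Gamma>(1)] bact_one[of c] by force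
  have orb_subset: "orb c' \<subseteq> orb c" if "c' \<in> orb c" for c c'
  proof
    fix x assume "x \<in> orb c'"
    then obtain g h where gh: "g \<in> \<Gamma>" "h \<in> \<Gamma>" "c' = bact g c" "x = bact h c'"
      using \<open>c' \<in> orb c\<close> by (auto simp: orb_def)
    then have "x = bact (h \<otimes>\<^bsub>PSL2R\<^esub> g) c" by (simp add: bact_mult carr)
    then show "x \<in> orb c" using gh subgroup.m_closed[OF \<Gamma>(1)] by (auto simp: orb_def)
  qed
  have orb_sym: "c \<in> orb c'" if c': "c' \<in> orb c" for c c'
  proof -
    obtain g where g: "g \<in> \<Gamma>" "c' = bact g c" using c' by (auto simp: orb_def)
    then have "bact (inv\<^bsub>PSL2R\<^esub> g) c' = c" by (simp add: bact_one carr flip: bact_mult)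
    then show ?thesis using g(1) subgroup.m_inv_closed[OF \<Gamma>(1)] unfolding orb_def by force
  qed
  have orb_eq: "orb c' = orb c" if "c' \<in> orb c" for c c'
    using orb_subset[OF that] orb_subset[OF orb_sym[OF that]] by (rule equalityI)
  \<comment> \<open>The choice depends on the orbit only, so equivalent cusps get the same representative.\<close>
  define pick where "pick = (\<lambda>O'. if Infty \<in> O' then Infty else SOME c. c \<in> O')"
  have pick: "pick (orb c) \<in> orb c" for c
    using orb_refl[of c] by (auto simp: pick_def intro: someI)
  define C where "C = pick ` orb ` {c. cusp \<Gamma> c}"
  have "cusp_representatives \<Gamma> C"
    unfolding cusp_representatives_def
  proof (intro conjI ballI allI impI)
    fix c assume "c \<in> C"
    then obtain b where b: "cusp \<Gamma> b" "c = pick (orb b)" by (auto simp: C_def)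
    then have "c \<in> orb b" using pick by simp
    then show "cusp \<Gamma> c" using cusp_bact(1)[OF \<Gamma> b(1)] by (auto simp: orb_def)
  next
    show "Infty \<in> C"
      unfolding C_def using Infty orb_refl[of Infty]
      by (intro image_eqI[of _ _ "orb Infty"] image_eqI[of _ _ Infty]) (auto simp: pick_def)
  next
    fix c assume c: "cusp \<Gamma> c"
    show "\<exists>!c'. c' \<in> C \<and> (\<exists>g\<in>\<Gamma>. bact g c' = c)"
    proof (rule ex1I[of _ "pick (orb c)"])
      have "c \<in> orb (pick (orb c))" by (rule orb_sym[OF pick])
      then have "\<exists>g\<in>\<Gamma>. bact g (pick (orb c)) = c" unfolding orb_def[of "pick (orb c)"] by (auto intro: sym)
      moreover have "pick (orb c) \<in> C" unfolding C_def using c by blast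
      ultimately show "pick (orb c) \<in> C \<and> (\<exists>g\<in>\<Gamma>. bact g (pick (orb c)) = c)" by blast
    next
      fix c' assume c': "c' \<in> C \<and> (\<exists>g\<in>\<Gamma>. bact g c' = c)"
      then obtain b where b: "c' = pick (orb b)" by (auto simp: C_def)
      have "c \<in> orb c'" using c' by (auto simp: orb_def)
      then have "orb c = orb c'" by (rule orb_eq)
      also have "orb c' = orb b" unfolding b by (rule orb_eq[OF pick])
      finally show "c' = pick (orb c)" by (simp add: b)
    qed
  qed
  then show ?thesis by blast
qed

section \<open>Subgroups of finite index\<close>

locale finite_index_subgroup =
  fixes G H :: "psl set" and \<gamma> :: "'m::finite \<Rightarrow> psl" and i1 :: 'm
  assumes first_kind: "fuchsian_first_kind G"
    and Infty_cusp: "cusp G Infty"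
    and subgroup_of_G: "subgroup H (PSL2R\<lparr>carrier := G\<rparr>)"
    and representatives: "coset_representatives G H i1 \<gamma>"
begin

lemma subgroup_G: "subgroup G PSL2R" and discrete_G: "discrete (\<Union>G)"
  using first_kind by (auto simp: fuchsian_first_kind_def)

lemma subgroup_H: "subgroup H PSL2R"
  using PSL.incl_subgroup[OF subgroup_G subgroup_of_G] .

lemma H_subset_G: "H \<subseteq> G"
  using subgroup.subset[OF subgroup_of_G] by simp

lemma discrete_H: "discrete (\<Union>H)"
  using discrete_G H_subset_G by (rule discrete_subset[OF _ Union_mono])

lemma G_carrier: "g \<in> G \<Longrightarrow> g \<in> carrier PSL2R"
  using subgroup_G by (rule subgroup.mem_carrier)

lemma H_carrier: "g \<in> H \<Longrightarrow> g \<in> carrier PSL2R"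
  using subgroup_H by (rule subgroup.mem_carrier)

lemma \<gamma>_in_G: "\<gamma> i \<in> G" and \<gamma>_i1: "\<gamma> i1 = \<one>\<^bsub>PSL2R\<^esub>"
  using representatives by (auto simp: coset_representatives_def)

lemma \<gamma>_carrier: "\<gamma> i \<in> carrier PSL2R"
  by (rule G_carrier[OF \<gamma>_in_G])

lemma G_mult: "g \<in> G \<Longrightarrow> h \<in> G \<Longrightarrow> g \<otimes>\<^bsub>PSL2R\<^esub> h \<in> G" and G_inv: "g \<in> G \<Longrightarrow> inv\<^bsub>PSL2R\<^esub> g \<in> G"
  using subgroup_G by (auto simp: subgroup.m_closed subgroup.m_inv_closed)

lemma H_mult: "g \<in> H \<Longrightarrow> h \<in> H \<Longrightarrow> g \<otimes>\<^bsub>PSL2R\<^esub> h \<in> H" and H_inv: "g \<in> H \<Longrightarrow> inv\<^bsub>PSL2R\<^esub> g \<in> H"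
  and H_one: "\<one>\<^bsub>PSL2R\<^esub> \<in> H"
  using subgroup_H by (auto simp: subgroup.m_closed subgroup.m_inv_closed subgroup.one_closed)

lemma mem_coset_iff:
  assumes "x \<in> G"
  shows "x \<in> \<gamma> j <#\<^bsub>PSL2R\<^esub> H \<longleftrightarrow> inv\<^bsub>PSL2R\<^esub> (\<gamma> j) \<otimes>\<^bsub>PSL2R\<^esub> x \<in> H"
proof
  assume "x \<in> \<gamma> j <#\<^bsub>PSL2R\<^esub> H"
  then obtain h where h: "h \<in> H" "x = \<gamma> j \<otimes>\<^bsub>PSL2R\<^esub> h" by (auto simp: l_coset_def)
  then show "inv\<^bsub>PSL2R\<^esub> (\<gamma> j) \<otimes>\<^bsub>PSL2R\<^esub> x \<in> H"
    using \<gamma>_carrier H_carrier by (simp flip: PSL.m_assoc)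
next
  assume *: "inv\<^bsub>PSL2R\<^esub> (\<gamma> j) \<otimes>\<^bsub>PSL2R\<^esub> x \<in> H"
  have "x = \<gamma> j \<otimes>\<^bsub>PSL2R\<^esub> (inv\<^bsub>PSL2R\<^esub> (\<gamma> j) \<otimes>\<^bsub>PSL2R\<^esub> x)"
    using \<gamma>_carrier G_carrier[OF assms] by (simp flip: PSL.m_assoc)
  then show "x \<in> \<gamma> j <#\<^bsub>PSL2R\<^esub> H" using * unfolding l_coset_def by blast
qed

lemma coset_exists:
  assumes "x \<in> G"
  obtains j where "inv\<^bsub>PSL2R\<^esub> (\<gamma> j) \<otimes>\<^bsub>PSL2R\<^esub> x \<in> H"
proof -
  have "G = (\<Union>i. \<gamma> i <#\<^bsub>PSL2R\<^esub> H)" using representatives by (simp add: coset_representatives_def)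
  then obtain j where "x \<in> \<gamma> j <#\<^bsub>PSL2R\<^esub> H" using assms by blast
  then show ?thesis using that mem_coset_iff[OF assms] by blast
qed

lemma coset_unique:
  assumes "x \<in> G" "inv\<^bsub>PSL2R\<^esub> (\<gamma> i) \<otimes>\<^bsub>PSL2R\<^esub> x \<in> H" "inv\<^bsub>PSL2R\<^esub> (\<gamma> j) \<otimes>\<^bsub>PSL2R\<^esub> x \<in> H"
  shows "i = j"
proof (rule ccontr)
  assume "i \<noteq> j"
  moreover have "disjoint_family (\<lambda>i. \<gamma> i <#\<^bsub>PSL2R\<^esub> H)"
    using representatives by (simp add: coset_representatives_def)
  ultimately have "(\<gamma> i <#\<^bsub>PSL2R\<^esub> H) \<inter> (\<gamma> j <#\<^bsub>PSL2R\<^esub> H) = {}"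
    by (simp add: disjoint_family_on_def)
  then show False using assms mem_coset_iff[OF assms(1)] by blast
qed

text \<open>The element of which the block \<open>(i, j)\<close> of the induced matrix of \<open>x\<close> is the value under \<open>\<rho>\<close>.\<close>

abbreviation entry :: "'m \<Rightarrow> psl \<Rightarrow> 'm \<Rightarrow> psl" where
  "entry i x j \<equiv> inv\<^bsub>PSL2R\<^esub> (\<gamma> i) \<otimes>\<^bsub>PSL2R\<^esub> x \<otimes>\<^bsub>PSL2R\<^esub> \<gamma> j"

lemma inv_entry:
  assumes "x \<in> G"
  shows "inv\<^bsub>PSL2R\<^esub> (entry i x j) = entry j (inv\<^bsub>PSL2R\<^esub> x) i"
  using \<gamma>_carrier G_carrier[OF assms] by (simp add: PSL.inv_mult_group PSL.m_assoc)

lemma entry_mult: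
  assumes "x \<in> G" "y \<in> G"
  shows "entry i (x \<otimes>\<^bsub>PSL2R\<^esub> y) k = entry i x j \<otimes>\<^bsub>PSL2R\<^esub> entry j y k"
proof -
  have "entry i x j \<otimes>\<^bsub>PSL2R\<^esub> entry j y k =
      inv\<^bsub>PSL2R\<^esub> (\<gamma> i) \<otimes>\<^bsub>PSL2R\<^esub> x \<otimes>\<^bsub>PSL2R\<^esub> (\<gamma> j \<otimes>\<^bsub>PSL2R\<^esub> inv\<^bsub>PSL2R\<^esub> (\<gamma> j)) \<otimes>\<^bsub>PSL2R\<^esub> y \<otimes>\<^bsub>PSL2R\<^esub> \<gamma> k"
    using \<gamma>_carrier G_carrier[OF assms(1)] G_carrier[OF assms(2)]
    by (simp only: PSL.m_assoc PSL.m_closed PSL.inv_closed)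
  then show ?thesis
    using \<gamma>_carrier G_carrier[OF assms(1)] G_carrier[OF assms(2)] by (simp add: PSL.m_assoc)
qed

text \<open>Left multiplication by \<open>x\<close> permutes the cosets: every block row of the induced matrix has
  exactly one nonzero block.\<close>

lemma entry_exists:
  assumes "x \<in> G"
  obtains j where "entry i x j \<in> H"
proof -
  have "inv\<^bsub>PSL2R\<^esub> x \<otimes>\<^bsub>PSL2R\<^esub> \<gamma> i \<in> G" using assms \<gamma>_in_G by (intro G_mult G_inv)
  then obtain j where "inv\<^bsub>PSL2R\<^esub> (\<gamma> j) \<otimes>\<^bsub>PSL2R\<^esub> (inv\<^bsub>PSL2R\<^esub> x \<otimes>\<^bsub>PSL2R\<^esub> \<gamma> i) \<in> H"
    by (rule coset_exists)
  then have "entry j (inv\<^bsub>PSL2R\<^esub> x) i \<in> H"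
    using \<gamma>_carrier G_carrier[OF assms] by (simp add: PSL.m_assoc)
  then have "entry i x j \<in> H"
    using H_inv inv_entry[OF G_inv[OF assms], of j i] G_carrier[OF assms] by fastforce
  then show ?thesis by (rule that)
qed

lemma entry_unique:
  assumes x: "x \<in> G" and "entry i x j \<in> H" "entry i x k \<in> H"
  shows "j = k"
proof (rule coset_unique)
  show "inv\<^bsub>PSL2R\<^esub> x \<otimes>\<^bsub>PSL2R\<^esub> \<gamma> i \<in> G" using x \<gamma>_in_G by (intro G_mult G_inv)
  have "inv\<^bsub>PSL2R\<^esub> (\<gamma> l) \<otimes>\<^bsub>PSL2R\<^esub> (inv\<^bsub>PSL2R\<^esub> x \<otimes>\<^bsub>PSL2R\<^esub> \<gamma> i) \<in> H" if "entry i x l \<in> H" for l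
    using H_inv[OF that] inv_entry[OF x, of i l] \<gamma>_carrier G_carrier[OF x] by (simp add: PSL.m_assoc)
  then show "inv\<^bsub>PSL2R\<^esub> (\<gamma> j) \<otimes>\<^bsub>PSL2R\<^esub> (inv\<^bsub>PSL2R\<^esub> x \<otimes>\<^bsub>PSL2R\<^esub> \<gamma> i) \<in> H"
    "inv\<^bsub>PSL2R\<^esub> (\<gamma> k) \<otimes>\<^bsub>PSL2R\<^esub> (inv\<^bsub>PSL2R\<^esub> x \<otimes>\<^bsub>PSL2R\<^esub> \<gamma> i) \<in> H"
    using assms by auto
qed

lemma entry_unique_left:
  assumes x: "x \<in> G" and "entry i x k \<in> H" "entry j x k \<in> H"
  shows "i = j"
  using entry_unique[OF G_inv[OF x] H_inv[OF assms(2), unfolded inv_entry[OF x]]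
      H_inv[OF assms(3), unfolded inv_entry[OF x]]] .

text \<open>By the pigeonhole principle two powers of \<open>x\<close> send \<open>\<gamma> i\<close> into the same coset.\<close>

lemma power_entry_in_H:
  assumes x: "x \<in> G"
  obtains n :: nat where "n > 0" "entry i (x [^]\<^bsub>PSL2R\<^esub> n) i \<in> H"
proof -
  have xP: "x \<in> carrier PSL2R" by (rule G_carrier[OF x])
  have pow: "x [^]\<^bsub>PSL2R\<^esub> n \<in> G" for n :: nat
    by (induction n) (use x G_mult subgroup.one_closed[OF subgroup_G] in auto)
  have "\<exists>j. entry j (x [^]\<^bsub>PSL2R\<^esub> n) i \<in> H" for n :: nat
  proof -
    obtain j where "entry i (inv\<^bsub>PSL2R\<^esub> (x [^]\<^bsub>PSL2R\<^esub> n)) j \<in> H" by (rule entry_exists[OF G_inv[OF pow]])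
    then show ?thesis
      using H_inv inv_entry[OF G_inv[OF pow], of i n j] G_carrier[OF pow] by fastforce
  qed
  then obtain f where f: "\<And>n :: nat. entry (f n) (x [^]\<^bsub>PSL2R\<^esub> n) i \<in> H" by metis
  have "\<not> inj f"
  proof
    assume "inj f"
    then have "finite (UNIV :: nat set)" by (rule inj_on_finite[OF _ subset_UNIV]) simp
    then show False by simp
  qed
  then obtain k n where kn: "k \<noteq> n" "f k = f n" by (auto simp: inj_on_def)
  have "\<exists>n::nat>0. entry i (x [^]\<^bsub>PSL2R\<^esub> n) i \<in> H" if "k < n" "f k = f n" for k n
  proof -
    have "x [^]\<^bsub>PSL2R\<^esub> n = x [^]\<^bsub>PSL2R\<^esub> k \<otimes>\<^bsub>PSL2R\<^esub> x [^]\<^bsub>PSL2R\<^esub> (n - k)"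
      using that xP by (simp add: PSL.nat_pow_mult)
    then have "inv\<^bsub>PSL2R\<^esub> (x [^]\<^bsub>PSL2R\<^esub> k) \<otimes>\<^bsub>PSL2R\<^esub> x [^]\<^bsub>PSL2R\<^esub> n = x [^]\<^bsub>PSL2R\<^esub> (n - k)"
      using xP by (simp flip: PSL.m_assoc)
    then have "entry i (x [^]\<^bsub>PSL2R\<^esub> (n - k)) i =
        entry i (inv\<^bsub>PSL2R\<^esub> (x [^]\<^bsub>PSL2R\<^esub> k)) (f k) \<otimes>\<^bsub>PSL2R\<^esub> entry (f k) (x [^]\<^bsub>PSL2R\<^esub> n) i"
      using entry_mult[OF G_inv[OF pow] pow] by metis
    moreover have "entry i (inv\<^bsub>PSL2R\<^esub> (x [^]\<^bsub>PSL2R\<^esub> k)) (f k) \<in> H"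
      using H_inv[OF f[of k]] inv_entry[OF pow] by simp
    moreover have "entry (f k) (x [^]\<^bsub>PSL2R\<^esub> n) i \<in> H" using f[of n] that(2) by simp
    ultimately have "entry i (x [^]\<^bsub>PSL2R\<^esub> (n - k)) i \<in> H" using H_mult by simp
    then show ?thesis using that(1) by (intro exI[of _ "n - k"]) auto
  qed
  then show ?thesis using that kn by (metis linorder_neqE_nat)
qed

text \<open>Some positive power of a translation in \<open>G\<close> lies in \<open>H\<close>, and it is a translation at the same
  cusp.\<close>

lemma cusp_H_iff: "cusp H c \<longleftrightarrow> cusp G c"
proof
  assume "cusp G c"
  then obtain h where h: "h > 0" "cusp_translation c h \<in> G"
    using cusp_iff_translation[OF subgroup_G] by blast
  obtain n :: nat where n: "n > 0" "entry i1 (cusp_translation c h [^]\<^bsub>PSL2R\<^esub> n) i1 \<in> H"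
    using power_entry_in_H[OF h(2), of i1] by metis
  then have "cusp_translation c (of_nat n * h) \<in> H"
    by (simp add: \<gamma>_i1 cusp_translation_pow cusp_translation_in_PSL2R)
  moreover have "of_nat n * h > 0" using n h by simp
  ultimately show "cusp H c" using cusp_iff_translation[OF subgroup_H] by blast
qed (use H_subset_G in \<open>auto simp: cusp_def\<close>)

end

section \<open>The induced representation is admissible\<close>

definition block :: "'m::finite \<Rightarrow> complex^('m \<times> 'd::finite) \<Rightarrow> complex^'d" where
  "block i v = (\<chi> \<xi>. v $ (i, \<xi>))"

lemma block_nth: "block i v $ \<xi> = v $ (i, \<xi>)"
  by (simp add: block_def)

lemma block_eqI: "(\<And>i. block i u = block i v) \<Longrightarrow> u = v"
  by (simp add: vec_eq_iff block_nth)

lemma block_scale: "block i (c *s v) = c *s block i v"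
  by (simp add: vec_eq_iff block_nth)

lemma block_zero: "block i 0 = 0"
  by (simp add: vec_eq_iff block_nth)

lemma slash_block: "block i (slash w Z g \<tau>) = slash w (\<lambda>\<tau>. block i (Z \<tau>)) g \<tau>"
  by (simp add: slash_def vec_eq_iff block_nth)

lemma block_lift_form: "block i (lift_form w \<gamma> X \<tau>) = slash w X (inv\<^bsub>PSL2R\<^esub> (\<gamma> i)) \<tau>"
  by (simp add: vec_eq_iff block_nth lift_form_def)

definition embed :: "'m::finite \<Rightarrow> complex^'d::finite^('m \<times> 'd)" where
  "embed i = (\<chi> r \<xi>. if r = (i, \<xi>) then 1 else 0)"

lemma embed_nth: "(embed i *v v) $ r = (if fst r = i then v $ snd r else 0)"
proof -
  have "(\<Sum>\<xi>\<in>UNIV. (if r = (i, \<xi>) then 1 else 0) * v $ \<xi>) =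
      (\<Sum>\<xi>\<in>UNIV. if \<xi> = snd r then (if fst r = i then v $ snd r else 0) else 0)"
    by (intro sum.cong) (auto simp: prod_eq_iff)
  then show ?thesis by (simp add: embed_def matrix_vector_mult_def)
qed

lemma block_embed: "block j (embed i *v v) = (if j = i then v else 0)"
  by (simp add: vec_eq_iff block_nth embed_nth)

lemma sum_embed_block: "(\<Sum>i\<in>UNIV. embed i *v block i u) = u"
  by (simp add: vec_eq_iff embed_nth block_nth)

context finite_index_subgroup
begin

text \<open>Only one block of the row \<open>i\<close> contributes. With this formula identities between induced matrices
  are verified block by block.\<close>

lemma block_induced_rep:
  fixes \<rho> :: "psl \<Rightarrow> complex^'d::finite^'d"
  assumes x: "x \<in> G" and j: "entry i x j \<in> H"
  shows "block i (induced_rep H \<gamma> \<rho> x *v v) = \<rho> (entry i x j) *v block j v"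
proof -
  have other: "entry i x k \<notin> H" if "k \<noteq> j" for k
    using entry_unique[OF x _ j] that by blast
  have "(induced_rep H \<gamma> \<rho> x *v v) $ (i, \<xi>) = (\<rho> (entry i x j) *v block j v) $ \<xi>" for \<xi>
  proof -
    have "(induced_rep H \<gamma> \<rho> x *v v) $ (i, \<xi>) =
        (\<Sum>s\<in>UNIV \<times> UNIV. (if entry i x (fst s) \<in> H then \<rho> (entry i x (fst s)) $ \<xi> $ snd s else 0) * v $ s)"
      by (simp add: matrix_vector_mult_def induced_rep_def Let_def cong: if_cong)
    also have "\<dots> = (\<Sum>k\<in>UNIV. \<Sum>\<eta>\<in>UNIV.
        (if entry i x k \<in> H then \<rho> (entry i x k) $ \<xi> $ \<eta> else 0) * v $ (k, \<eta>))"
      by (subst sum.cartesian_product) (simp add: case_prod_unfold)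
    also have "\<dots> = (\<Sum>\<eta>\<in>UNIV. \<rho> (entry i x j) $ \<xi> $ \<eta> * v $ (j, \<eta>))"
      by (subst sum.mono_neutral_right[of UNIV "{j}"]) (simp_all add: other j)
    finally show ?thesis by (simp add: matrix_vector_mult_def block_nth)
  qed
  then show ?thesis by (simp add: vec_eq_iff block_nth)
qed

lemma entry_one: "entry i \<one>\<^bsub>PSL2R\<^esub> i = \<one>\<^bsub>PSL2R\<^esub>"
  using \<gamma>_carrier by simp

lemma induced_rep_hom:
  fixes \<rho> :: "psl \<Rightarrow> complex^'d::finite^'d"
  assumes \<rho>: "\<rho> \<in> hom (PSL2R\<lparr>carrier := H\<rparr>) GL"
  shows "induced_rep H \<gamma> \<rho> \<in> hom (PSL2R\<lparr>carrier := G\<rparr>) GL"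
proof -
  define R where "R = induced_rep H \<gamma> \<rho>"
  have mult: "R (x \<otimes>\<^bsub>PSL2R\<^esub> y) = R x ** R y" if x: "x \<in> G" and y: "y \<in> G" for x y
  proof -
    have "R (x \<otimes>\<^bsub>PSL2R\<^esub> y) *v v = (R x ** R y) *v v" for v
    proof (rule block_eqI)
      fix i
      obtain j where j: "entry i x j \<in> H" by (rule entry_exists[OF x])
      obtain k where k: "entry j y k \<in> H" by (rule entry_exists[OF y])
      have ik: "entry i (x \<otimes>\<^bsub>PSL2R\<^esub> y) k = entry i x j \<otimes>\<^bsub>PSL2R\<^esub> entry j y k" by (rule entry_mult[OF x y])
      then have "entry i (x \<otimes>\<^bsub>PSL2R\<^esub> y) k \<in> H" using H_mult[OF j k] by simp
      then have "block i (R (x \<otimes>\<^bsub>PSL2R\<^esub> y) *v v) = \<rho> (entry i x j \<otimes>\<^bsub>PSL2R\<^esub> entry j y k) *v block k v"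
        unfolding R_def ik[symmetric] by (rule block_induced_rep[OF G_mult[OF x y]])
      also have "\<rho> (entry i x j \<otimes>\<^bsub>PSL2R\<^esub> entry j y k) = \<rho> (entry i x j) ** \<rho> (entry j y k)"
        using \<rho> j k by (simp add: hom_GL_iff)
      also have "(\<rho> (entry i x j) ** \<rho> (entry j y k)) *v block k v =
          \<rho> (entry i x j) *v (\<rho> (entry j y k) *v block k v)"
        by (simp add: matrix_vector_mul_assoc)
      also have "\<dots> = block i (R x *v (R y *v v))"
        unfolding R_def block_induced_rep[OF x j] block_induced_rep[OF y k] ..
      finally show "block i (R (x \<otimes>\<^bsub>PSL2R\<^esub> y) *v v) = block i ((R x ** R y) *v v)"
        by (simp add: matrix_vector_mul_assoc)
    qed
    then show ?thesis by (simp add: matrix_eq)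
  qed
  have one: "R \<one>\<^bsub>PSL2R\<^esub> = mat 1"
  proof -
    have "R \<one>\<^bsub>PSL2R\<^esub> *v v = mat 1 *v v" for v
    proof (rule block_eqI)
      fix i
      have "entry i \<one>\<^bsub>PSL2R\<^esub> i \<in> H" using H_one unfolding entry_one .
      from block_induced_rep[OF _ this, of \<rho> v]
      show "block i (R \<one>\<^bsub>PSL2R\<^esub> *v v) = block i (mat 1 *v v)"
        unfolding R_def entry_one using H_one H_subset_G hom_GL_one[OF subgroup_H \<rho>] by auto
    qed
    then show ?thesis by (simp add: matrix_eq)
  qed
  have "invertible (R x)" if "x \<in> G" for x
  proof -
    have "R x ** R (inv\<^bsub>PSL2R\<^esub> x) = mat 1"
      using mult[OF that G_inv[OF that]] one G_carrier[OF that] by simp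
    then show ?thesis using invertible_right_inverse by blast
  qed
  then show ?thesis using mult by (simp add: hom_GL_iff R_def)
qed

text \<open>For every \<open>i\<close>, the vectors supported in block \<open>i\<close> are spanned by eigenvectors of some power of the
  induced matrix. The exponent depends on \<open>i\<close>, which does no harm because the span of eigenvectors of
  the matrix itself does not.\<close>

lemma induced_rep_diagonalizable:
  fixes \<rho> :: "psl \<Rightarrow> complex^'d::finite^'d"
  assumes \<rho>: "\<rho> \<in> hom (PSL2R\<lparr>carrier := H\<rparr>) GL" and diag: "cuspidally_diagonalizable H \<rho>"
    and c: "cusp G c"
  shows "diagonalizable (induced_rep H \<gamma> \<rho> (cusp_gen G c))"
proof -
  define R where "R = induced_rep H \<gamma> \<rho>"
  define t where "t = cusp_gen G c"
  have R: "R \<in> hom (PSL2R\<lparr>carrier := G\<rparr>) GL" unfolding R_def by (rule induced_rep_hom[OF \<rho>])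
  have t: "t \<in> G" unfolding t_def by (rule cusp_width_generates(2)[OF subgroup_G discrete_G c])
  have embed_span: "embed i *v u \<in> vec.span (eigenvectors (R t))" for i u
  proof -
    obtain n :: nat where n: "n > 0" "entry i (t [^]\<^bsub>PSL2R\<^esub> n) i \<in> H"
      using power_entry_in_H[OF t, of i] by metis
    note tn = hom_power_vector(2)[OF subgroup_G R t, of n]
    define y where "y = entry i (t [^]\<^bsub>PSL2R\<^esub> n) i"
    have yH: "y \<in> H" using n(2) by (simp add: y_def)
    define c' where "c' = bact (inv\<^bsub>PSL2R\<^esub> (\<gamma> i)) c"
    obtain a where a: "a \<noteq> 0" "\<And>h. inv\<^bsub>PSL2R\<^esub> (\<gamma> i) \<otimes>\<^bsub>PSL2R\<^esub> cusp_translation c h \<otimes>\<^bsub>PSL2R\<^esub> inv\<^bsub>PSL2R\<^esub> (inv\<^bsub>PSL2R\<^esub> (\<gamma> i)) =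
        cusp_translation c' (a\<^sup>2 * h)"
      using cusp_translation_conj[OF PSL.inv_closed[OF \<gamma>_carrier]] unfolding c'_def by metis
    have y_eq: "y = cusp_translation c' (a\<^sup>2 * (of_nat n * cusp_width G c))"
      using a(2)[of "of_nat n * cusp_width G c"] \<gamma>_carrier
      by (simp add: y_def t_def cusp_gen_def cusp_translation_pow)
    have pos: "a\<^sup>2 * (of_nat n * cusp_width G c) > 0"
      using a(1) n(1) cusp_width_generates(1)[OF subgroup_G discrete_G c] by simp
    then have cH: "cusp H c'" and "\<exists>k::nat. a\<^sup>2 * (of_nat n * cusp_width G c) = of_nat k * cusp_width H c'"
      using yH y_eq cusp_iff_translation[OF subgroup_H] cusp_width_generates(4)[OF subgroup_H discrete_H]
      by metis+
    then obtain k :: nat where k: "y = cusp_gen H c' [^]\<^bsub>PSL2R\<^esub> k"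
      using y_eq by (metis cusp_gen_def cusp_translation_pow)
    define g where "g = cusp_gen H c'"
    have g: "g \<in> H" unfolding g_def by (rule cusp_width_generates(2)[OF subgroup_H discrete_H cH])
    have "diagonalizable (\<rho> g)"
      using diag cH unfolding cuspidally_diagonalizable_def g_def
      by (metis diagonalized_by_imp_diagonalizable)
    then have "u \<in> vec.span (eigenvectors (\<rho> g))" by (simp add: diagonalizable_def)
    then show ?thesis
    proof (rule span_matrix_image)
      fix v assume "v \<in> eigenvectors (\<rho> g)"
      then obtain \<mu> where \<mu>: "\<rho> g *v v = \<mu> *s v" by (auto simp: eigenvectors_def)
      show "embed i *v v \<in> vec.span (eigenvectors (R t))"
      proof (cases "v = 0")
        case True
        then show ?thesis by (simp add: vec.span_zero)
      next
        case False
        have inv: "invertible (\<rho> g)" using \<rho> g by (simp add: hom_GL_iff)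
        have "\<mu> \<noteq> 0"
        proof
          assume "\<mu> = 0"
          then have "\<rho> g *v v = 0" using \<mu> by simp
          then show False using matrix_inv_vector_cancel(2)[OF inv, of v] False by simp
        qed
        have iter: "((*v) (\<rho> g) ^^ k) v = \<mu> ^ k *s v"
          by (induction k) (simp_all add: \<mu> vector_scalar_commute vector_smult_assoc mult.commute)
        then have y_eig: "\<rho> y *v v = \<mu> ^ k *s v"
          using hom_power_vector(1)[OF subgroup_H \<rho> g, of k v] k by (simp add: g_def)
        \<comment> \<open>In column \<open>i\<close> of the induced matrix of \<open>t ^ n\<close> the only nonzero block is the diagonal one.\<close>
        have "R (t [^]\<^bsub>PSL2R\<^esub> n) *v (embed i *v v) = \<mu> ^ k *s (embed i *v v)"
        proof (rule block_eqI)
          fix j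
          obtain l where l: "entry j (t [^]\<^bsub>PSL2R\<^esub> n) l \<in> H" by (rule entry_exists[OF tn])
          have "j = i \<longleftrightarrow> l = i"
            using entry_unique[OF tn l, of i] entry_unique_left[OF tn l, of i] n(2) l by auto
          then show "block j (R (t [^]\<^bsub>PSL2R\<^esub> n) *v (embed i *v v)) = block j (\<mu> ^ k *s (embed i *v v))"
            using y_eig l unfolding R_def block_induced_rep[OF tn l]
            by (auto simp: block_scale block_embed y_def)
        qed
        then have "((*v) (R t) ^^ n) (embed i *v v) = \<mu> ^ k *s (embed i *v v)"
          using hom_power_vector(1)[OF subgroup_G R t] by simp
        then show ?thesis using n(1) \<open>\<mu> \<noteq> 0\<close> by (intro eigenvector_power_in_span[of n "\<mu> ^ k"]) auto
      qed
    qed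
  qed
  have "u \<in> vec.span (eigenvectors (R t))" for u
    by (subst sum_embed_block[of u, symmetric]) (intro vec.span_sum embed_span)
  then show ?thesis unfolding diagonalizable_def R_def t_def by blast
qed

text \<open>The generator at infinity must act by a diagonal matrix, which the induced matrix is not in
  general; a diagonalizing matrix \<open>P\<close> at infinity supplies the change of basis.\<close>

theorem induced_rep_admissible:
  fixes \<rho> :: "psl \<Rightarrow> complex^'d::finite^'d"
  assumes "admissible H \<rho>"
  shows "\<exists>P. invertible P \<and> admissible G (conj_rep P (induced_rep H \<gamma> \<rho>))"
proof -
  define R where "R = induced_rep H \<gamma> \<rho>"
  note \<rho> = admissible_imp[OF subgroup_H discrete_H assms]
  have R: "R \<in> hom (PSL2R\<lparr>carrier := G\<rparr>) GL" unfolding R_def by (rule induced_rep_hom[OF \<rho>(1)])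
  have diagR: "diagonalizable (R (cusp_gen G c))" and invR: "invertible (R (cusp_gen G c))"
    if "cusp G c" for c
    using induced_rep_diagonalizable[OF \<rho>(1,3) that] R
      cusp_width_generates(2)[OF subgroup_G discrete_G that] by (auto simp: R_def hom_GL_iff)
  obtain P \<Lambda> where P: "diagonalized_by (R (cusp_gen G Infty)) P \<Lambda>"
    using diagonalizable_imp_diagonalized_by[OF diagR[OF Infty_cusp] invR[OF Infty_cusp]] by blast
  then have Pinv: "invertible P" by (simp add: diagonalized_by_def)
  have hom: "conj_rep P R \<in> hom (PSL2R\<lparr>carrier := G\<rparr>) GL" by (rule hom_conj_rep[OF R Pinv])
  obtain C where C: "cusp_representatives G C"
    using exists_cusp_representatives[OF subgroup_G discrete_G Infty_cusp] by blast
  have "\<exists>P' \<Lambda>. diagonalized_by (conj_rep P R (cusp_gen G c)) P' \<Lambda>" if "c \<in> C" for c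
  proof (rule diagonalizable_imp_diagonalized_by)
    have c: "cusp G c" using C that by (auto simp: cusp_representatives_def)
    show "diagonalizable (conj_rep P R (cusp_gen G c))"
      unfolding conj_rep_def by (rule diagonalizable_conj[OF diagR[OF c] Pinv])
    show "invertible (conj_rep P R (cusp_gen G c))"
      using hom cusp_width_generates(2)[OF subgroup_G discrete_G c] by (simp add: hom_GL_iff)
  qed
  moreover have "diagonalized_by (conj_rep P R (cusp_gen G Infty)) (mat 1) \<Lambda>"
    using P by (simp add: diagonalized_by_def conj_rep_def matrix_inv_one invertible_mat_1)
  ultimately have "admissible G (conj_rep P R)"
    using hom C unfolding admissible_def by blast
  then show ?thesis using Pinv unfolding R_def by blast
qed

end

section \<open>The modules of weakly holomorphic forms\<close>

lemma cuspidally_diagonalizable_trivial: "cuspidally_diagonalizable \<Gamma> (\<lambda>_. mat 1 :: complex^'n^'n)"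
proof -
  have "diagonalized_by (mat 1 :: complex^'n^'n) (mat 1) (\<lambda>_. 0)"
    by (simp add: diagonalized_by_def invertible_mat_1 matrix_inv_one)
       (simp add: diag_def mat_def vec_eq_iff)
  then show ?thesis unfolding cuspidally_diagonalizable_def by blast
qed

lemma wh_forms_additive_subgroup:
  fixes X Y :: "complex \<Rightarrow> complex^'n"
  assumes \<Gamma>: "subgroup \<Gamma> PSL2R" "discrete (\<Union>\<Gamma>)" and Infty: "cusp \<Gamma> Infty"
    and \<rho>: "cuspidally_diagonalizable \<Gamma> \<rho>" and w: "even w"
  shows wh_forms_zero: "(\<lambda>_. 0) \<in> wh_forms \<Gamma> w \<rho>"
    and wh_forms_add: "X \<in> wh_forms \<Gamma> w \<rho> \<Longrightarrow> Y \<in> wh_forms \<Gamma> w \<rho> \<Longrightarrow> (\<lambda>\<tau>. X \<tau> + Y \<tau>) \<in> wh_forms \<Gamma> w \<rho>"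
    and wh_forms_uminus: "X \<in> wh_forms \<Gamma> w \<rho> \<Longrightarrow> (\<lambda>\<tau>. - X \<tau>) \<in> wh_forms \<Gamma> w \<rho>"
proof -
  note iff = wh_forms_iff_growth[OF \<Gamma> Infty \<rho> w]
  have slash_add: "slash w (\<lambda>\<tau>. X \<tau> + Y \<tau>) g \<tau> = slash w X g \<tau> + slash w Y g \<tau>"
    for X Y :: "complex \<Rightarrow> complex^'n" and g \<tau>
    by (simp add: slash_def vector_add_ldistrib)
  have slash_uminus: "slash w (\<lambda>\<tau>. - X \<tau>) g \<tau> = - slash w X g \<tau>"
    for X :: "complex \<Rightarrow> complex^'n" and g \<tau>
    by (simp add: slash_def vec_eq_iff)
  have slash_zero: "slash w (\<lambda>\<tau>. 0 :: complex^'n) g \<tau> = 0" for g \<tau>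
    by (simp add: slash_def)
  show "(\<lambda>_. 0) \<in> wh_forms \<Gamma> w \<rho>"
    unfolding iff by (simp add: cusp_growth_def slash_zero moderate_const)
  have matrix_uminus: "A *v (- v) = - (A *v v)" for A :: "complex^'n^'n" and v
    by (simp add: matrix_vector_mult_def vec_eq_iff sum_negf)
  show "(\<lambda>\<tau>. X \<tau> + Y \<tau>) \<in> wh_forms \<Gamma> w \<rho>" if "X \<in> wh_forms \<Gamma> w \<rho>" "Y \<in> wh_forms \<Gamma> w \<rho>"
    using that unfolding iff
    by (auto simp: slash_add matrix_vector_right_distrib intro: holomorphic_on_add cusp_growth_add)
  have growth: "cusp_growth w c (\<lambda>\<tau>. - X \<tau>)" if "cusp_growth w c X" for c
  proof -
    have "moderate (\<lambda>z. (-1) * slash w X (cusp_mat c) z $ \<xi>)" for \<xi>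
      using that by (intro moderate_mult moderate_const) (simp add: cusp_growth_def)
    then show ?thesis by (simp add: cusp_growth_def slash_uminus)
  qed
  show "(\<lambda>\<tau>. - X \<tau>) \<in> wh_forms \<Gamma> w \<rho>" if "X \<in> wh_forms \<Gamma> w \<rho>"
    using that growth unfolding iff by (auto simp: slash_uminus matrix_uminus intro: holomorphic_on_minus)
qed

text \<open>For weight 0 and the trivial representation the law of transformation is invariance.\<close>

lemma fun_ring_carrier_iff:
  assumes \<Gamma>: "subgroup \<Gamma> PSL2R" "discrete (\<Union>\<Gamma>)" and Infty: "cusp \<Gamma> Infty"
  shows "f \<in> carrier (fun_ring \<Gamma>) \<longleftrightarrow>
    (\<forall>\<tau>. \<tau> \<notin> uhp \<longrightarrow> f \<tau> = 0) \<and> f holomorphic_on uhp \<and>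
    (\<forall>g\<in>\<Gamma>. \<forall>\<tau>\<in>uhp. f (moebius g \<tau>) = f \<tau>) \<and>
    (\<forall>c. cusp \<Gamma> c \<longrightarrow> cusp_growth 0 c (\<lambda>\<tau>. (\<chi> i. f \<tau>) :: complex^1))"
  by (simp add: fun_ring_def wh_forms_iff_growth[OF \<Gamma> Infty cuspidally_diagonalizable_trivial]
      slash_def vec_eq_iff)

text \<open>This covers the forms for \<open>G\<close> as well as those for a subgroup \<open>\<Gamma>\<close>: functions invariant under \<open>G\<close>
  are invariant under \<open>\<Gamma>\<close>, and they have moderate growth at the cusps of \<open>\<Gamma>\<close>, which are the same.\<close>

lemma wh_forms_smult:
  fixes X :: "complex \<Rightarrow> complex^'n"
  assumes G: "subgroup G PSL2R" "discrete (\<Union>G)" "cusp G Infty"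
    and \<Gamma>: "subgroup \<Gamma> PSL2R" "\<Gamma> \<subseteq> G" "\<And>c. cusp \<Gamma> c \<longleftrightarrow> cusp G c"
    and \<rho>: "cuspidally_diagonalizable \<Gamma> \<rho>" and w: "even w"
    and f: "f \<in> carrier (fun_ring G)" and X: "X \<in> wh_forms \<Gamma> w \<rho>"
  shows "(\<lambda>\<tau>. f \<tau> *s X \<tau>) \<in> wh_forms \<Gamma> w \<rho>"
proof -
  have disc: "discrete (\<Union>\<Gamma>)" using G(2) \<Gamma>(2) by (rule discrete_subset[OF _ Union_mono])
  note iff = wh_forms_iff_growth[OF \<Gamma>(1) disc \<Gamma>(3)[THEN iffD2, OF G(3)] \<rho> w]
  note f = f[unfolded fun_ring_carrier_iff[OF G]] and X = X[unfolded iff]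
  have growth: "cusp_growth w c (\<lambda>\<tau>. f \<tau> *s X \<tau>)" if "cusp \<Gamma> c" for c
    using cusp_growth_smult[of c "\<lambda>\<tau>. \<chi> i. f \<tau>" w X] f X that \<Gamma>(3) by simp
  have "slash w (\<lambda>\<tau>. f \<tau> *s X \<tau>) g \<tau> = \<rho> g *v (f \<tau> *s X \<tau>)" if g: "g \<in> \<Gamma>" and \<tau>: "\<tau> \<in> uhp" for g \<tau>
  proof -
    have "slash w (\<lambda>\<tau>. f \<tau> *s X \<tau>) g \<tau> = f \<tau> *s slash w X g \<tau>"
      using f g \<tau> \<Gamma>(2) by (auto simp: slash_def vector_smult_assoc mult.commute)
    also have "slash w X g \<tau> = \<rho> g *v X \<tau>" using X g \<tau> by blast
    finally show ?thesis by (simp add: vector_scalar_commute)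
  qed
  moreover have "(\<lambda>\<tau>. (f \<tau> *s X \<tau>) $ \<xi>) holomorphic_on uhp" for \<xi>
    using f X by (auto intro: holomorphic_on_mult)
  ultimately show ?thesis using growth X unfolding iff by auto
qed

lemma wh_module_simps:
  "carrier (wh_module \<Gamma> w \<rho>) = wh_forms \<Gamma> w \<rho>"
  "X \<oplus>\<^bsub>wh_module \<Gamma> w \<rho>\<^esub> Y = (\<lambda>\<tau>. X \<tau> + Y \<tau>)"
  "\<zero>\<^bsub>wh_module \<Gamma> w \<rho>\<^esub> = (\<lambda>_. 0)"
  "f \<odot>\<^bsub>wh_module \<Gamma> w \<rho>\<^esub> X = (\<lambda>\<tau>. f \<tau> *s X \<tau>)"
  by (simp_all add: wh_module_def)

lemma fun_ring_simps:
  "f \<otimes>\<^bsub>fun_ring \<Gamma>\<^esub> g = (\<lambda>\<tau>. f \<tau> * g \<tau>)"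
  "f \<oplus>\<^bsub>fun_ring \<Gamma>\<^esub> g = (\<lambda>\<tau>. f \<tau> + g \<tau>)"
  "\<zero>\<^bsub>fun_ring \<Gamma>\<^esub> = (\<lambda>_. 0)"
  "\<one>\<^bsub>fun_ring \<Gamma>\<^esub> = (\<lambda>\<tau>. if \<tau> \<in> uhp then 1 else 0)"
  by (simp_all add: fun_ring_def)

lemma abelian_group_wh_module:
  fixes \<rho> :: "psl \<Rightarrow> complex^'n^'n"
  assumes \<Gamma>: "subgroup \<Gamma> PSL2R" "discrete (\<Union>\<Gamma>)" and Infty: "cusp \<Gamma> Infty"
    and \<rho>: "cuspidally_diagonalizable \<Gamma> \<rho>" and w: "even w"
  shows "abelian_group (wh_module \<Gamma> w \<rho>)"
proof (rule abelian_groupI)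
  fix X assume "X \<in> carrier (wh_module \<Gamma> w \<rho>)"
  then show "\<exists>Y\<in>carrier (wh_module \<Gamma> w \<rho>). Y \<oplus>\<^bsub>wh_module \<Gamma> w \<rho>\<^esub> X = \<zero>\<^bsub>wh_module \<Gamma> w \<rho>\<^esub>"
    unfolding wh_module_simps
    by (intro bexI[of _ "\<lambda>\<tau>. - X \<tau>"] wh_forms_uminus[OF \<Gamma> Infty \<rho> w]) auto
qed (auto simp: wh_module_simps add.commute add.assoc
    intro: wh_forms_zero[OF \<Gamma> Infty \<rho> w] wh_forms_add[OF \<Gamma> Infty \<rho> w])

lemma cring_fun_ring:
  assumes \<Gamma>: "subgroup \<Gamma> PSL2R" "discrete (\<Union>\<Gamma>)" and Infty: "cusp \<Gamma> Infty"
  shows "cring (fun_ring \<Gamma>)"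
proof -
  note trivial = cuspidally_diagonalizable_trivial[where ?'n = 1, of \<Gamma>]
  have mem: "f \<in> carrier (fun_ring \<Gamma>) \<longleftrightarrow>
      (\<lambda>\<tau>. (\<chi> i. f \<tau>) :: complex^1) \<in> wh_forms \<Gamma> 0 (\<lambda>_. mat 1)" for f
    by (simp add: fun_ring_def)
  have zero: "(\<lambda>_. 0) \<in> carrier (fun_ring \<Gamma>)"
    using wh_forms_zero[OF \<Gamma> Infty trivial, of 0] unfolding mem by (simp add: zero_vec_def)
  have add: "(\<lambda>\<tau>. f \<tau> + g \<tau>) \<in> carrier (fun_ring \<Gamma>)"
    if "f \<in> carrier (fun_ring \<Gamma>)" "g \<in> carrier (fun_ring \<Gamma>)" for f g
    using wh_forms_add[OF \<Gamma> Infty trivial _ that[unfolded mem]] unfolding mem by (simp add: plus_vec_def)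
  have uminus: "(\<lambda>\<tau>. - f \<tau>) \<in> carrier (fun_ring \<Gamma>)" if "f \<in> carrier (fun_ring \<Gamma>)" for f
    using wh_forms_uminus[OF \<Gamma> Infty trivial _ that[unfolded mem]] unfolding mem by (simp add: uminus_vec_def)
  have mult: "(\<lambda>\<tau>. f \<tau> * g \<tau>) \<in> carrier (fun_ring \<Gamma>)"
    if "f \<in> carrier (fun_ring \<Gamma>)" "g \<in> carrier (fun_ring \<Gamma>)" for f g
    using wh_forms_smult[OF \<Gamma> Infty \<Gamma>(1) subset_refl refl trivial _ that(1) that(2)[unfolded mem]]
    unfolding mem by (simp add: vector_scalar_mult_def)
  have one: "(\<lambda>\<tau>. if \<tau> \<in> uhp then 1 else 0) \<in> carrier (fun_ring \<Gamma>)"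
    unfolding fun_ring_carrier_iff[OF \<Gamma> Infty]
  proof (intro conjI allI impI ballI)
    show "(\<lambda>\<tau>. if \<tau> \<in> uhp then 1 else 0) holomorphic_on uhp"
      by (rule holomorphic_transform[of "\<lambda>_. 1"]) auto
    show "cusp_growth 0 c (\<lambda>\<tau>. (\<chi> i. if \<tau> \<in> uhp then 1 else 0) :: complex^1)" for c
      by (rule cusp_growth_bounded[of _ "\<chi> i. 1"]) simp
  qed (use moebius_in_uhp subgroup.mem_carrier[OF \<Gamma>(1)] in auto)
  show ?thesis
  proof (rule cringI)
    show "abelian_group (fun_ring \<Gamma>)"
    proof (rule abelian_groupI)
      fix f assume "f \<in> carrier (fun_ring \<Gamma>)"
      then show "\<exists>g\<in>carrier (fun_ring \<Gamma>). g \<oplus>\<^bsub>fun_ring \<Gamma>\<^esub> f = \<zero>\<^bsub>fun_ring \<Gamma>\<^esub>"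
        by (intro bexI[of _ "\<lambda>\<tau>. - f \<tau>"] uminus) (simp_all add: fun_ring_simps)
    qed (use add zero in \<open>auto simp: fun_ring_simps add.commute add.assoc\<close>)
    show "comm_monoid (fun_ring \<Gamma>)"
    proof (rule comm_monoidI)
      fix f assume "f \<in> carrier (fun_ring \<Gamma>)"
      then show "\<one>\<^bsub>fun_ring \<Gamma>\<^esub> \<otimes>\<^bsub>fun_ring \<Gamma>\<^esub> f = f"
        by (auto simp: fun_ring_simps fun_eq_iff fun_ring_carrier_iff[OF \<Gamma> Infty])
    qed (use mult one in \<open>auto simp: fun_ring_simps mult.commute mult.assoc\<close>)
  qed (simp add: fun_ring_simps distrib_right)
qed

lemma module_wh_module:
  fixes \<rho> :: "psl \<Rightarrow> complex^'n^'n"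
  assumes G: "subgroup G PSL2R" "discrete (\<Union>G)" "cusp G Infty"
    and \<Gamma>: "subgroup \<Gamma> PSL2R" "\<Gamma> \<subseteq> G" "\<And>c. cusp \<Gamma> c \<longleftrightarrow> cusp G c"
    and \<rho>: "cuspidally_diagonalizable \<Gamma> \<rho>" and w: "even w"
  shows "module (fun_ring G) (wh_module \<Gamma> w \<rho>)"
proof (rule moduleI)
  have disc: "discrete (\<Union>\<Gamma>)" using G(2) \<Gamma>(2) by (rule discrete_subset[OF _ Union_mono])
  show "cring (fun_ring G)" by (rule cring_fun_ring[OF G])
  show "abelian_group (wh_module \<Gamma> w \<rho>)"
    by (rule abelian_group_wh_module[OF \<Gamma>(1) disc \<Gamma>(3)[THEN iffD2, OF G(3)] \<rho> w])
  show "f \<odot>\<^bsub>wh_module \<Gamma> w \<rho>\<^esub> X \<in> carrier (wh_module \<Gamma> w \<rho>)"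
    if "f \<in> carrier (fun_ring G)" "X \<in> carrier (wh_module \<Gamma> w \<rho>)" for f X
    using wh_forms_smult[OF G \<Gamma> \<rho> w that(1)] that(2) by (simp add: wh_module_simps)
  show "\<one>\<^bsub>fun_ring G\<^esub> \<odot>\<^bsub>wh_module \<Gamma> w \<rho>\<^esub> X = X" if "X \<in> carrier (wh_module \<Gamma> w \<rho>)" for X
    using that by (auto simp: wh_module_simps fun_ring_simps fun_eq_iff wh_forms_def)
qed (simp_all add: wh_module_simps fun_ring_simps vector_add_ldistrib vector_sadd_rdistrib
    vector_smult_assoc)

section \<open>Lifting forms from the subgroup to the group\<close>

context finite_index_subgroup
begin

text \<open>This rests on \<open>\<gamma> i\<inverse> g = (\<gamma> i\<inverse> g \<gamma> j) \<gamma> j\<inverse>\<close>, where \<open>j\<close> is the index for which the bracket lies in \<open>H\<close>.\<close>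

lemma slash_lift_form:
  fixes X :: "complex \<Rightarrow> complex^'d::finite"
  assumes w: "even w" and g: "g \<in> G" and \<tau>: "\<tau> \<in> uhp"
    and trans: "\<And>h \<tau>. h \<in> H \<Longrightarrow> \<tau> \<in> uhp \<Longrightarrow> slash w X h \<tau> = \<rho> h *v X \<tau>"
  shows "slash w (lift_form w \<gamma> X) g \<tau> = induced_rep H \<gamma> \<rho> g *v lift_form w \<gamma> X \<tau>"
proof (rule block_eqI)
  fix i
  obtain j where j: "entry i g j \<in> H" by (rule entry_exists[OF g])
  note carr = PSL.inv_closed[OF \<gamma>_carrier] G_carrier[OF g] H_carrier[OF j]
  have "inv\<^bsub>PSL2R\<^esub> (\<gamma> i) \<otimes>\<^bsub>PSL2R\<^esub> g = entry i g j \<otimes>\<^bsub>PSL2R\<^esub> inv\<^bsub>PSL2R\<^esub> (\<gamma> j)"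
    using \<gamma>_carrier carr(2) by (simp add: PSL.m_assoc)
  then have "slash w (slash w X (inv\<^bsub>PSL2R\<^esub> (\<gamma> i))) g = slash w (slash w X (entry i g j)) (inv\<^bsub>PSL2R\<^esub> (\<gamma> j))"
    using slash_mult[OF carr(1) carr(2) w] slash_mult[OF carr(3) carr(1) w] by metis
  also have "\<dots> = slash w (\<lambda>\<tau>. \<rho> (entry i g j) *v X \<tau>) (inv\<^bsub>PSL2R\<^esub> (\<gamma> j))"
    by (rule slash_cong[OF carr(1)]) (rule trans[OF j])
  finally have "slash w (slash w X (inv\<^bsub>PSL2R\<^esub> (\<gamma> i))) g \<tau> =
      \<rho> (entry i g j) *v slash w X (inv\<^bsub>PSL2R\<^esub> (\<gamma> j)) \<tau>"
    by (simp add: slash_matrix)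
  then show "block i (slash w (lift_form w \<gamma> X) g \<tau>) = block i (induced_rep H \<gamma> \<rho> g *v lift_form w \<gamma> X \<tau>)"
    by (simp add: slash_block block_lift_form block_induced_rep[OF g j])
qed

lemma cusp_growth_blocks:
  fixes Z :: "complex \<Rightarrow> complex^('m \<times> 'd::finite)"
  shows "cusp_growth w c Z \<longleftrightarrow> (\<forall>i. cusp_growth w c (\<lambda>\<tau>. block i (Z \<tau>)))"
  by (simp add: cusp_growth_def block_nth flip: slash_block)

text \<open>Growth of block \<open>i\<close> at a cusp \<open>c\<close> is growth of \<open>X\<close> at the cusp \<open>\<gamma> i\<inverse> c\<close>.\<close>

lemma lift_form_in_wh_forms:
  fixes X :: "complex \<Rightarrow> complex^'d::finite"
  assumes w: "even w" and \<rho>: "cuspidally_diagonalizable H \<rho>" and P: "invertible P"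
    and R: "cuspidally_diagonalizable G (conj_rep P (induced_rep H \<gamma> \<rho>))"
    and X: "X \<in> wh_forms H w \<rho>"
  shows "(\<lambda>\<tau>. matrix_inv P *v lift_form w \<gamma> X \<tau>) \<in> wh_forms G w (conj_rep P (induced_rep H \<gamma> \<rho>))"
proof -
  have InftyH: "cusp H Infty" using Infty_cusp cusp_H_iff by simp
  note iffH = wh_forms_iff_growth[OF subgroup_H discrete_H InftyH \<rho> w]
  note iffG = wh_forms_iff_growth[OF subgroup_G discrete_G Infty_cusp R w]
  note X = X[unfolded iffH]
  have inv_\<gamma>: "inv\<^bsub>PSL2R\<^esub> (\<gamma> i) \<in> carrier PSL2R" for i using \<gamma>_carrier by simp
  show ?thesis
    unfolding iffG
  proof (intro conjI allI ballI impI)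
    fix \<tau> assume "\<tau> \<notin> uhp"
    then have "lift_form w \<gamma> X \<tau> = 0" by (simp add: lift_form_def slash_def vec_eq_iff)
    then show "matrix_inv P *v lift_form w \<gamma> X \<tau> = 0" by simp
  next
    fix \<xi>
    have "(\<lambda>\<tau>. lift_form w \<gamma> X \<tau> $ r) holomorphic_on uhp" for r
      unfolding lift_form_def vec_lambda_beta using X by (intro holomorphic_on_slash inv_\<gamma> w) blast
    then show "(\<lambda>\<tau>. (matrix_inv P *v lift_form w \<gamma> X \<tau>) $ \<xi>) holomorphic_on uhp"
      by (rule holomorphic_on_matrix_vector)
  next
    fix g \<tau> assume g: "g \<in> G" and \<tau>: "\<tau> \<in> uhp"
    have "slash w (lift_form w \<gamma> X) g \<tau> = induced_rep H \<gamma> \<rho> g *v lift_form w \<gamma> X \<tau>"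
      using X by (intro slash_lift_form[OF w g \<tau>]) blast
    then show "slash w (\<lambda>\<tau>. matrix_inv P *v lift_form w \<gamma> X \<tau>) g \<tau> =
        conj_rep P (induced_rep H \<gamma> \<rho>) g *v (matrix_inv P *v lift_form w \<gamma> X \<tau>)"
      by (simp add: slash_matrix conj_rep_def matrix_inv_vector_cancel[OF P] flip: matrix_vector_mul_assoc)
  next
    fix c assume c: "cusp G c"
    have "cusp_growth w c (slash w X (inv\<^bsub>PSL2R\<^esub> (\<gamma> i)))" for i
    proof (rule cusp_growth_slash[OF inv_\<gamma> w])
      have "cusp G (bact (inv\<^bsub>PSL2R\<^esub> (\<gamma> i)) c)"
        by (rule cusp_bact(1)[OF subgroup_G discrete_G c G_inv[OF \<gamma>_in_G]])
      then show "cusp_growth w (bact (inv\<^bsub>PSL2R\<^esub> (\<gamma> i)) c) X" using X cusp_H_iff by blast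
    qed
    then have "cusp_growth w c (lift_form w \<gamma> X)"
      by (simp add: cusp_growth_blocks block_lift_form)
    then show "cusp_growth w c (\<lambda>\<tau>. matrix_inv P *v lift_form w \<gamma> X \<tau>)"
      by (rule cusp_growth_matrix)
  qed
qed

lemma block_i1_lift_form:
  assumes "even w" "\<And>\<tau>. \<tau> \<notin> uhp \<Longrightarrow> X \<tau> = 0"
  shows "block i1 (lift_form w \<gamma> X \<tau>) = X \<tau>"
  by (simp add: block_lift_form \<gamma>_i1 slash_one[OF assms])

text \<open>For \<open>h \<in> H\<close> the block \<open>(i1, i1)\<close> of the induced matrix is \<open>\<rho> h\<close> and it is alone in its row, so the
  block at \<open>i1\<close> of a form for \<open>G\<close> transforms under \<open>H\<close> by \<open>\<rho>\<close>. Lifting it gives back the whole form,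
  because in the induced matrix of \<open>\<gamma> i\<inverse>\<close> the nonzero block of the row \<open>i1\<close> is the identity, in column
  \<open>i\<close>.\<close>

lemma block_i1_in_wh_forms:
  fixes Y :: "complex \<Rightarrow> complex^('m \<times> 'd::finite)"
  assumes w: "even w" and hom: "\<rho> \<in> hom (PSL2R\<lparr>carrier := H\<rparr>) GL"
    and \<rho>: "cuspidally_diagonalizable H \<rho>" and P: "invertible P"
    and R: "cuspidally_diagonalizable G (conj_rep P (induced_rep H \<gamma> \<rho>))"
    and Y: "Y \<in> wh_forms G w (conj_rep P (induced_rep H \<gamma> \<rho>))"
  shows "(\<lambda>\<tau>. block i1 (P *v Y \<tau>)) \<in> wh_forms H w \<rho>"
    "matrix_inv P *v lift_form w \<gamma> (\<lambda>\<tau>. block i1 (P *v Y \<tau>)) \<tau> = Y \<tau>"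
proof -
  have InftyH: "cusp H Infty" using Infty_cusp cusp_H_iff by simp
  note iffH = wh_forms_iff_growth[OF subgroup_H discrete_H InftyH \<rho> w]
  note iffG = wh_forms_iff_growth[OF subgroup_G discrete_G Infty_cusp R w]
  note Y = Y[unfolded iffG]
  define Z where "Z = (\<lambda>\<tau>. P *v Y \<tau>)"
  have trans: "slash w Z g \<tau> = induced_rep H \<gamma> \<rho> g *v Z \<tau>" if "g \<in> G" "\<tau> \<in> uhp" for g \<tau>
  proof -
    have "slash w Z g \<tau> = P *v slash w Y g \<tau>" by (simp add: Z_def slash_matrix)
    also have "slash w Y g \<tau> = conj_rep P (induced_rep H \<gamma> \<rho>) g *v Y \<tau>" using Y that by blast
    finally show ?thesis
      by (simp add: Z_def conj_rep_def matrix_inv_vector_cancel[OF P] flip: matrix_vector_mul_assoc)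
  qed
  show "(\<lambda>\<tau>. block i1 (P *v Y \<tau>)) \<in> wh_forms H w \<rho>"
    unfolding iffH Z_def[symmetric]
  proof (intro conjI allI ballI impI)
    fix \<tau> assume "\<tau> \<notin> uhp"
    then have "Y \<tau> = 0" using Y by blast
    then show "block i1 (P *v Y \<tau>) = 0" by (simp add: block_zero)
  next
    fix \<xi>
    show "(\<lambda>\<tau>. block i1 (P *v Y \<tau>) $ \<xi>) holomorphic_on uhp"
      unfolding block_nth using Y by (intro holomorphic_on_matrix_vector) blast
  next
    fix h \<tau> assume h: "h \<in> H" and \<tau>: "\<tau> \<in> uhp"
    then have hG: "h \<in> G" using H_subset_G by blast
    have e: "entry i1 h i1 = h" using H_carrier[OF h] by (simp add: \<gamma>_i1)
    have "slash w (\<lambda>\<tau>. block i1 (Z \<tau>)) h \<tau> = block i1 (induced_rep H \<gamma> \<rho> h *v Z \<tau>)"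
      by (simp add: trans[OF hG \<tau>] flip: slash_block)
    also have "\<dots> = \<rho> h *v block i1 (Z \<tau>)"
      using block_induced_rep[OF hG, of i1 i1 \<rho> "Z \<tau>"] h unfolding e by simp
    finally show "slash w (\<lambda>\<tau>. block i1 (P *v Y \<tau>)) h \<tau> = \<rho> h *v block i1 (P *v Y \<tau>)"
      by (simp add: Z_def)
  next
    fix c assume "cusp H c"
    then have "cusp_growth w c Y" using Y cusp_H_iff by blast
    then have "cusp_growth w c (\<lambda>\<tau>. P *v Y \<tau>)" by (rule cusp_growth_matrix)
    then show "cusp_growth w c (\<lambda>\<tau>. block i1 (P *v Y \<tau>))" by (simp add: cusp_growth_blocks)
  qed
  have "lift_form w \<gamma> (\<lambda>\<tau>. block i1 (Z \<tau>)) \<tau> = Z \<tau>"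
  proof (cases "\<tau> \<in> uhp")
    case True
    show ?thesis
    proof (rule block_eqI)
      fix i
      have g: "inv\<^bsub>PSL2R\<^esub> (\<gamma> i) \<in> G" by (rule G_inv[OF \<gamma>_in_G])
      have e: "entry i1 (inv\<^bsub>PSL2R\<^esub> (\<gamma> i)) i = \<one>\<^bsub>PSL2R\<^esub>"
        using \<gamma>_carrier by (simp add: \<gamma>_i1)
      have "block i (lift_form w \<gamma> (\<lambda>\<tau>. block i1 (Z \<tau>)) \<tau>) =
          block i1 (induced_rep H \<gamma> \<rho> (inv\<^bsub>PSL2R\<^esub> (\<gamma> i)) *v Z \<tau>)"
        by (simp add: block_lift_form trans[OF g True] flip: slash_block)
      also have "\<dots> = \<rho> \<one>\<^bsub>PSL2R\<^esub> *v block i (Z \<tau>)"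
        using block_induced_rep[OF g, of i1 i \<rho> "Z \<tau>"] H_one unfolding e by simp
      finally show "block i (lift_form w \<gamma> (\<lambda>\<tau>. block i1 (Z \<tau>)) \<tau>) = block i (Z \<tau>)"
        by (simp add: hom_GL_one[OF subgroup_H hom])
    qed
  next
    case False
    then have "Y \<tau> = 0" using Y by blast
    then have "Z \<tau> = 0" by (simp add: Z_def)
    moreover have "lift_form w \<gamma> (\<lambda>\<tau>. block i1 (Z \<tau>)) \<tau> = 0"
      using False by (simp add: lift_form_def slash_def vec_eq_iff)
    ultimately show ?thesis by simp
  qed
  then show "matrix_inv P *v lift_form w \<gamma> (\<lambda>\<tau>. block i1 (P *v Y \<tau>)) \<tau> = Y \<tau>"
    by (simp add: Z_def matrix_inv_vector_cancel[OF P])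
qed

lemma lift_form_add:
  "lift_form w \<gamma> (\<lambda>\<tau>. X \<tau> + Y \<tau>) \<tau> = lift_form w \<gamma> X \<tau> + lift_form w \<gamma> Y \<tau>"
  by (simp add: lift_form_def slash_def vec_eq_iff distrib_left)

text \<open>Linearity over the function ring needs invariance under the representatives \<open>\<gamma> i\<inverse>\<close>, so scalars
  are taken from the ring of \<open>G\<close>, not of \<open>H\<close>.\<close>

lemma lift_form_smult:
  assumes "f \<in> carrier (fun_ring G)"
  shows "lift_form w \<gamma> (\<lambda>\<tau>. f \<tau> *s X \<tau>) \<tau> = f \<tau> *s lift_form w \<gamma> X \<tau>"
proof -
  have "f (moebius (inv\<^bsub>PSL2R\<^esub> (\<gamma> i)) \<tau>) = f \<tau>" if "\<tau> \<in> uhp" for i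
    using assms that G_inv[OF \<gamma>_in_G]
    unfolding fun_ring_carrier_iff[OF subgroup_G discrete_G Infty_cusp] by blast
  then show ?thesis by (simp add: lift_form_def slash_def vec_eq_iff)
qed

theorem lift_form_module_iso:
  fixes \<rho> :: "psl \<Rightarrow> complex^'d::finite^'d"
  assumes w: "even w" and \<rho>: "admissible H \<rho>" and P: "invertible P"
    and adm: "admissible G (conj_rep P (induced_rep H \<gamma> \<rho>))"
  shows "module_iso (fun_ring G) (wh_module H w \<rho>)
    (wh_module G w (conj_rep P (induced_rep H \<gamma> \<rho>))) (\<lambda>X \<tau>. matrix_inv P *v lift_form w \<gamma> X \<tau>)"
proof -
  note \<rho> = admissible_imp[OF subgroup_H discrete_H \<rho>]
  note R = admissible_imp(3)[OF subgroup_G discrete_G adm]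
  note to_G = lift_form_in_wh_forms[OF w \<rho>(3) P R]
  note to_H = block_i1_in_wh_forms[OF w \<rho>(1) \<rho>(3) P R]
  have "bij_betw (\<lambda>X \<tau>. matrix_inv P *v lift_form w \<gamma> X \<tau>)
      (wh_forms H w \<rho>) (wh_forms G w (conj_rep P (induced_rep H \<gamma> \<rho>)))"
  proof (rule bij_betwI[where g = "\<lambda>Y \<tau>. block i1 (P *v Y \<tau>)"])
    show "(\<lambda>X \<tau>. matrix_inv P *v lift_form w \<gamma> X \<tau>) \<in>
        wh_forms H w \<rho> \<rightarrow> wh_forms G w (conj_rep P (induced_rep H \<gamma> \<rho>))"
      using to_G by (rule Pi_I)
    show "(\<lambda>Y \<tau>. block i1 (P *v Y \<tau>)) \<in>
        wh_forms G w (conj_rep P (induced_rep H \<gamma> \<rho>)) \<rightarrow> wh_forms H w \<rho>"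
      using to_H(1) by (rule Pi_I)
    show "(\<lambda>\<tau>. block i1 (P *v (matrix_inv P *v lift_form w \<gamma> X \<tau>))) = X" if "X \<in> wh_forms H w \<rho>" for X
    proof -
      have "X \<tau> = 0" if "\<tau> \<notin> uhp" for \<tau> using \<open>X \<in> _\<close> that by (simp add: wh_forms_def)
      then show ?thesis by (simp add: matrix_inv_vector_cancel[OF P] block_i1_lift_form[OF w])
    qed
    show "(\<lambda>\<tau>. matrix_inv P *v lift_form w \<gamma> (\<lambda>\<tau>. block i1 (P *v Y \<tau>)) \<tau>) = Y"
      if "Y \<in> wh_forms G w (conj_rep P (induced_rep H \<gamma> \<rho>))" for Y
      using to_H(2)[OF that] by (rule ext)
  qed
  moreover have "module (fun_ring G) (wh_module H w \<rho>)"
    by (rule module_wh_module[OF subgroup_G discrete_G Infty_cusp subgroup_H H_subset_G cusp_H_iff \<rho>(3) w])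
  moreover have "module (fun_ring G) (wh_module G w (conj_rep P (induced_rep H \<gamma> \<rho>)))"
    by (rule module_wh_module[OF subgroup_G discrete_G Infty_cusp subgroup_G subset_refl refl R w])
  ultimately show ?thesis
    by (simp add: module_iso_def wh_module_simps lift_form_add lift_form_smult
        matrix_vector_right_distrib vector_scalar_commute)
qed

end

theorem theorem4p3:
  fixes G H :: "psl set"
    and \<rho> :: "psl \<Rightarrow> complex^'d::finite^'d"
    and \<gamma> :: "'m::finite \<Rightarrow> psl"
    and i1 :: 'm
    and w :: int
  assumes "fuchsian_first_kind G"
    and "cusp G Infty"
    and "subgroup H (PSL2R\<lparr>carrier := G\<rparr>)"
    and "card (lcosets\<^bsub>PSL2R\<lparr>carrier := G\<rparr>\<^esub> H) = CARD('m)"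
    and "coset_representatives G H i1 \<gamma>"
    and "admissible H \<rho>"
    and "even w"
  shows "(\<exists>P. invertible P \<and> admissible G (conj_rep P (induced_rep H \<gamma> \<rho>))) \<and>
         (\<forall>P. invertible P \<and> admissible G (conj_rep P (induced_rep H \<gamma> \<rho>)) \<longrightarrow>
            module_iso (fun_ring G) (wh_module H w \<rho>)
              (wh_module G w (conj_rep P (induced_rep H \<gamma> \<rho>)))
              (\<lambda>X \<tau>. matrix_inv P *v lift_form w \<gamma> X \<tau>))"
proof -
  interpret finite_index_subgroup G H \<gamma> i1
    using assms(1,2,3,5) by (rule finite_index_subgroup.intro)
  show ?thesis
    using induced_rep_admissible lift_form_module_iso assms by blast
qed

end
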